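(* Let $(W,S)$ be an arbitrary Coxeter system, $I\subseteq S$ arbitrary, and use the notation of the context. 1. For all $x,y\in\mathcal V(C)$, $C_{y,x}=W^{\perp[y]}\cdot Y_{y,x}=Y_{y,x}\cdot W^{\perp[x]}$. Hence $C_{x,x}=W^{\perp[x]}\rtimes Y_{x,x}$ (with $W^{\perp[x]}$ normal). 2. The groupoid $Y$ is generated by all the non-loop generators of $C$, and $Y_{y,x}=\{w\in C_{y,x}\mid\mathsf{lp}(w)=0\}$ for all $x,y\in\mathcal V(C)$. Moreover, for any $w\in Y$: (i) any two standard expressions of $w$ by non-loop generators can be converted into each other using only generalized braid moves that contain no loop generators; (ii) any expression of $w$ as a product of non-loop generators can be converted into any given standard expression of $w$ by non-loop generators using only generalized braid moves that contain no loop generators and cancellations of subwords $w_\xi w_{\varphi(\xi)}$ (no insertions). 3. Let $x\in\mathcal V(C)$. The length of $w\in W^{\perp[x]}$ with respect to the generating set $R^{[x]}$ equals $\mathsf{lp}(w)$, and $$R^{[x]}=\{w s_\gamma w^{-1}\mid s_\gamma\in C_{y,y}\text{ is a loop generator and }w\in Y_{x,y}\text{ for some }y\in\mathcal V(C)\}.$$ Moreover, every $w\in W^{\perp[x]}$ admits an expression $(w_1s_{\gamma_1}w_1^{-1})\cdots(w_ns_{\gamma_n}w_n^{-1})$ with $n=\mathsf{lp}(w)$ and with each factor of the form appearing in the displayed set, such that the expression in the generators of $C$ obtained by replacing each of $w_1$, $w_i^{-1}w_{i+1}$ ($1\le i\le n-1$), $w_n^{-1}$ with its standard expression is also standard. 4.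 If $w\in Y_{y,x}$, then $u\mapsto wuw^{-1}$ is an isomorphism of Coxeter systems from $(W^{\perp[x]},R^{[x]})$ to $(W^{\perp[y]},R^{[y]})$.
   Context: **Coxeter groups.** $(W,S)$ is a Coxeter system, $S$ possibly infinite; $m_{s,t}$ is the order of $st$; $\ell$ is the length function; $\Gamma$ is the Coxeter graph ($s\ne t$ adjacent iff $m_{s,t}\ge 3$, including $\infty$). $V$ is the real space with basis $\{\alpha_s\mid s\in S\}$ and form $\langle\alpha_s,\alpha_t\rangle=-\cos(\pi/m_{s,t})$ ($=-1$ if $m_{s,t}=\infty$); $W$ acts by $s\cdot v=v-2\langle\alpha_s,v\rangle\alpha_s$. $\Phi=\{w\cdot\alpha_s\}$ is the root system, $\Phi^+$ the positive roots, $\Phi^-=-\Phi^+$, $\Psi^{\pm}=\Psi\cap\Phi^{\pm}$ for $\Psi\subseteq\Phi$; $s_\gamma=wsw^{-1}$ for $\gamma=w\cdot\alpha_s$. For $J\subseteq S$, $W_J=\langle J\rangle$; $J$ is of finite type if $W_J$ is finite, and then $w_0(J)$ is the longest element of $W_J$. For $J,K\subseteq S$, $J_{\sim K}$ is the union of those connected components of the full subgraph of $\Gamma$ on $J\cup K$ which meet $K$; $J_{\sim s}=J_{\sim\{s\}}$. **Orthogonal part.** For $J\subseteq S$, $\Phi^{\perp J}=\{\gamma\in\Phi\mid\langle\gamma,\alpha_s\rangle=0\ \forall s\in J\}$, $W^{\perp J}=\langle s_\gamma\mid\gamma\in\Phi^{\perp J}\rangle$. It is known that $(W^{\perp J},R^J)$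 is a Coxeter system, where $R^J$ consists of the $s_\gamma$ with $\gamma\in(\Phi^{\perp J})^+$ such that in any expression $\gamma=\sum_i c_i\beta_i$ with $c_i>0$, $\beta_i\in(\Phi^{\perp J})^+$, all $\beta_i=\gamma$. An isomorphism of Coxeter systems is a group isomorphism mapping the one generating set onto the other. **Groupoids.** Fix a set $\Lambda$ with $|\Lambda|=|I|$. $S^{(\Lambda)}$ is the set of injections $x:\Lambda\to S$, $x_\lambda=x(\lambda)$, $[x]=x(\Lambda)$. Fix $x_I\in S^{(\Lambda)}$ with $[x_I]=I$. For $x,y\in S^{(\Lambda)}$ put $C_{x,y}=\{w\in W\mid\alpha_{x_\lambda}=w\cdot\alpha_{y_\lambda}\ \forall\lambda\}$, $\mathcal V(C)=\{x\mid C_{x,x_I}\ne\emptyset\}$. $C=\{C_{x,y}\}_{x,y\in\mathcal V(C)}$ is a groupoid under multiplication in $W$ (elements of $C_{x,y}$ have source $y$, target $x$; write $x=w\cdot y$). $Y$ is the subgroupoid with the same vertices and $Y_{x,y}=\{w\in C_{x,y}\mid w\cdot(\Phi^{\perp[y]})^+\subseteq\Phi^+\}$. **Generators.** For a pair $\xi=(x,s)$ with $x\in\mathcal V(C)$, $s\in S\smallsetminus[x]$, $[x]_{\sim s}$ of finite type, let $w_\xi=w_x^s=w_0([x]_{\sim s})w_0([x]_{\sim s}\smallsetminus\{s\})$; it lies in $C_{y,x}$ for a unique $y\in\mathcal V(C)$. Put $\varphi(\xi)=(y,t)$ where $\{t\}=([x]\cup\{s\})\smallsetminus[y]$; then $w_\xi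 w_{\varphi(\xi)}=1$. The $w_\xi$ generate $C$; $w_x^s$ is a loop generator if $w_x^s\cdot x=x$, and a non-loop generator otherwise. Each loop generator $w_x^s$ is a reflection $s_\gamma$ for a unique positive root $\gamma$, and $\gamma\in\Phi^{\perp[x]}$. **Expressions.** An expression of $w\in C$ is a composable product $w=w_{\xi_1}\cdots w_{\xi_n}$; it is standard if $\ell(w)=\sum_i\ell(w_{\xi_i})$. Every $w\in C$ has a standard expression; $\mathsf{lp}(w)$ is the number of loop generators in a standard expression of $w$ (independent of the choice). If $x\in\mathcal V(C)$, $s\neq t$ in $S\smallsetminus[x]$ and $K=[x]_{\sim\{s,t\}}$ is of finite type, then $w_0(K)w_0(K\smallsetminus\{s,t\})$ is an element of $C$ with source $x$ having exactly two standard expressions in $C$. A generalized braid move is the replacement, inside an expression, of one of these two standard expressions by the other; it contains no loop generators if neither of the two contains one. *)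

theory Defs
  imports Complex_Main "HOL-Algebra.Algebra" "HOL-Library.Poly_Mapping"
begin

section \<open>Coxeter systems\<close>

definition word_prod :: "('a, 'b) monoid_scheme \<Rightarrow> 'a list \<Rightarrow> 'a" where
  "word_prod G ws = foldr (\<lambda>u v. u \<otimes>\<^bsub>G\<^esub> v) ws \<one>\<^bsub>G\<^esub>"

text \<open>Used only for generating sets consisting of involutions, so that inverses of
  generators need not be allowed in words.\<close>
definition word_length :: "('a, 'b) monoid_scheme \<Rightarrow> 'a set \<Rightarrow> 'a \<Rightarrow> nat" where
  "word_length G R w = (LEAST n. \<exists>ws \<in> lists R. length ws = n \<and> word_prod G ws = w)"

text \<open>The order of $st$; the value 0 encodes infinite order, as for \<^term>\<open>group.ord\<close>.\<close>
definition cox_m :: "('a, 'b) monoid_scheme \<Rightarrow> 'a \<Rightarrow> 'a \<Rightarrow> nat" where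
  "cox_m W s t = group.ord W (s \<otimes>\<^bsub>W\<^esub> t)"

text \<open>The congruence on words over \<open>S\<close> generated by the relations $(st)^{m_{s,t}} = 1$,
  for all $s, t$ with $m_{s,t}$ finite.  The case $s = t$ gives $s s = 1$, so formal inverses
  are not needed and the quotient monoid is the group with this presentation.\<close>
inductive cox_equiv :: "('a, 'b) monoid_scheme \<Rightarrow> 'a set \<Rightarrow> 'a list \<Rightarrow> 'a list \<Rightarrow> bool"
  for W S where
  refl: "cox_equiv W S u u"
| sym: "cox_equiv W S u v \<Longrightarrow> cox_equiv W S v u"
| trans: "cox_equiv W S u v \<Longrightarrow> cox_equiv W S v w \<Longrightarrow> cox_equiv W S u w"
| relator: "s \<in> S \<Longrightarrow> t \<in> S \<Longrightarrow> cox_m W s t \<noteq> 0 \<Longrightarrow>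
    cox_equiv W S (u @ concat (replicate (cox_m W s t) [s, t]) @ v) (u @ v)"

locale coxeter_system = group W for W (structure) +
  fixes S
  assumes gens_subset: "S \<subseteq> carrier W"
    and gens_nontrivial: "s \<in> S \<Longrightarrow> s \<noteq> \<one>"
    and gens_involution: "s \<in> S \<Longrightarrow> s \<otimes> s = \<one>"
    and gens_generate: "generate W S = carrier W"
    and presentation: "ws \<in> lists S \<Longrightarrow> word_prod W ws = \<one> \<Longrightarrow> cox_equiv W S ws []"

definition coxeter_isos ::
    "('a, 'b) monoid_scheme \<Rightarrow> 'a set \<Rightarrow> ('c, 'd) monoid_scheme \<Rightarrow> 'c set \<Rightarrow> ('a \<Rightarrow> 'c) set" where
  "coxeter_isos G R H T = {f \<in> iso G H. f ` R = T}"

definition semidirect :: "('a, 'b) monoid_scheme \<Rightarrow> 'a set \<Rightarrow> 'a set \<Rightarrow> bool" where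
  "semidirect G N H \<longleftrightarrow> N \<lhd> G \<and> subgroup H G \<and> N \<inter> H = {\<one>\<^bsub>G\<^esub>} \<and> N <#>\<^bsub>G\<^esub> H = carrier G"


section \<open>The geometric representation and the root system\<close>

text \<open>Vectors are the finitely supported functions; those occurring below are supported on \<open>S\<close>.\<close>
type_synonym 'a vec = "'a \<Rightarrow>\<^sub>0 real"

definition simple_root :: "'a \<Rightarrow> 'a vec" where
  "simple_root s = Poly_Mapping.single s 1"

definition form :: "('a, 'b) monoid_scheme \<Rightarrow> 'a vec \<Rightarrow> 'a vec \<Rightarrow> real" where
  "form W u v = (\<Sum>s \<in> Poly_Mapping.keys u. \<Sum>t \<in> Poly_Mapping.keys v.
     Poly_Mapping.lookup u s * Poly_Mapping.lookup v t *
     (if cox_m W s t = 0 then - 1 else - cos (pi / real (cox_m W s t))))"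

definition scale_vec :: "real \<Rightarrow> 'a vec \<Rightarrow> 'a vec" where
  "scale_vec c v = Poly_Mapping.map (\<lambda>r. c * r) v"

definition simple_act :: "('a, 'b) monoid_scheme \<Rightarrow> 'a \<Rightarrow> 'a vec \<Rightarrow> 'a vec" where
  "simple_act W s v = v - scale_vec (2 * form W (simple_root s) v) (simple_root s)"

text \<open>The result does not depend on the word chosen for \<open>w\<close>.\<close>
definition act :: "('a, 'b) monoid_scheme \<Rightarrow> 'a set \<Rightarrow> 'a \<Rightarrow> 'a vec \<Rightarrow> 'a vec" where
  "act W S w v = (THE v'. \<exists>ws \<in> lists S. word_prod W ws = w \<and> v' = foldr (simple_act W) ws v)"

definition roots :: "('a, 'b) monoid_scheme \<Rightarrow> 'a set \<Rightarrow> 'a vec set" where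
  "roots W S = {act W S w (simple_root s) | w s. w \<in> carrier W \<and> s \<in> S}"

definition pos_roots :: "('a, 'b) monoid_scheme \<Rightarrow> 'a set \<Rightarrow> 'a vec set" where
  "pos_roots W S = {\<gamma> \<in> roots W S. \<forall>s. 0 \<le> Poly_Mapping.lookup \<gamma> s}"

definition reflection :: "('a, 'b) monoid_scheme \<Rightarrow> 'a set \<Rightarrow> 'a vec \<Rightarrow> 'a" where
  "reflection W S \<gamma> = (THE r. \<exists>w \<in> carrier W. \<exists>s \<in> S.
     \<gamma> = act W S w (simple_root s) \<and> r = w \<otimes>\<^bsub>W\<^esub> s \<otimes>\<^bsub>W\<^esub> inv\<^bsub>W\<^esub> w)"

definition finite_type :: "('a, 'b) monoid_scheme \<Rightarrow> 'a set \<Rightarrow> bool" where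
  "finite_type W J \<longleftrightarrow> finite (generate W J)"

definition longest :: "('a, 'b) monoid_scheme \<Rightarrow> 'a set \<Rightarrow> 'a set \<Rightarrow> 'a" where
  "longest W S J = (THE w. w \<in> generate W J \<and>
     (\<forall>u \<in> generate W J. word_length W S u \<le> word_length W S w))"

definition cox_adj :: "('a, 'b) monoid_scheme \<Rightarrow> ('a \<times> 'a) set" where
  "cox_adj W = {(s, t). s \<noteq> t \<and> (cox_m W s t = 0 \<or> 3 \<le> cox_m W s t)}"

text \<open>$J_{\sim K}$\<close>
definition components :: "('a, 'b) monoid_scheme \<Rightarrow> 'a set \<Rightarrow> 'a set \<Rightarrow> 'a set" where
  "components W J K = {s. \<exists>k \<in> K. (k, s) \<in> (cox_adj W \<inter> (J \<union> K) \<times> (J \<union> K))\<^sup>*}"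


section \<open>The orthogonal part\<close>

definition perp_roots :: "('a, 'b) monoid_scheme \<Rightarrow> 'a set \<Rightarrow> 'a set \<Rightarrow> 'a vec set" where
  "perp_roots W S J = {\<gamma> \<in> roots W S. \<forall>s \<in> J. form W \<gamma> (simple_root s) = 0}"

definition perp_pos_roots :: "('a, 'b) monoid_scheme \<Rightarrow> 'a set \<Rightarrow> 'a set \<Rightarrow> 'a vec set" where
  "perp_pos_roots W S J = perp_roots W S J \<inter> pos_roots W S"

definition Wperp :: "('a, 'b) monoid_scheme \<Rightarrow> 'a set \<Rightarrow> 'a set \<Rightarrow> 'a set" where
  "Wperp W S J = generate W (reflection W S ` perp_roots W S J)"

definition perp_simple_roots :: "('a, 'b) monoid_scheme \<Rightarrow> 'a set \<Rightarrow> 'a set \<Rightarrow> 'a vec set" where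
  "perp_simple_roots W S J = {\<gamma> \<in> perp_pos_roots W S J.
     \<forall>(n::nat) c \<beta>. (\<forall>i<n. 0 < c i \<and> \<beta> i \<in> perp_pos_roots W S J) \<and>
       \<gamma> = (\<Sum>i<n. scale_vec (c i) (\<beta> i)) \<longrightarrow> (\<forall>i<n. \<beta> i = \<gamma>)}"

definition Rperp :: "('a, 'b) monoid_scheme \<Rightarrow> 'a set \<Rightarrow> 'a set \<Rightarrow> 'a set" where
  "Rperp W S J = reflection W S ` perp_simple_roots W S J"


section \<open>The groupoids\<close>

text \<open>\<open>\<Lambda>\<close> is a set in an arbitrary type.  Injections $x : \Lambda \to S$ are represented by
  functions that are undefined outside \<open>\<Lambda>\<close>, so that equality of functions is equality of
  injections; $[x]$ is \<^term>\<open>x ` \<Lambda>\<close>.  The parameter \<open>b\<close> below is the base vertex $x_I$.\<close>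
definition injections :: "'a set \<Rightarrow> 'l set \<Rightarrow> ('l \<Rightarrow> 'a) set" where
  "injections S \<Lambda> = {x \<in> \<Lambda> \<rightarrow>\<^sub>E S. inj_on x \<Lambda>}"

text \<open>In \<open>Cset W S \<Lambda> x y\<close> and \<open>Yset W S \<Lambda> x y\<close> the target is \<open>x\<close> and the source is \<open>y\<close>.\<close>
definition Cset :: "('a, 'b) monoid_scheme \<Rightarrow> 'a set \<Rightarrow> 'l set \<Rightarrow> ('l \<Rightarrow> 'a) \<Rightarrow> ('l \<Rightarrow> 'a) \<Rightarrow> 'a set" where
  "Cset W S \<Lambda> x y = {w \<in> carrier W. \<forall>l \<in> \<Lambda>. simple_root (x l) = act W S w (simple_root (y l))}"

definition verts :: "('a, 'b) monoid_scheme \<Rightarrow> 'a set \<Rightarrow> 'l set \<Rightarrow> ('l \<Rightarrow> 'a) \<Rightarrow> ('l \<Rightarrow> 'a) set" where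
  "verts W S \<Lambda> b = {x \<in> injections S \<Lambda>. Cset W S \<Lambda> x b \<noteq> {}}"

definition Yset :: "('a, 'b) monoid_scheme \<Rightarrow> 'a set \<Rightarrow> 'l set \<Rightarrow> ('l \<Rightarrow> 'a) \<Rightarrow> ('l \<Rightarrow> 'a) \<Rightarrow> 'a set" where
  "Yset W S \<Lambda> x y = {w \<in> Cset W S \<Lambda> x y.
     act W S w ` perp_pos_roots W S (y ` \<Lambda>) \<subseteq> pos_roots W S}"

text \<open>The subgroupoid, with vertex set \<open>V\<close>, of the groupoid with composition in \<open>W\<close> that is
  generated by the arrows \<open>A y x w\<close> (with target \<open>y\<close> and source \<open>x\<close>).\<close>
inductive groupoid_gen ::
    "('a, 'b) monoid_scheme \<Rightarrow> 'v set \<Rightarrow> ('v \<Rightarrow> 'v \<Rightarrow> 'a \<Rightarrow> bool) \<Rightarrow> 'v \<Rightarrow> 'v \<Rightarrow> 'a \<Rightarrow> bool"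
  for W V A where
  ident: "x \<in> V \<Longrightarrow> groupoid_gen W V A x x \<one>\<^bsub>W\<^esub>"
| incl: "x \<in> V \<Longrightarrow> y \<in> V \<Longrightarrow> A y x w \<Longrightarrow> groupoid_gen W V A y x w"
| inverse: "groupoid_gen W V A y x w \<Longrightarrow> groupoid_gen W V A x y (inv\<^bsub>W\<^esub> w)"
| comp: "groupoid_gen W V A z y w \<Longrightarrow> groupoid_gen W V A y x u \<Longrightarrow>
    groupoid_gen W V A z x (w \<otimes>\<^bsub>W\<^esub> u)"


section \<open>Generators of the groupoid and expressions\<close>

type_synonym ('l, 'a) gen = "('l \<Rightarrow> 'a) \<times> 'a"

definition gens :: "('a, 'b) monoid_scheme \<Rightarrow> 'a set \<Rightarrow> 'l set \<Rightarrow> ('l \<Rightarrow> 'a) \<Rightarrow> ('l, 'a) gen set" where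
  "gens W S \<Lambda> b = {(x, s). x \<in> verts W S \<Lambda> b \<and> s \<in> S - x ` \<Lambda> \<and>
     finite_type W (components W (x ` \<Lambda>) {s})}"

definition gen_elt :: "('a, 'b) monoid_scheme \<Rightarrow> 'a set \<Rightarrow> 'l set \<Rightarrow> ('l, 'a) gen \<Rightarrow> 'a" where
  "gen_elt W S \<Lambda> \<xi> = (let K = components W (fst \<xi> ` \<Lambda>) {snd \<xi>} in
     longest W S K \<otimes>\<^bsub>W\<^esub> longest W S (K - {snd \<xi>}))"

definition gen_tgt ::
    "('a, 'b) monoid_scheme \<Rightarrow> 'a set \<Rightarrow> 'l set \<Rightarrow> ('l \<Rightarrow> 'a) \<Rightarrow> ('l, 'a) gen \<Rightarrow> 'l \<Rightarrow> 'a" where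
  "gen_tgt W S \<Lambda> b \<xi> = (THE y. y \<in> verts W S \<Lambda> b \<and> gen_elt W S \<Lambda> \<xi> \<in> Cset W S \<Lambda> y (fst \<xi>))"

text \<open>$\varphi(\xi)$\<close>
definition gen_inv ::
    "('a, 'b) monoid_scheme \<Rightarrow> 'a set \<Rightarrow> 'l set \<Rightarrow> ('l \<Rightarrow> 'a) \<Rightarrow> ('l, 'a) gen \<Rightarrow> ('l, 'a) gen" where
  "gen_inv W S \<Lambda> b \<xi> = (let y = gen_tgt W S \<Lambda> b \<xi> in
     (y, THE t. {t} = (fst \<xi> ` \<Lambda> \<union> {snd \<xi>}) - y ` \<Lambda>))"

definition loop_gens :: "('a, 'b) monoid_scheme \<Rightarrow> 'a set \<Rightarrow> 'l set \<Rightarrow> ('l \<Rightarrow> 'a) \<Rightarrow> ('l, 'a) gen set" where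
  "loop_gens W S \<Lambda> b = {\<xi> \<in> gens W S \<Lambda> b. gen_tgt W S \<Lambda> b \<xi> = fst \<xi>}"

definition nonloop_gens :: "('a, 'b) monoid_scheme \<Rightarrow> 'a set \<Rightarrow> 'l set \<Rightarrow> ('l \<Rightarrow> 'a) \<Rightarrow> ('l, 'a) gen set" where
  "nonloop_gens W S \<Lambda> b = gens W S \<Lambda> b - loop_gens W S \<Lambda> b"

definition nonloop_arrow ::
    "('a, 'b) monoid_scheme \<Rightarrow> 'a set \<Rightarrow> 'l set \<Rightarrow> ('l \<Rightarrow> 'a) \<Rightarrow> ('l \<Rightarrow> 'a) \<Rightarrow> ('l \<Rightarrow> 'a) \<Rightarrow> 'a \<Rightarrow> bool" where
  "nonloop_arrow W S \<Lambda> b y x w \<longleftrightarrow> (\<exists>\<xi> \<in> nonloop_gens W S \<Lambda> b.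
     fst \<xi> = x \<and> gen_tgt W S \<Lambda> b \<xi> = y \<and> gen_elt W S \<Lambda> \<xi> = w)"

text \<open>\<open>gen_path W S \<Lambda> b y \<xi>s x\<close>: the list \<open>\<xi>s\<close> is composable, with source \<open>x\<close> and target \<open>y\<close>.
  Lists are read like products in \<open>W\<close>: the last generator is applied first.\<close>
fun gen_path :: "('a, 'b) monoid_scheme \<Rightarrow> 'a set \<Rightarrow> 'l set \<Rightarrow> ('l \<Rightarrow> 'a) \<Rightarrow>
    ('l \<Rightarrow> 'a) \<Rightarrow> ('l, 'a) gen list \<Rightarrow> ('l \<Rightarrow> 'a) \<Rightarrow> bool" where
  "gen_path W S \<Lambda> b y [] x \<longleftrightarrow> y = x \<and> x \<in> verts W S \<Lambda> b"
| "gen_path W S \<Lambda> b y (\<xi> # \<xi>s) x \<longleftrightarrow>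
     \<xi> \<in> gens W S \<Lambda> b \<and> gen_tgt W S \<Lambda> b \<xi> = y \<and> gen_path W S \<Lambda> b (fst \<xi>) \<xi>s x"

definition expression :: "('a, 'b) monoid_scheme \<Rightarrow> 'a set \<Rightarrow> 'l set \<Rightarrow> ('l \<Rightarrow> 'a) \<Rightarrow>
    ('l \<Rightarrow> 'a) \<Rightarrow> ('l \<Rightarrow> 'a) \<Rightarrow> 'a \<Rightarrow> ('l, 'a) gen list \<Rightarrow> bool" where
  "expression W S \<Lambda> b y x w \<xi>s \<longleftrightarrow>
     gen_path W S \<Lambda> b y \<xi>s x \<and> word_prod W (map (gen_elt W S \<Lambda>) \<xi>s) = w"

definition standard_expression :: "('a, 'b) monoid_scheme \<Rightarrow> 'a set \<Rightarrow> 'l set \<Rightarrow> ('l \<Rightarrow> 'a) \<Rightarrow>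
    ('l \<Rightarrow> 'a) \<Rightarrow> ('l \<Rightarrow> 'a) \<Rightarrow> 'a \<Rightarrow> ('l, 'a) gen list \<Rightarrow> bool" where
  "standard_expression W S \<Lambda> b y x w \<xi>s \<longleftrightarrow> expression W S \<Lambda> b y x w \<xi>s \<and>
     word_length W S w = (\<Sum>\<xi>\<leftarrow>\<xi>s. word_length W S (gen_elt W S \<Lambda> \<xi>))"

text \<open>The same element of \<open>W\<close> may represent arrows with different sources, so
  $\mathsf{lp}$ takes the source \<open>x\<close> as an argument; the target is determined by \<open>x\<close> and \<open>w\<close>.\<close>
definition lp :: "('a, 'b) monoid_scheme \<Rightarrow> 'a set \<Rightarrow> 'l set \<Rightarrow> ('l \<Rightarrow> 'a) \<Rightarrow> ('l \<Rightarrow> 'a) \<Rightarrow> 'a \<Rightarrow> nat" where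
  "lp W S \<Lambda> b x w = (THE n. \<exists>y \<xi>s. standard_expression W S \<Lambda> b y x w \<xi>s \<and>
     n = length (filter (\<lambda>\<xi>. \<xi> \<in> loop_gens W S \<Lambda> b) \<xi>s))"

text \<open>The pairs consisting of the two standard expressions of a rank two element
  $w_0(K) w_0(K \smallsetminus \{s,t\})$.\<close>
definition braid_pair :: "('a, 'b) monoid_scheme \<Rightarrow> 'a set \<Rightarrow> 'l set \<Rightarrow> ('l \<Rightarrow> 'a) \<Rightarrow>
    ('l, 'a) gen list \<Rightarrow> ('l, 'a) gen list \<Rightarrow> bool" where
  "braid_pair W S \<Lambda> b p q \<longleftrightarrow> (\<exists>x \<in> verts W S \<Lambda> b. \<exists>s \<in> S - x ` \<Lambda>. \<exists>t \<in> S - x ` \<Lambda>. \<exists>y K.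
     s \<noteq> t \<and> K = components W (x ` \<Lambda>) {s, t} \<and> finite_type W K \<and> p \<noteq> q \<and>
     standard_expression W S \<Lambda> b y x (longest W S K \<otimes>\<^bsub>W\<^esub> longest W S (K - {s, t})) p \<and>
     standard_expression W S \<Lambda> b y x (longest W S K \<otimes>\<^bsub>W\<^esub> longest W S (K - {s, t})) q)"

text \<open>Generalized braid moves that contain no loop generators.\<close>
inductive nonloop_braid_move :: "('a, 'b) monoid_scheme \<Rightarrow> 'a set \<Rightarrow> 'l set \<Rightarrow> ('l \<Rightarrow> 'a) \<Rightarrow>
    ('l, 'a) gen list \<Rightarrow> ('l, 'a) gen list \<Rightarrow> bool" for W S \<Lambda> b where
  "braid_pair W S \<Lambda> b p q \<Longrightarrow> set p \<inter> loop_gens W S \<Lambda> b = {} \<Longrightarrow> set q \<inter> loop_gens W S \<Lambda> b = {} \<Longrightarrow>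
    nonloop_braid_move W S \<Lambda> b (u @ p @ v) (u @ q @ v)"

inductive cancel_move :: "('a, 'b) monoid_scheme \<Rightarrow> 'a set \<Rightarrow> 'l set \<Rightarrow> ('l \<Rightarrow> 'a) \<Rightarrow>
    ('l, 'a) gen list \<Rightarrow> ('l, 'a) gen list \<Rightarrow> bool" for W S \<Lambda> b where
  "\<xi> \<in> gens W S \<Lambda> b \<Longrightarrow> cancel_move W S \<Lambda> b (u @ [\<xi>, gen_inv W S \<Lambda> b \<xi>] @ v) (u @ v)"

definition loop_reflection :: "('a, 'b) monoid_scheme \<Rightarrow> 'a set \<Rightarrow> 'l set \<Rightarrow> ('l \<Rightarrow> 'a) \<Rightarrow>
    ('l \<Rightarrow> 'a) \<Rightarrow> 'a \<Rightarrow> 'a vec \<Rightarrow> bool" where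
  "loop_reflection W S \<Lambda> b y s \<gamma> \<longleftrightarrow>
     (y, s) \<in> loop_gens W S \<Lambda> b \<and> \<gamma> \<in> pos_roots W S \<and> gen_elt W S \<Lambda> (y, s) = reflection W S \<gamma>"

end

theory Submission
  imports Defs
begin

text \<open>
  Call the positive roots made negative by \<open>w\<close> its inversions; there are \<open>\<ell>(w)\<close> of them, and
  \<open>\<ell>(u v) = \<ell>(u) + \<ell>(v)\<close> iff every inversion of \<open>v\<close> is an inversion of \<open>u v\<close>.
  If \<open>w\<close> lies in $C_{y,x}$ and makes \<open>\<alpha>\<^sub>s\<close> negative, then it makes negative all positive
  roots supported in \<open>K\<close> $= [x]_{\sim s}$ and involving \<open>s\<close>.  Since these are finitely many and
  \<open>K\<close> is connected to \<open>s\<close>, the set \<open>K\<close> is of finite type, and $w_x^s$, whose inversions are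
  exactly these roots, splits off \<open>w\<close> on the right with lengths adding.  The same holds for two descents
  \<open>s, t\<close> at once, so the classical proofs of Matsumoto's theorem and of Tits' solution of
  the word problem carry over to the groupoid.

  A generator $w_x^s$ is a loop iff it has an inversion in $\Phi^{\perp[x]}$, and then it has exactly one,
  the root of which it is the reflection.  Hence $\mathsf{lp}(w)$ is the number of inversions of \<open>w\<close> in
  $\Phi^{\perp[x]}$.  The transports by \<open>Y\<close> of the roots of the loop generators therefore have the
  defining property of simple roots, namely that the reflection in such a root permutes the other positive
  roots of $\Phi^{\perp[x]}$, and the usual exchange argument applies to them.  Pulling the loop generators
  out of a standard expression to the left yields all factorizations in the theorem.
\<close>

section \<open>Vectors and the form\<close>

text \<open>Nothing about root systems is taken for granted: that the action is well defined, that
  every root is positive or negative, and that a loop generator is a reflection are all derived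
  here. The obstacle is that \<open>S\<close> and [x] may be infinite, so finiteness has to be
  proved before any longest element can be split off. The inversions of \<open>w\<close> only show
  that the positive roots of \<open>K\<close> involving \<open>s\<close> are finite in number. The
  parabolic subgroup of \<open>K\<close> without \<open>s\<close> permutes these roots, and it does
  so faithfully, because every letter of \<open>K\<close> is reached from \<open>s\<close> by
  reflecting such a root in a neighbouring letter. Hence this subgroup is finite, and
  \<open>w\<close> times its longest element inverts every positive root of \<open>K\<close>. For
  the reflection part, R^[x] is defined by indecomposability of roots, whereas lengths need
  generators with an exchange property. The transported loop roots are therefore studied first, and
  they are identified with the indecomposable roots only at the end: adding a decomposition to its
  mirror image in the root leaves no room for other summands.\<close>

abbreviation lk :: "'a vec \<Rightarrow> 'a \<Rightarrow> real" where "lk \<equiv> Poly_Mapping.lookup"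

lemma lookup_scale_vec [simp]: "lk (scale_vec c v) k = c * lk v k"
  unfolding scale_vec_def by (simp add: Poly_Mapping.map.rep_eq when_def)

lemmas vec_eq_iff = poly_mapping_eq_iff fun_eq_iff

lemma vec_eqI: "(\<And>k. lk u k = lk v k) \<Longrightarrow> u = v"
  by (rule poly_mapping_eqI)

lemmas lookup_vec = lookup_add lookup_minus lookup_sum

lemma scale_vec_simps [simp]:
  "scale_vec 1 v = v" "scale_vec 0 v = 0" "scale_vec c 0 = 0" "scale_vec (- 1) v = - v"
  "scale_vec a (scale_vec c v) = scale_vec (a * c) v"
  by (rule vec_eqI; simp)+

lemma scale_vec_diff: "scale_vec c (u - v) = scale_vec c u - scale_vec c v"
  and scale_vec_uminus: "scale_vec c (- v) = - scale_vec c v"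
  and scale_vec_left_diff: "scale_vec (a - c) v = scale_vec a v - scale_vec c v"
  and scale_vec_left_uminus: "scale_vec (- c) v = - scale_vec c v"
  by (rule vec_eqI; simp add: lookup_vec algebra_simps)+

lemma scale_vec_eq_0_iff: "scale_vec c v = 0 \<longleftrightarrow> c = 0 \<or> v = 0"
  by (auto simp: vec_eq_iff)

lemma lookup_simple_root: "lk (simple_root s) k = (if s = k then 1 else 0)"
  unfolding simple_root_def by (simp add: lookup_single when_def)

lemma keys_simple_root [simp]: "Poly_Mapping.keys (simple_root s) = {s}"
  unfolding simple_root_def by simp

lemma simple_root_inject [simp]: "simple_root s = simple_root t \<longleftrightarrow> s = t"
  by (metis keys_simple_root singleton_inject)

lemma simple_root_nonzero [simp]: "simple_root s \<noteq> 0"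
  by (metis keys_simple_root keys_zero insert_not_empty)

lemma vec_expand: "v = (\<Sum>k \<in> Poly_Mapping.keys v. scale_vec (lk v k) (simple_root k))"
proof (rule vec_eqI)
  fix j
  have "(\<Sum>k \<in> Poly_Mapping.keys v. lk v k * (if k = j then 1 else 0)) = lk v j"
    by (simp add: if_distrib[of "\<lambda>x. _ * x"] sum.delta not_in_keys_iff_lookup_eq_zero cong: if_cong)
  then show "lk v j = lk (\<Sum>k \<in> Poly_Mapping.keys v. scale_vec (lk v k) (simple_root k)) j"
    by (simp add: lookup_sum lookup_simple_root)
qed

definition linear_vec :: "('a vec \<Rightarrow> 'a vec) \<Rightarrow> bool" where
  "linear_vec f \<longleftrightarrow> (\<forall>u v. f (u + v) = f u + f v) \<and> (\<forall>c v. f (scale_vec c v) = scale_vec c (f v))"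

lemma linear_vecD:
  assumes "linear_vec f"
  shows "f (u + v) = f u + f v" "f (scale_vec c v) = scale_vec c (f v)"
    "f 0 = 0" "f (- v) = - f v" "f (u - v) = f u - f v" "f (sum h A) = (\<Sum>a\<in>A. f (h a))"
proof -
  have add: "\<And>u v. f (u + v) = f u + f v" and sc: "\<And>c v. f (scale_vec c v) = scale_vec c (f v)"
    using assms unfolding linear_vec_def by auto
  show "f (u + v) = f u + f v" "f (scale_vec c v) = scale_vec c (f v)" by (fact add sc)+
  show z: "f 0 = 0" using sc[of 0 0] by simp
  show n: "f (- v) = - f v" for v using sc[of "-1" v] by simp
  show "f (u - v) = f u - f v" using add[of u "- v"] n by simp
  show "f (sum h A) = (\<Sum>a\<in>A. f (h a))"
    by (induction A rule: infinite_finite_induct) (auto simp: z add)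
qed

lemma linear_vec_expand:
  assumes "linear_vec f"
  shows "f v = (\<Sum>k \<in> Poly_Mapping.keys v. scale_vec (lk v k) (f (simple_root k)))"
  by (subst vec_expand) (simp add: linear_vecD[OF assms])

lemma linear_vec_comp: "linear_vec f \<Longrightarrow> linear_vec g \<Longrightarrow> linear_vec (\<lambda>v. f (g v))"
  unfolding linear_vec_def by simp

definition cox_cos :: "('a, 'b) monoid_scheme \<Rightarrow> 'a \<Rightarrow> 'a \<Rightarrow> real" where
  "cox_cos W s t = (if cox_m W s t = 0 then - 1 else - cos (pi / real (cox_m W s t)))"

text \<open>\<open>form\<close> sums over the supports of its arguments, which change under addition
  and scaling. On a common larger index set the sums can be compared term by term.\<close>

lemma form_superset:
  assumes "finite A" "finite C" "Poly_Mapping.keys u \<subseteq> A" "Poly_Mapping.keys v \<subseteq> C"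
  shows "form W u v = (\<Sum>s\<in>A. \<Sum>t\<in>C. lk u s * lk v t * cox_cos W s t)"
proof -
  have "(\<Sum>t\<in>C. lk u s * lk v t * cox_cos W s t) =
      (\<Sum>t\<in>Poly_Mapping.keys v. lk u s * lk v t * cox_cos W s t)" for s
    by (rule sum.mono_neutral_right) (use assms in \<open>auto simp: not_in_keys_iff_lookup_eq_zero\<close>)
  moreover have "(\<Sum>s\<in>A. \<Sum>t\<in>Poly_Mapping.keys v. lk u s * lk v t * cox_cos W s t) =
      (\<Sum>s\<in>Poly_Mapping.keys u. \<Sum>t\<in>Poly_Mapping.keys v. lk u s * lk v t * cox_cos W s t)"
    by (rule sum.mono_neutral_right) (use assms in \<open>auto simp: not_in_keys_iff_lookup_eq_zero\<close>)
  ultimately show ?thesis unfolding form_def cox_cos_def by simp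
qed

lemma form_add_left: "form W (u + u') v = form W u v + form W u' v"
proof -
  let ?A = "Poly_Mapping.keys u \<union> Poly_Mapping.keys u'" and ?C = "Poly_Mapping.keys v"
  have "form W x v = (\<Sum>s\<in>?A. \<Sum>t\<in>?C. lk x s * lk v t * cox_cos W s t)"
    if "x \<in> {u + u', u, u'}" for x
    by (rule form_superset) (use that keys_add[of u u'] in auto)
  then show ?thesis by (simp add: lookup_add algebra_simps sum.distrib)
qed

lemma form_add_right: "form W u (v + v') = form W u v + form W u v'"
proof -
  let ?C = "Poly_Mapping.keys v \<union> Poly_Mapping.keys v'" and ?A = "Poly_Mapping.keys u"
  have "form W u x = (\<Sum>s\<in>?A. \<Sum>t\<in>?C. lk u s * lk x t * cox_cos W s t)"
    if "x \<in> {v + v', v, v'}" for x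
    by (rule form_superset) (use that keys_add[of v v'] in auto)
  then show ?thesis by (simp add: lookup_add algebra_simps sum.distrib)
qed

lemma keys_scale_vec: "Poly_Mapping.keys (scale_vec c v) \<subseteq> Poly_Mapping.keys v"
  by (auto simp: in_keys_iff)

lemma form_scale_left: "form W (scale_vec c u) v = c * form W u v"
proof -
  let ?A = "Poly_Mapping.keys u" and ?C = "Poly_Mapping.keys v"
  have "form W x v = (\<Sum>s\<in>?A. \<Sum>t\<in>?C. lk x s * lk v t * cox_cos W s t)"
    if "x \<in> {scale_vec c u, u}" for x
    by (rule form_superset) (use that keys_scale_vec[of c u] in auto)
  then show ?thesis by (simp add: algebra_simps sum_distrib_left)
qed

lemma form_scale_right: "form W u (scale_vec c v) = c * form W u v"
proof -
  let ?A = "Poly_Mapping.keys u" and ?C = "Poly_Mapping.keys v"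
  have "form W u x = (\<Sum>s\<in>?A. \<Sum>t\<in>?C. lk u s * lk x t * cox_cos W s t)"
    if "x \<in> {scale_vec c v, v}" for x
    by (rule form_superset) (use that keys_scale_vec[of c v] in auto)
  then show ?thesis by (simp add: algebra_simps sum_distrib_left)
qed

lemma form_uminus_left: "form W (- u) v = - form W u v"
  and form_uminus_right: "form W u (- v) = - form W u v"
  using form_scale_left[of W "-1"] form_scale_right[of W _ "-1"] by simp_all

lemma form_diff_left: "form W (u - u') v = form W u v - form W u' v"
  using form_add_left[of W u "- u'"] by (simp add: form_uminus_left)

lemma form_diff_right: "form W u (v - v') = form W u v - form W u v'"
  using form_add_right[of W u v "- v'"] by (simp add: form_uminus_right)

lemmas form_bilinear = form_add_left form_add_right form_scale_left form_scale_right
  form_uminus_left form_uminus_right form_diff_left form_diff_right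

lemma form_simple_root: "form W (simple_root s) (simple_root t) = cox_cos W s t"
  by (simp add: form_superset[of "{s}" "{t}"] lookup_simple_root)

lemma form_zero_left [simp]: "form W 0 v = 0" and form_zero_right [simp]: "form W u 0 = 0"
  by (simp_all add: form_def)

lemma form_sum_left: "form W (sum h A) v = (\<Sum>a\<in>A. form W (h a) v)"
  by (induction A rule: infinite_finite_induct) (auto simp: form_add_left)

lemma form_expand_left:
  "form W u v = (\<Sum>k\<in>Poly_Mapping.keys u. lk u k * form W (simple_root k) v)"
  by (subst vec_expand) (simp add: form_sum_left form_scale_left)

lemma linear_simple_act: "linear_vec (simple_act W s)"
  unfolding linear_vec_def simple_act_def
  by (auto simp: vec_eq_iff lookup_vec form_bilinear algebra_simps)

lemma linear_foldr_simple_act: "linear_vec (foldr (simple_act W) ws)"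
proof (induction ws)
  case (Cons s ws)
  then show ?case using linear_vec_comp[OF linear_simple_act Cons] by (simp add: comp_def)
qed (simp add: linear_vec_def)

section \<open>The geometric representation\<close>

text \<open>Chebyshev polynomials of the second kind, shifted so that
  \<open>cheb (cos \<theta>) n = sin (n \<theta>) / sin \<theta>\<close>.\<close>
fun cheb :: "real \<Rightarrow> nat \<Rightarrow> real" where
  "cheb a 0 = 0"
| "cheb a (Suc 0) = 1"
| "cheb a (Suc (Suc n)) = 2 * a * cheb a (Suc n) - cheb a n"

text \<open>The recurrence is the addition formula for \<open>sin\<close> at
  \<open>(n + 1) * \<theta>\<close> plus and minus \<open>\<theta>\<close>. With the denominator
  cleared, the identity also covers \<open>sin \<theta> = 0\<close>.\<close>

lemma cheb_cos: "cheb (cos \<theta>) n * sin \<theta> = sin (real n * \<theta>)"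
proof (induction "cos \<theta>" n rule: cheb.induct)
  case (3 n)
  have "cheb (cos \<theta>) (Suc (Suc n)) * sin \<theta> = 2 * cos \<theta> * sin (real (Suc n) * \<theta>) - sin (real n * \<theta>)"
    using 3 by (simp add: algebra_simps)
  also have "\<dots> = sin (real (Suc n) * \<theta> + \<theta>)"
  proof -
    have "sin (real n * \<theta>) = sin (real (Suc n) * \<theta> - \<theta>)" by (simp add: algebra_simps)
    then show ?thesis by (simp only: sin_add sin_diff) (simp add: algebra_simps)
  qed
  finally show ?case by (simp add: algebra_simps)
qed simp_all

text \<open>The limit case of angle 0, which stands for infinite order of \<open>s t\<close>, where
  the form takes the value -1.\<close>

lemma cheb_1: "cheb 1 n = real n"
  by (induction "1::real" n rule: cheb.induct) auto

text \<open>The last letter is \<open>t\<close> whatever the length: letters are added in front,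
  since \<open>foldr\<close> lets the last letter of a word act first.\<close>

fun alt_word :: "'a \<Rightarrow> 'a \<Rightarrow> nat \<Rightarrow> 'a list" where
  "alt_word s t 0 = []"
| "alt_word s t (Suc n) = (if even n then t else s) # alt_word s t n"

lemma length_alt_word [simp]: "length (alt_word s t n) = n"
  by (induction n) auto

lemma set_alt_word: "set (alt_word s t n) \<subseteq> {s, t}"
  by (induction n) auto

lemma alt_word_snoc: "alt_word s t (Suc n) = alt_word t s n @ [t]"
  by (induction n) auto

lemma alt_word_even: "alt_word s t (2 * n) = concat (replicate n [s, t])"
  by (induction n) (auto simp del: alt_word.simps(2) simp: alt_word.simps(2)[of s t])

lemma alt_word_append:
  "alt_word s t (k + n) = (if even n then alt_word s t k else alt_word t s k) @ alt_word s t n"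
  by (induction k) auto

text \<open>The plane spanned by the two simple roots is stable, and each reflection replaces one of
  the two coordinates by \<open>2 * a\<close> times the other minus itself, which is the recurrence
  of \<open>cheb\<close>.\<close>

lemma foldr_alt_word:
  assumes "cox_cos W s s = 1" "cox_cos W t t = 1" "cox_cos W s t = - a" "cox_cos W t s = - a"
  shows "foldr (simple_act W) (alt_word s t k) (simple_root s) =
    (if even k then scale_vec (cheb a (Suc k)) (simple_root s) + scale_vec (cheb a k) (simple_root t)
     else scale_vec (cheb a k) (simple_root s) + scale_vec (cheb a (Suc k)) (simple_root t))"
proof (induction k)
  case (Suc k)
  then show ?case
    using assms by (cases "even k") (simp_all add: simple_act_def form_bilinear form_simple_root,
      (rule vec_eqI, simp add: lookup_vec algebra_simps)+)
qed simp

context coxeter_system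
begin

lemma cox_m_refl: "s \<in> S \<Longrightarrow> cox_m W s s = 1"
  unfolding cox_m_def using gens_involution by simp

lemma gens_carrier [simp]: "s \<in> S \<Longrightarrow> s \<in> carrier W"
  using gens_subset by auto

lemma gens_inv [simp]: "s \<in> S \<Longrightarrow> inv s = s"
  using gens_involution by (intro inv_unique'[symmetric]) auto

lemma cox_m_sym: "s \<in> S \<Longrightarrow> t \<in> S \<Longrightarrow> cox_m W s t = cox_m W t s"
  unfolding cox_m_def by (metis gens_carrier gens_inv inv_mult_group m_closed ord_inv)

lemma cox_m_neq_1: "s \<in> S \<Longrightarrow> t \<in> S \<Longrightarrow> s \<noteq> t \<Longrightarrow> cox_m W s t \<noteq> 1"
  unfolding cox_m_def by (metis gens_carrier gens_inv inv_equality inv_inv m_closed ord_eq_1)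

lemma cox_cos_refl [simp]: "s \<in> S \<Longrightarrow> cox_cos W s s = 1"
  unfolding cox_cos_def by (simp add: cox_m_refl)

lemma cox_cos_sym: "s \<in> S \<Longrightarrow> t \<in> S \<Longrightarrow> cox_cos W s t = cox_cos W t s"
  unfolding cox_cos_def by (simp add: cox_m_sym)

lemma simple_act_simple_act: "s \<in> S \<Longrightarrow> simple_act W s (simple_act W s v) = v"
  unfolding simple_act_def
  by (auto simp: vec_eq_iff lookup_vec form_bilinear form_simple_root algebra_simps)

text \<open>Split \<open>v\<close> into a vector of the plane of the two simple roots and a vector
  orthogonal to both, which is possible because \<open>sin \<theta>\<close> is not 0. Both
  reflections fix the second part; on the plane the Chebyshev values around \<open>2 * m\<close>
  give the identity.\<close>

lemma foldr_relator:
  assumes s: "s \<in> S" and t: "t \<in> S" and m: "cox_m W s t \<noteq> 0"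
  shows "foldr (simple_act W) (concat (replicate (cox_m W s t) [s, t])) v = v"
proof (cases "s = t")
  case True
  then show ?thesis using cox_m_refl s by (simp add: simple_act_simple_act)
next
  case False
  define m where "m = cox_m W s t"
  have m2: "2 \<le> m" using cox_m_neq_1[OF s t False] m unfolding m_def by linarith
  define \<theta> where "\<theta> = pi / real m"
  define a where "a = cos \<theta>"
  have \<theta>: "0 < \<theta>" "\<theta> \<le> pi / 2" unfolding \<theta>_def using m2 by (auto simp: field_simps)
  have sin: "0 < sin \<theta>" by (rule sin_gt_zero) (use \<theta> pi_gt_zero in linarith)+
  have st: "cox_cos W s t = - a" unfolding cox_cos_def a_def \<theta>_def using m m_def by simp
  have ts: "cox_cos W t s = - a" using st cox_cos_sym s t by simp
  have mt: "real m * \<theta> = pi" unfolding \<theta>_def using m2 by simp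
  have c2m: "cheb a (2 * m) = 0"
  proof -
    have "cheb a (2 * m) * sin \<theta> = sin (2 * pi)"
      unfolding a_def cheb_cos using mt by (simp add: mult.assoc)
    then show ?thesis using sin by simp
  qed
  have c2m1: "cheb a (2 * m - 1) = - 1"
  proof -
    have "real (2 * m - 1) * \<theta> = 2 * pi - \<theta>" using mt m2 by (simp add: of_nat_diff algebra_simps)
    then have "cheb a (2 * m - 1) * sin \<theta> = - sin \<theta>" unfolding a_def cheb_cos by (simp add: sin_diff)
    then have "(cheb a (2 * m - 1) + 1) * sin \<theta> = 0" by (simp add: algebra_simps)
    then show ?thesis using sin by (simp add: mult_eq_0_iff)
  qed
  have c2mS: "cheb a (Suc (2 * m)) = 1"
  proof -
    obtain k where k: "2 * m = Suc k" using m2 by (cases "2 * m") auto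
    then show ?thesis using c2m c2m1 by simp
  qed
  define f where "f = foldr (simple_act W) (concat (replicate m [s, t]))"
  have lin: "linear_vec f" unfolding f_def by (rule linear_foldr_simple_act)
  have fs: "f (simple_root s) = simple_root s"
    unfolding f_def alt_word_even[symmetric]
    by (subst foldr_alt_word[OF _ _ st ts]) (use s t c2m c2mS in simp_all)
  \<comment> \<open>\<open>foldr_alt_word\<close> starts from the root of the letter in which the
    word does not end. For \<open>t\<close> the last letter is therefore applied by hand, which
    gives a sign, and the remaining word of length \<open>2 * m - 1\<close> ends in
    \<open>s\<close>.\<close>
  have ft: "f (simple_root t) = simple_root t"
  proof -
    obtain k where k: "2 * m = Suc k" using m2 by (cases "2 * m") auto
    have k': "odd k" using k by presburger
    have "f (simple_root t) = foldr (simple_act W) (alt_word t s k) (simple_act W t (simple_root t))"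
      unfolding f_def alt_word_even[symmetric] k alt_word_snoc by simp
    also have "simple_act W t (simple_root t) = - simple_root t"
      using t by (simp add: simple_act_def form_simple_root vec_eq_iff lookup_vec)
    also have "foldr (simple_act W) (alt_word t s k) (- simple_root t) =
        - foldr (simple_act W) (alt_word t s k) (simple_root t)"
      by (rule linear_vecD[OF linear_foldr_simple_act])
    also have "\<dots> = simple_root t"
      by (subst foldr_alt_word[OF _ _ ts st]) (use s t k k' c2m c2m1 in simp_all)
    finally show ?thesis .
  qed
  have fix0: "f u = u" if "form W (simple_root s) u = 0" "form W (simple_root t) u = 0" for u
  proof -
    have "foldr (simple_act W) (concat (replicate n [s, t])) u = u" for n
      using that by (induction n) (auto simp: simple_act_def)
    then show ?thesis unfolding f_def .
  qed
  \<comment> \<open>\<open>d\<close> is the determinant of the Gram matrix of the two simple roots;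
    \<open>p\<close> and \<open>q\<close> below are the coordinates of the orthogonal projection of
    \<open>v\<close> to their plane.\<close>
  define x y d where "x = form W (simple_root s) v" "y = form W (simple_root t) v" "d = 1 - a\<^sup>2"
  have "d = (sin \<theta>)\<^sup>2" unfolding x_y_d_def a_def by (simp add: sin_squared_eq)
  then have d: "d \<noteq> 0" using sin by simp
  define p q where "p = (x + a * y) / d" "q = (y + a * x) / d"
  define v' where "v' = v - (scale_vec p (simple_root s) + scale_vec q (simple_root t))"
  have pd: "p * d = x + a * y" and qd: "q * d = y + a * x" unfolding p_q_def using d by simp_all
  have "(x - p + a * q) * d = x * d - p * d + a * (q * d)"
    and "(y - q + a * p) * d = y * d - q * d + a * (p * d)" by (simp_all add: algebra_simps)
  then have "(x - p + a * q) * d = 0" "(y - q + a * p) * d = 0"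
    unfolding pd qd by (simp_all add: x_y_d_def(3) algebra_simps power2_eq_square)
  then have "x - p + a * q = 0" "y - q + a * p = 0" using d by simp_all
  then have "f v' = v'"
    by (intro fix0) (simp_all add: v'_def form_bilinear form_simple_root s t st ts
      x_y_d_def(1,2)[symmetric] algebra_simps)
  then show ?thesis unfolding m_def[symmetric] f_def[symmetric]
    by (simp add: v'_def linear_vecD[OF lin] fs ft)
qed

section \<open>Invariants of the congruence on words and well-definedness of the action\<close>

lemma cox_equiv_foldr:
  "cox_equiv W S u v \<Longrightarrow> foldr (simple_act W) u = foldr (simple_act W) v"
  by (induction rule: cox_equiv.induct) (auto simp: fun_eq_iff foldr_relator)

text \<open>The sign character on words: every relator has even length
  \<open>2 * cox_m W s t\<close>.\<close>

lemma cox_equiv_parity: "cox_equiv W S u v \<Longrightarrow> even (length u) = even (length v)"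
  by (induction rule: cox_equiv.induct) (auto simp: length_concat sum_list_replicate)

lemma word_prod_Nil [simp]: "word_prod W [] = \<one>"
  and word_prod_Cons [simp]: "word_prod W (s # ws) = s \<otimes> word_prod W ws"
  by (simp_all add: word_prod_def)

lemma word_prod_closed [simp]: "set ws \<subseteq> carrier W \<Longrightarrow> word_prod W ws \<in> carrier W"
  by (induction ws) auto

lemma word_prod_append:
  "set us \<subseteq> carrier W \<Longrightarrow> set vs \<subseteq> carrier W \<Longrightarrow> word_prod W (us @ vs) = word_prod W us \<otimes> word_prod W vs"
  by (induction us) (auto simp: m_assoc)

lemma set_S_carrier: "set ws \<subseteq> S \<Longrightarrow> set ws \<subseteq> carrier W"
  using gens_subset by auto

lemma word_prod_rev: "set ws \<subseteq> S \<Longrightarrow> word_prod W (rev ws) = inv (word_prod W ws)"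
  by (induction ws) (auto simp: word_prod_append set_S_carrier inv_mult_group)

lemma generate_involutions_word:
  assumes "R \<subseteq> carrier W" "\<And>r. r \<in> R \<Longrightarrow> inv r = r" "w \<in> generate W R"
  shows "\<exists>ws. set ws \<subseteq> R \<and> word_prod W ws = w"
  using assms(3)
proof (induction rule: generate.induct)
  case one
  then show ?case by (intro exI[of _ "[]"]) simp
next
  case (incl h)
  then show ?case using assms(1) by (intro exI[of _ "[h]"]) auto
next
  case (inv h)
  then show ?case using assms(1,2) by (intro exI[of _ "[h]"]) auto
next
  case (eng h1 h2)
  then obtain u v where "set u \<subseteq> R" "word_prod W u = h1" "set v \<subseteq> R" "word_prod W v = h2" by auto
  then show ?case using assms(1) by (intro exI[of _ "u @ v"]) (auto simp: word_prod_append)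
qed

lemma generate_word:
  assumes "J \<subseteq> S" "w \<in> generate W J" shows "\<exists>ws. set ws \<subseteq> J \<and> word_prod W ws = w"
  by (rule generate_involutions_word[OF _ _ assms(2)]) (use assms(1) in auto)

lemma word_generate: "set ws \<subseteq> J \<Longrightarrow> word_prod W ws \<in> generate W J"
  by (induction ws) (auto intro: generate.intros)

lemma ex_word: "w \<in> carrier W \<Longrightarrow> \<exists>ws. set ws \<subseteq> S \<and> word_prod W ws = w"
  using generate_word[of S w] gens_generate by auto

text \<open>The axiom \<open>presentation\<close> enters here and nowhere else: the action and the
  parity are invariants of the congruence on words, so they descend to \<open>W\<close>.\<close>

lemma word_prod_eq_1_trivial:
  assumes "set ws \<subseteq> S" "word_prod W ws = \<one>"
  shows "foldr (simple_act W) ws v = v" "even (length ws)"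
proof -
  have "cox_equiv W S ws []" using presentation assms by (auto simp: in_lists_conv_set)
  then show "foldr (simple_act W) ws v = v" "even (length ws)"
    by (auto dest: cox_equiv_foldr cox_equiv_parity)
qed

lemma foldr_rev: "set ws \<subseteq> S \<Longrightarrow> foldr (simple_act W) (rev ws) (foldr (simple_act W) ws v) = v"
  by (induction ws arbitrary: v) (auto simp: simple_act_simple_act)

lemma word_prod_eq_imp:
  assumes "set us \<subseteq> S" "set vs \<subseteq> S" "word_prod W us = word_prod W vs"
  shows "foldr (simple_act W) us v = foldr (simple_act W) vs v" "even (length us) = even (length vs)"
proof -
  have c: "set us \<subseteq> carrier W" "set vs \<subseteq> carrier W" using assms set_S_carrier by auto
  have 1: "word_prod W (us @ rev vs) = \<one>"
    using assms c by (simp add: word_prod_append word_prod_rev)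
  note triv = word_prod_eq_1_trivial[OF _ 1]
  have "foldr (simple_act W) us (foldr (simple_act W) (rev vs) (foldr (simple_act W) vs v)) =
      foldr (simple_act W) vs v"
    using triv(1)[of "foldr (simple_act W) vs v"] assms by simp
  then show "foldr (simple_act W) us v = foldr (simple_act W) vs v"
    using foldr_rev assms(2) by simp
  show "even (length us) = even (length vs)" using triv(2) assms by simp
qed

abbreviation wact :: "'a \<Rightarrow> 'a vec \<Rightarrow> 'a vec" (infixr "\<star>" 75) where
  "w \<star> v \<equiv> act W S w v"

abbreviation len :: "'a \<Rightarrow> nat" where "len \<equiv> word_length W S"

abbreviation \<alpha> :: "'a \<Rightarrow> 'a vec" where "\<alpha> \<equiv> simple_root"

lemma act_word:
  assumes "set ws \<subseteq> S" shows "word_prod W ws \<star> v = foldr (simple_act W) ws v"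
  unfolding act_def
proof (rule the_equality)
  show "\<exists>ws'\<in>lists S. word_prod W ws' = word_prod W ws \<and> foldr (simple_act W) ws v = foldr (simple_act W) ws' v"
    using assms by (intro bexI[of _ ws]) (auto simp: in_lists_conv_set)
next
  fix v' assume "\<exists>ws'\<in>lists S. word_prod W ws' = word_prod W ws \<and> v' = foldr (simple_act W) ws' v"
  then obtain ws' where "set ws' \<subseteq> S" "word_prod W ws' = word_prod W ws" "v' = foldr (simple_act W) ws' v"
    by (auto simp: in_lists_conv_set)
  then show "v' = foldr (simple_act W) ws v" using word_prod_eq_imp(1)[of ws' ws v] assms by simp
qed

lemma linear_act: "w \<in> carrier W \<Longrightarrow> linear_vec ((\<star>) w)"
proof -
  assume "w \<in> carrier W"
  then obtain ws where "set ws \<subseteq> S" "word_prod W ws = w" using ex_word by blast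
  then have "(\<star>) w = foldr (simple_act W) ws" using act_word by blast
  then show ?thesis using linear_foldr_simple_act by metis
qed

lemmas act_linear = linear_vecD[OF linear_act]

lemma act_one [simp]: "\<one> \<star> v = v"
  using act_word[of "[]"] by simp

lemma act_gen: "s \<in> S \<Longrightarrow> s \<star> v = v - scale_vec (2 * form W (\<alpha> s) v) (\<alpha> s)"
  using act_word[of "[s]"] by (simp add: simple_act_def)

lemma act_mult:
  assumes "u \<in> carrier W" "w \<in> carrier W" shows "(u \<otimes> w) \<star> v = u \<star> w \<star> v"
proof -
  obtain us ws where "set us \<subseteq> S" "word_prod W us = u" "set ws \<subseteq> S" "word_prod W ws = w"
    using ex_word assms by metis
  then show ?thesis using act_word[of us] act_word[of ws] act_word[of "us @ ws"]
    by (simp add: word_prod_append set_S_carrier)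
qed

lemma act_inv_act [simp]: "w \<in> carrier W \<Longrightarrow> inv w \<star> w \<star> v = v"
  and act_act_inv [simp]: "w \<in> carrier W \<Longrightarrow> w \<star> inv w \<star> v = v"
  by (simp_all add: act_mult[symmetric])

lemma act_eq_iff [simp]: "w \<in> carrier W \<Longrightarrow> w \<star> u = w \<star> v \<longleftrightarrow> u = v"
  by (metis act_inv_act)

end

lemma not_distinct_adjD: "\<not> distinct_adj u \<Longrightarrow> \<exists>xs a ys. u = xs @ [a, a] @ ys"
proof (induction u)
  case (Cons a u)
  show ?case
  proof (cases "distinct_adj u")
    case True
    then show ?thesis using Cons.prems
      by (cases u) (auto simp: distinct_adj_Cons intro!: exI[of _ "[]"])
  next
    case False
    then obtain xs c ys where "u = xs @ [c, c] @ ys" using Cons.IH by blast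
    then show ?thesis by (intro exI[of _ "a # xs"]) auto
  qed
qed simp

lemma alt_word_unique:
  assumes "distinct_adj u" "set u \<subseteq> {s, t}" "s \<noteq> t" "u \<noteq> [] \<Longrightarrow> last u = t"
  shows "u = alt_word s t (length u)"
  using assms
proof (induction u)
  case (Cons a u)
  show ?case
  proof (cases u)
    case Nil
    then show ?thesis using Cons.prems by simp
  next
    case (Cons b u')
    have u: "u = alt_word s t (length u)"
      using Cons Cons.prems Cons.IH by (auto simp: distinct_adj_Cons)
    have "b = (if even (length u') then t else s)" using u Cons by simp
    moreover have "a \<noteq> b" "a \<in> {s, t}" using Cons.prems Cons by auto
    ultimately have "a = (if even (length u) then t else s)" using Cons by (auto split: if_splits)
    then show ?thesis using u by simp
  qed
qed simp

lemma rev_alt_word: "rev (alt_word s t n) = (if even n then alt_word t s n else alt_word s t n)"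
proof (induction n arbitrary: s t)
  case (Suc n)
  have "rev (alt_word s t (Suc n)) = t # rev (alt_word t s n)"
    by (simp only: alt_word_snoc rev_append) simp
  then show ?case using Suc by simp
qed simp

section \<open>Length and positivity of roots\<close>

lemma word_length_le: "set ws \<subseteq> R \<Longrightarrow> word_length G R (word_prod G ws) \<le> length ws"
  unfolding word_length_def by (rule Least_le) (auto simp: in_lists_conv_set)

lemma word_length_attained:
  assumes "set vs \<subseteq> R" "word_prod G vs = w"
  shows "\<exists>ws. set ws \<subseteq> R \<and> word_prod G ws = w \<and> length ws = word_length G R w"
proof -
  have "\<exists>n. \<exists>ws\<in>lists R. length ws = n \<and> word_prod G ws = w"
    using assms by (auto simp: in_lists_conv_set)
  from LeastI_ex[OF this] show ?thesis unfolding word_length_def[symmetric] by (auto simp: in_lists_conv_set)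
qed

context coxeter_system
begin

lemma len_le: "set ws \<subseteq> S \<Longrightarrow> len (word_prod W ws) \<le> length ws"
  by (rule word_length_le)

lemma ex_reduced:
  assumes "w \<in> carrier W" shows "\<exists>ws. set ws \<subseteq> S \<and> word_prod W ws = w \<and> length ws = len w"
proof -
  obtain ws where "set ws \<subseteq> S" "word_prod W ws = w" using ex_word[OF assms] by blast
  then show ?thesis by (rule word_length_attained)
qed

lemma len_one [simp]: "len \<one> = 0"
  using len_le[of "[]"] by simp

lemma len_eq_0_iff: "w \<in> carrier W \<Longrightarrow> len w = 0 \<longleftrightarrow> w = \<one>"
  using ex_reduced[of w] by auto

lemma len_parity: "set ws \<subseteq> S \<Longrightarrow> even (length ws) = even (len (word_prod W ws))"
  by (metis ex_reduced set_S_carrier word_prod_closed word_prod_eq_imp(2))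

lemma len_mult_le:
  assumes "u \<in> carrier W" "v \<in> carrier W" shows "len (u \<otimes> v) \<le> len u + len v"
proof -
  obtain us vs where "set us \<subseteq> S" "word_prod W us = u" "length us = len u"
    "set vs \<subseteq> S" "word_prod W vs = v" "length vs = len v"
    using ex_reduced[OF assms(1)] ex_reduced[OF assms(2)] by blast
  then show ?thesis using len_le[of "us @ vs"] by (simp add: word_prod_append set_S_carrier)
qed

lemma len_inv: assumes "w \<in> carrier W" shows "len (inv w) = len w"
proof -
  have "len (inv u) \<le> len u" if "u \<in> carrier W" for u
  proof -
    obtain us where "set us \<subseteq> S" "word_prod W us = u" "length us = len u"
      using ex_reduced[OF \<open>u \<in> carrier W\<close>] by blast
    then show ?thesis using len_le[of "rev us"] by (simp add: word_prod_rev)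
  qed
  from this[of w] this[of "inv w"] assms show ?thesis by simp
qed

lemma len_gen_le: "s \<in> S \<Longrightarrow> len s \<le> 1"
  using len_le[of "[s]"] by simp

text \<open>Lengths change by at most one, and parity excludes equality.\<close>

lemma len_mult_gen:
  assumes "w \<in> carrier W" "s \<in> S"
  shows "len (w \<otimes> s) = len w + 1 \<or> len w = len (w \<otimes> s) + 1"
proof -
  obtain ws where ws: "set ws \<subseteq> S" "word_prod W ws = w" "length ws = len w"
    using ex_reduced[OF assms(1)] by blast
  then have "even (length (ws @ [s])) = even (len (w \<otimes> s))"
    using len_parity[of "ws @ [s]"] assms(2) by (simp add: word_prod_append set_S_carrier)
  then have "even (Suc (len w)) = even (len (w \<otimes> s))" using ws by simp
  moreover have "len (w \<otimes> s) \<le> len w + 1"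
    using len_mult_le[of w s] len_gen_le[of s] assms by simp
  moreover have "len w \<le> len (w \<otimes> s) + 1"
  proof -
    have "len (w \<otimes> s \<otimes> s) \<le> len (w \<otimes> s) + len s" by (rule len_mult_le) (use assms in auto)
    then show ?thesis using len_gen_le[of s] assms by (simp add: m_assoc gens_involution)
  qed
  ultimately show ?thesis by presburger
qed

lemma mult_gen_gen [simp]: "w \<in> carrier W \<Longrightarrow> s \<in> S \<Longrightarrow> w \<otimes> s \<otimes> s = w"
  by (simp add: m_assoc gens_involution)

lemma ex_descent:
  assumes "w \<in> carrier W" "w \<noteq> \<one>" shows "\<exists>s\<in>S. len (w \<otimes> s) < len w"
proof -
  obtain ws where ws: "set ws \<subseteq> S" "word_prod W ws = w" "length ws = len w"
    using ex_reduced[OF assms(1)] by blast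
  then obtain us s where us: "ws = us @ [s]" using assms by (cases ws rule: rev_exhaust) auto
  then have "word_prod W us \<otimes> s = w" "set us \<subseteq> S" "s \<in> S"
    using ws by (auto simp: word_prod_append set_S_carrier)
  then have "w \<otimes> s = word_prod W us" by (auto simp: set_S_carrier)
  then show ?thesis using len_le[of us] ws us \<open>s \<in> S\<close> \<open>set us \<subseteq> S\<close> by (intro bexI[of _ s]) auto
qed

text \<open>Write the relator as two alternating words of length \<open>m\<close> and move one of
  them to the other side; its inverse is the reversed word, as letters are involutions.\<close>

lemma braid_relation:
  assumes s: "s \<in> S" and t: "t \<in> S"
  shows "word_prod W (alt_word s t (cox_m W s t)) = word_prod W (alt_word t s (cox_m W s t))"
proof -
  define m where "m = cox_m W s t"
  have subS: "set (alt_word x y k) \<subseteq> S" if "x \<in> {s, t}" "y \<in> {s, t}" for x y k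
    using set_alt_word[of x y k] that s t by auto
  have "word_prod W (concat (replicate n [s, t])) = (s \<otimes> t) [^] n" for n
  proof (induction n)
    case (Suc n)
    have "(s \<otimes> t) [^] Suc n = (s \<otimes> t) \<otimes> (s \<otimes> t) [^] n"
      using s t by (intro nat_pow_Suc2) auto
    then show ?case using Suc s t by (simp add: m_assoc)
  qed simp
  then have "word_prod W (alt_word s t (2 * m)) = \<one>"
    unfolding alt_word_even m_def cox_m_def using s t by simp
  moreover have "alt_word s t (2 * m) = (if even m then alt_word s t m else alt_word t s m) @ alt_word s t m"
    unfolding mult_2 by (rule alt_word_append)
  ultimately have "word_prod W (if even m then alt_word s t m else alt_word t s m) \<otimes> word_prod W (alt_word s t m) = \<one>"
    using subS by (simp add: word_prod_append set_S_carrier)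
  moreover have "word_prod W (if even m then alt_word s t m else alt_word t s m) \<in> carrier W"
    "word_prod W (alt_word s t m) \<in> carrier W" using subS by (auto simp: set_S_carrier)
  ultimately have "word_prod W (alt_word s t m) = inv (word_prod W (if even m then alt_word s t m else alt_word t s m))"
    by (metis inv_equality inv_inv)
  also have "\<dots> = word_prod W (rev (if even m then alt_word s t m else alt_word t s m))"
    using subS by (simp add: word_prod_rev)
  also have "\<dots> = word_prod W (alt_word t s m)" by (simp add: rev_alt_word)
  finally show ?thesis unfolding m_def .
qed

text \<open>For finite order \<open>m\<close> the value is \<open>sin (k * pi / m)\<close> over
  \<open>sin (pi / m)\<close>, and \<open>k * pi / m\<close> does not exceed \<open>pi\<close>; for
  infinite order it is \<open>k\<close>.\<close>

lemma cheb_nonneg: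
  assumes "s \<in> S" "t \<in> S" "s \<noteq> t" "cox_m W s t = 0 \<or> k \<le> cox_m W s t"
  shows "0 \<le> cheb (- cox_cos W s t) k"
proof (cases "cox_m W s t = 0")
  case True
  then show ?thesis by (simp add: cox_cos_def cheb_1)
next
  case False
  define m where "m = cox_m W s t"
  have m: "2 \<le> m" "k \<le> m" using cox_m_neq_1[OF assms(1-3)] False assms(4) unfolding m_def by linarith+
  define \<theta> where "\<theta> = pi / real m"
  have c: "- cox_cos W s t = cos \<theta>" unfolding cox_cos_def \<theta>_def m_def using False by simp
  have \<theta>: "0 < \<theta>" "\<theta> \<le> pi / 2" unfolding \<theta>_def using m by (auto simp: field_simps)
  have sin: "0 < sin \<theta>" by (rule sin_gt_zero) (use \<theta> pi_gt_zero in linarith)+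
  have "real k * \<theta> \<le> real m * \<theta>" using m \<theta> by (intro mult_right_mono) auto
  also have "real m * \<theta> = pi" unfolding \<theta>_def using m by simp
  finally have "0 \<le> sin (real k * \<theta>)" using \<theta> by (intro sin_ge_zero) auto
  then have "0 \<le> cheb (cos \<theta>) k * sin \<theta>" unfolding cheb_cos .
  then show ?thesis unfolding c using sin by (simp add: zero_le_mult_iff)
qed

text \<open>The bound is strict because the coefficients are the Chebyshev values at
  \<open>k\<close> and \<open>k + 1\<close>.\<close>

lemma alt_word_nonneg:
  assumes st: "s \<in> S" "t \<in> S" "s \<noteq> t" and k: "cox_m W s t = 0 \<or> k < cox_m W s t"
  shows "\<exists>p q. 0 \<le> p \<and> 0 \<le> q \<and>
    foldr (simple_act W) (alt_word s t k) (\<alpha> s) = scale_vec p (\<alpha> s) + scale_vec q (\<alpha> t)"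
proof -
  define a where "a = - cox_cos W s t"
  have a: "cox_cos W s t = - a" "cox_cos W t s = - a" unfolding a_def using cox_cos_sym st by auto
  have "0 \<le> cheb a k" "0 \<le> cheb a (Suc k)" unfolding a_def using k by (intro cheb_nonneg[OF st]; auto)+
  moreover have "foldr (simple_act W) (alt_word s t k) (\<alpha> s) =
    (if even k then scale_vec (cheb a (Suc k)) (\<alpha> s) + scale_vec (cheb a k) (\<alpha> t)
     else scale_vec (cheb a k) (\<alpha> s) + scale_vec (cheb a (Suc k)) (\<alpha> t))"
    by (rule foldr_alt_word) (use st a in auto)
  ultimately show ?thesis by (cases "even k") auto
qed

text \<open>Reduction to a dihedral subgroup. Split \<open>w\<close> into \<open>v\<close> and a
  word \<open>u\<close> in \<open>s\<close> and a descent \<open>t\<close>, with lengths adding and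
  \<open>u\<close> as long as possible. Both letters are then ascents of \<open>v\<close>, so
  induction covers \<open>v\<close>, while \<open>u\<close> sends \<alpha> s to a nonnegative
  combination of the two simple roots.\<close>

theorem ascent_nonneg:
  assumes "w \<in> carrier W" "s \<in> S" "len w < len (w \<otimes> s)"
  shows "0 \<le> lk (w \<star> \<alpha> s) k"
  using assms
proof (induction "len w" arbitrary: w s k rule: less_induct)
  case less
  note w = \<open>w \<in> carrier W\<close> and s = \<open>s \<in> S\<close> and ws = \<open>len w < len (w \<otimes> s)\<close>
  show ?case
  proof (cases "w = \<one>")
    case True
    then show ?thesis by (simp add: lookup_simple_root)
  next
    case False
    then obtain t where t: "t \<in> S" and wt: "len (w \<otimes> t) < len w" using ex_descent w by blast
    have st: "s \<noteq> t" using ws wt by auto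
    define P where "P u \<longleftrightarrow> set u \<subseteq> {s, t} \<and>
      (\<exists>v\<in>carrier W. w = v \<otimes> word_prod W u \<and> len w = len v + length u)" for u
    \<comment> \<open>The descent \<open>t\<close> provides a start, so the maximal \<open>u\<close>
      is nonempty and \<open>v\<close> is shorter than \<open>w\<close>.\<close>
    have "P [t]" unfolding P_def using w t wt len_mult_gen[OF w t]
      by (auto intro!: bexI[of _ "w \<otimes> t"])
    moreover have "\<forall>u. P u \<longrightarrow> length u \<le> len w" unfolding P_def by auto
    ultimately obtain u where "P u" and max: "\<And>u'. P u' \<Longrightarrow> length u' \<le> length u"
      using ex_has_greatest_nat[of P "[t]" length "Suc (len w)"] by (auto simp: less_Suc_eq_le)
    then obtain v where u: "set u \<subseteq> {s, t}" and v: "v \<in> carrier W" and w_eq: "w = v \<otimes> word_prod W u"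
      and lw: "len w = len v + length u" unfolding P_def by blast
    have uS: "set u \<subseteq> S" using u s t by auto
    have u_ne: "1 \<le> length u" using max[OF \<open>P [t]\<close>] by simp
    \<comment> \<open>A word for the same element that is no longer than \<open>u\<close> but ends
      in \<open>s\<close> would make \<open>s\<close> a descent of \<open>w\<close>.\<close>
    have not_s: False if "w = v \<otimes> word_prod W (u' @ [s])" "length u' < length u" "set u' \<subseteq> S" for u'
    proof -
      have "w = v \<otimes> word_prod W u' \<otimes> s" using that v s by (simp add: word_prod_append set_S_carrier m_assoc)
      then have "w \<otimes> s = v \<otimes> word_prod W u'" using that v s by (simp add: set_S_carrier)
      then have "len (w \<otimes> s) \<le> len v + length u'"
        using len_mult_le[of v "word_prod W u'"] len_le[of u'] v that by (auto simp: set_S_carrier)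
      then show False using that ws lw by simp
    qed
    have v_asc: "len v < len (v \<otimes> r)" if r: "r \<in> {s, t}" for r
    proof (rule ccontr)
      have rS: "r \<in> S" using r s t by auto
      assume "\<not> len v < len (v \<otimes> r)"
      then have "len v = len (v \<otimes> r) + 1" using len_mult_gen[OF v rS] by auto
      then have "P (r # u)" unfolding P_def using u r rS v w_eq lw uS
        by (auto intro!: bexI[of _ "v \<otimes> r"] simp: set_S_carrier m_assoc[symmetric])
      from max[OF this] show False by simp
    qed
    have v_less: "len v < len w" using lw u_ne by linarith
    have v_nonneg: "0 \<le> lk (v \<star> \<alpha> r) j" if "r \<in> {s, t}" for r j
      using less.hyps[OF v_less v _ v_asc[OF that]] that s t by auto
    have da: "distinct_adj u"
    proof (rule ccontr)
      assume "\<not> distinct_adj u"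
      then obtain xs a ys where xs: "u = xs @ [a, a] @ ys" using not_distinct_adjD by blast
      then have "word_prod W u = word_prod W (xs @ ys)"
        using uS by (simp add: word_prod_append set_S_carrier m_assoc[symmetric] gens_involution)
      then show False using len_mult_le[of v "word_prod W (xs @ ys)"] len_le[of "xs @ ys"] v w_eq lw xs uS
        by (auto simp: set_S_carrier)
    qed
    have lu: "last u = t" if "u \<noteq> []"
    proof (rule ccontr)
      assume "last u \<noteq> t"
      moreover have "last u \<in> {s, t}" using u last_in_set[OF that] by blast
      ultimately have "last u = s" by blast
      then have "u = butlast u @ [s]" using append_butlast_last_id[OF that] by simp
      then obtain u' where eq: "u = u' @ [s]" by blast
      show False by (rule not_s[of u']) (use w_eq eq uS in auto)
    qed
    have u_alt: "u = alt_word s t (length u)" by (rule alt_word_unique[OF da u st lu])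
    \<comment> \<open>Otherwise the braid relation rewrites the last \<open>cox_m W s t\<close>
      letters of \<open>u\<close> so that they end in \<open>s\<close>, which \<open>not_s\<close>
      excludes.\<close>
    have "cox_m W s t = 0 \<or> length u < cox_m W s t"
    proof (rule ccontr)
      assume "\<not> ?thesis"
      then have m0: "cox_m W s t \<noteq> 0" and ml: "cox_m W s t \<le> length u" by auto
      obtain m' where m': "cox_m W s t = Suc m'" using m0 by (cases "cox_m W s t") auto
      define x where "x = (if even (cox_m W s t) then alt_word s t (length u - cox_m W s t)
        else alt_word t s (length u - cox_m W s t))"
      have ux: "u = x @ alt_word s t (cox_m W s t)"
        using alt_word_append[of s t "length u - cox_m W s t" "cox_m W s t"] u_alt ml
        unfolding x_def by simp
      have xS: "set x \<subseteq> S" and lx: "length x = length u - cox_m W s t" unfolding x_def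
        using set_alt_word[of s t] set_alt_word[of t s] s t by (auto simp: subset_iff)
      have altS: "set (alt_word a c k) \<subseteq> S" if "a \<in> {s,t}" "c \<in> {s,t}" for a c k
        using set_alt_word[of a c k] that s t by auto
      have "word_prod W u = word_prod W (x @ alt_word t s (cox_m W s t))"
        using braid_relation[OF s t] ux xS altS by (simp add: word_prod_append set_S_carrier)
      also have "x @ alt_word t s (cox_m W s t) = (x @ alt_word s t m') @ [s]"
        unfolding m' alt_word_snoc by simp
      finally have "w = v \<otimes> word_prod W ((x @ alt_word s t m') @ [s])" using w_eq by simp
      then show False by (rule not_s) (use lx ml m' xS altS in auto)
    qed
    from alt_word_nonneg[OF s t st this] obtain p q where pq: "0 \<le> p" "0 \<le> q"
      "foldr (simple_act W) u (\<alpha> s) = scale_vec p (\<alpha> s) + scale_vec q (\<alpha> t)"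
      by (auto simp flip: u_alt)
    have "w \<star> \<alpha> s = v \<star> word_prod W u \<star> \<alpha> s"
      using w_eq v uS by (simp add: act_mult set_S_carrier)
    also have "\<dots> = scale_vec p (v \<star> \<alpha> s) + scale_vec q (v \<star> \<alpha> t)"
      using pq uS v by (simp add: act_word act_linear)
    finally show ?thesis using pq v_nonneg by (simp add: lookup_add)
  qed
qed

section \<open>Inversions and reflections\<close>

abbreviation Roots :: "'a vec set" ("\<Phi>") where "\<Phi> \<equiv> roots W S"
abbreviation Pos_roots :: "'a vec set" ("\<Phi>p") where "\<Phi>p \<equiv> pos_roots W S"

lemma gen_induct [consumes 1, case_names one mult]:
  assumes "w \<in> carrier W" "P \<one>" "\<And>s w. s \<in> S \<Longrightarrow> w \<in> carrier W \<Longrightarrow> P w \<Longrightarrow> P (s \<otimes> w)"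
  shows "P w"
proof -
  obtain ws where ws: "set ws \<subseteq> S" "word_prod W ws = w" using ex_word[OF assms(1)] by blast
  have "P (word_prod W ws)" using ws(1)
    by (induction ws) (use assms(2,3) in \<open>auto simp: set_S_carrier\<close>)
  then show ?thesis using ws by simp
qed

lemma keys_act:
  assumes "w \<in> carrier W" "Poly_Mapping.keys v \<subseteq> S" shows "Poly_Mapping.keys (w \<star> v) \<subseteq> S"
  using assms(1)
proof (induction w rule: gen_induct)
  case (mult s w)
  have "lk (s \<star> w \<star> v) k = 0" if "k \<notin> S" for k
    using mult that by (auto simp: act_gen lookup_minus lookup_simple_root not_in_keys_iff_lookup_eq_zero[symmetric])
  then show ?case using mult by (auto simp: act_mult in_keys_iff)
qed (use assms in simp)

text \<open>Symmetry of \<open>cox_m\<close> is at hand only for letters of \<open>S\<close>, hence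
  the conditions on supports here and below; roots meet them by \<open>root_keys\<close>.\<close>

lemma form_sym:
  assumes "Poly_Mapping.keys u \<subseteq> S" "Poly_Mapping.keys v \<subseteq> S" shows "form W u v = form W v u"
proof -
  let ?A = "Poly_Mapping.keys u" and ?C = "Poly_Mapping.keys v"
  have "form W u v = (\<Sum>s\<in>?A. \<Sum>t\<in>?C. lk u s * lk v t * cox_cos W s t)"
    by (rule form_superset) auto
  also have "\<dots> = (\<Sum>s\<in>?A. \<Sum>t\<in>?C. lk v t * lk u s * cox_cos W t s)"
    using assms by (intro sum.cong refl) (auto simp: cox_cos_sym subset_iff)
  also have "\<dots> = (\<Sum>t\<in>?C. \<Sum>s\<in>?A. lk v t * lk u s * cox_cos W t s)"
    by (rule sum.swap)
  also have "\<dots> = form W v u" by (rule form_superset[symmetric]) auto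
  finally show ?thesis .
qed

lemma form_act:
  assumes "w \<in> carrier W" "Poly_Mapping.keys u \<subseteq> S" "Poly_Mapping.keys v \<subseteq> S"
  shows "form W (w \<star> u) (w \<star> v) = form W u v"
  using assms(1)
proof (induction w rule: gen_induct)
  case (mult s w)
  have "form W (w \<star> u) (\<alpha> s) = form W (\<alpha> s) (w \<star> u)"
    by (rule form_sym) (use keys_act mult assms in auto)
  then have "form W (s \<star> w \<star> u) (s \<star> w \<star> v) = form W (w \<star> u) (w \<star> v)"
    using mult by (simp add: act_gen form_bilinear form_simple_root algebra_simps)
  then show ?case using mult by (simp add: act_mult)
qed simp

lemma rootsE:
  assumes "\<gamma> \<in> \<Phi>" obtains w s where "w \<in> carrier W" "s \<in> S" "\<gamma> = w \<star> \<alpha> s"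
  using assms unfolding roots_def by auto

lemma rootsI: "w \<in> carrier W \<Longrightarrow> s \<in> S \<Longrightarrow> w \<star> \<alpha> s \<in> \<Phi>"
  unfolding roots_def by auto

lemma root_act: "\<gamma> \<in> \<Phi> \<Longrightarrow> w \<in> carrier W \<Longrightarrow> w \<star> \<gamma> \<in> \<Phi>"
  by (elim rootsE) (auto simp: act_mult[symmetric] intro!: rootsI)

lemma root_keys: "\<gamma> \<in> \<Phi> \<Longrightarrow> Poly_Mapping.keys \<gamma> \<subseteq> S"
  by (elim rootsE) (use keys_act in auto)

lemma root_norm: "\<gamma> \<in> \<Phi> \<Longrightarrow> form W \<gamma> \<gamma> = 1"
  by (elim rootsE) (simp add: form_act form_simple_root)

lemma root_nonzero: "\<gamma> \<in> \<Phi> \<Longrightarrow> \<gamma> \<noteq> 0"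
  using root_norm by fastforce

lemma simple_root_root [simp]: "s \<in> S \<Longrightarrow> \<alpha> s \<in> \<Phi>"
  using rootsI[of \<one> s] by simp

lemma act_gen_simple [simp]: "s \<in> S \<Longrightarrow> s \<star> \<alpha> s = - \<alpha> s"
  by (rule vec_eqI) (simp add: act_gen form_simple_root lookup_minus)

lemma root_uminus: assumes "\<gamma> \<in> \<Phi>" shows "- \<gamma> \<in> \<Phi>"
proof -
  obtain w s where ws: "w \<in> carrier W" "s \<in> S" "\<gamma> = w \<star> \<alpha> s" using assms by (elim rootsE)
  then have "- \<gamma> = (w \<otimes> s) \<star> \<alpha> s" by (simp add: act_mult act_linear)
  then show ?thesis using ws by (auto intro: rootsI)
qed

lemma pos_roots_iff: "\<gamma> \<in> \<Phi>p \<longleftrightarrow> \<gamma> \<in> \<Phi> \<and> (\<forall>k. 0 \<le> lk \<gamma> k)"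
  unfolding pos_roots_def by auto

lemma pos_root_root: "\<gamma> \<in> \<Phi>p \<Longrightarrow> \<gamma> \<in> \<Phi>"
  by (simp add: pos_roots_iff)

lemma simple_root_pos [simp]: "s \<in> S \<Longrightarrow> \<alpha> s \<in> \<Phi>p"
  by (simp add: pos_roots_iff lookup_simple_root)

lemma ascent_pos: "w \<in> carrier W \<Longrightarrow> s \<in> S \<Longrightarrow> len w < len (w \<otimes> s) \<Longrightarrow> w \<star> \<alpha> s \<in> \<Phi>p"
  using ascent_nonneg by (simp add: pos_roots_iff rootsI)

lemma descent_neg:
  assumes "w \<in> carrier W" "s \<in> S" "len (w \<otimes> s) < len w" shows "- (w \<star> \<alpha> s) \<in> \<Phi>p"
proof -
  have "(w \<otimes> s) \<star> \<alpha> s \<in> \<Phi>p" by (rule ascent_pos) (use assms in auto)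
  then show ?thesis using assms by (simp add: act_mult act_linear)
qed

lemma not_pos_neg: "\<gamma> \<in> \<Phi>p \<Longrightarrow> - \<gamma> \<notin> \<Phi>p"
proof
  assume *: "\<gamma> \<in> \<Phi>p" "- \<gamma> \<in> \<Phi>p"
  have "lk \<gamma> k = 0" for k using * by (auto simp: pos_roots_iff intro!: antisym)
  then have "\<gamma> = 0" by (intro vec_eqI) simp
  then show False using * root_nonzero pos_root_root by blast
qed

lemma pos_or_neg: "\<gamma> \<in> \<Phi> \<Longrightarrow> \<gamma> \<in> \<Phi>p \<or> - \<gamma> \<in> \<Phi>p"
proof (elim rootsE)
  fix w s assume "w \<in> carrier W" "s \<in> S" "\<gamma> = w \<star> \<alpha> s"
  then show ?thesis using len_mult_gen[of w s] ascent_pos[of w s] descent_neg[of w s] by fastforce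
qed

lemma neg_iff: "\<gamma> \<in> \<Phi> \<Longrightarrow> - \<gamma> \<in> \<Phi>p \<longleftrightarrow> \<gamma> \<notin> \<Phi>p"
  using pos_or_neg not_pos_neg by blast

lemma pos_coeff:
  assumes "\<gamma> \<in> \<Phi>" "0 < lk \<gamma> k" shows "\<gamma> \<in> \<Phi>p"
proof (rule ccontr)
  assume "\<gamma> \<notin> \<Phi>p"
  then have "- \<gamma> \<in> \<Phi>p" using assms pos_or_neg by blast
  then have "0 \<le> lk (- \<gamma>) k" by (simp only: pos_roots_iff)
  then show False using assms by simp
qed

lemma ascent_iff: "w \<in> carrier W \<Longrightarrow> s \<in> S \<Longrightarrow> len w < len (w \<otimes> s) \<longleftrightarrow> w \<star> \<alpha> s \<in> \<Phi>p"
  using len_mult_gen[of w s] ascent_pos[of w s] descent_neg[of w s] not_pos_neg by fastforce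

lemma descent_iff: "w \<in> carrier W \<Longrightarrow> s \<in> S \<Longrightarrow> len (w \<otimes> s) < len w \<longleftrightarrow> w \<star> \<alpha> s \<notin> \<Phi>p"
  using len_mult_gen[of w s] ascent_iff[of w s] by auto

text \<open>Both vectors have norm 1, so the factor is a sign, and positivity fixes it.\<close>

lemma pos_parallel_eq:
  assumes "\<gamma> \<in> \<Phi>p" "\<delta> \<in> \<Phi>p" "\<gamma> = scale_vec c \<delta>" shows "\<gamma> = \<delta>"
proof -
  have "c * c = 1" using assms root_norm[of \<gamma>] root_norm[of \<delta>] pos_root_root
    by (simp add: form_scale_left form_scale_right)
  then have "c = 1 \<or> c = - 1" by (metis square_eq_1_iff)
  then show ?thesis using assms not_pos_neg[of \<gamma>] by auto
qed

lemma pos_root_other_coeff: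
  assumes "\<gamma> \<in> \<Phi>p" "s \<in> S" "\<gamma> \<noteq> \<alpha> s" shows "\<exists>k. k \<noteq> s \<and> 0 < lk \<gamma> k"
proof (rule ccontr)
  assume no: "\<not> ?thesis"
  have "lk \<gamma> k = 0" if "k \<noteq> s" for k
    using no that assms(1) by (metis less_eq_real_def pos_roots_iff)
  then have "\<gamma> = scale_vec (lk \<gamma> s) (\<alpha> s)"
    by (intro vec_eqI) (auto simp: lookup_simple_root)
  then show False using pos_parallel_eq[OF assms(1) simple_root_pos[OF assms(2)]] assms(3) by blast
qed

text \<open>The reflection changes only the coordinate at \<open>s\<close>, and a positive root
  other than \<alpha> s has another positive coordinate, which decides the sign.\<close>

lemma gen_act_pos:
  assumes "\<gamma> \<in> \<Phi>p" "s \<in> S" "\<gamma> \<noteq> \<alpha> s" shows "s \<star> \<gamma> \<in> \<Phi>p"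
proof -
  obtain k where k: "k \<noteq> s" "0 < lk \<gamma> k" using pos_root_other_coeff assms by blast
  then have "0 < lk (s \<star> \<gamma>) k" using assms by (simp add: act_gen lookup_minus lookup_simple_root)
  then show ?thesis
    by (rule pos_coeff[OF root_act[OF pos_root_root[OF assms(1)] gens_carrier[OF assms(2)]]])
qed

section \<open>Inversion sets and length\<close>

definition inversions :: "'a \<Rightarrow> 'a vec set" where
  "inversions w = {\<gamma> \<in> \<Phi>p. w \<star> \<gamma> \<notin> \<Phi>p}"

lemma inversions_one [simp]: "inversions \<one> = {}"
  unfolding inversions_def by simp

lemma gen_gen_act [simp]: "s \<in> S \<Longrightarrow> s \<star> s \<star> v = v"
  by (simp add: act_mult[symmetric] gens_involution)

text \<open>\<open>s\<close> permutes the positive roots other than \<alpha> s, so it carries the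
  old inversions along, and \<alpha> s itself is the only new one.\<close>

lemma inversions_ascent:
  assumes w: "w \<in> carrier W" and s: "s \<in> S" and asc: "w \<star> \<alpha> s \<in> \<Phi>p"
  shows "inversions (w \<otimes> s) = insert (\<alpha> s) ((\<star>) s ` inversions w)" "\<alpha> s \<notin> (\<star>) s ` inversions w"
proof -
  have nin: "\<gamma> \<noteq> \<alpha> s" if "\<gamma> \<in> inversions w" for \<gamma> using that asc unfolding inversions_def by auto
  show "\<alpha> s \<notin> (\<star>) s ` inversions w"
  proof
    assume "\<alpha> s \<in> (\<star>) s ` inversions w"
    then obtain \<gamma> where \<gamma>: "\<gamma> \<in> inversions w" "\<alpha> s = s \<star> \<gamma>" by blast
    then have "\<gamma> = - \<alpha> s" using s by (metis act_gen_simple gen_gen_act)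
    then show False using \<gamma>(1) s not_pos_neg[of "\<alpha> s"] unfolding inversions_def by auto
  qed
  show "inversions (w \<otimes> s) = insert (\<alpha> s) ((\<star>) s ` inversions w)"
  proof (intro equalityI subsetI)
    fix \<gamma> assume \<gamma>: "\<gamma> \<in> inversions (w \<otimes> s)"
    show "\<gamma> \<in> insert (\<alpha> s) ((\<star>) s ` inversions w)"
    proof (cases "\<gamma> = \<alpha> s")
      case False
      then have "s \<star> \<gamma> \<in> \<Phi>p" using \<gamma> s gen_act_pos unfolding inversions_def by auto
      then have "s \<star> \<gamma> \<in> inversions w" using \<gamma> w s unfolding inversions_def by (auto simp: act_mult)
      then show ?thesis using s by (auto intro!: image_eqI[of _ _ "s \<star> \<gamma>"])
    qed simp
  next
    fix \<gamma> assume "\<gamma> \<in> insert (\<alpha> s) ((\<star>) s ` inversions w)"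
    then consider "\<gamma> = \<alpha> s" | \<delta> where "\<delta> \<in> inversions w" "\<gamma> = s \<star> \<delta>" by blast
    then show "\<gamma> \<in> inversions (w \<otimes> s)"
    proof cases
      case 1
      then show ?thesis using w s asc not_pos_neg unfolding inversions_def by (auto simp: act_mult act_linear)
    next
      case 2
      then show ?thesis using w s nin[OF 2(1)] gen_act_pos unfolding inversions_def by (auto simp: act_mult)
    qed
  qed
qed

lemma inversions_len: assumes "w \<in> carrier W" shows "finite (inversions w) \<and> card (inversions w) = len w"
  using assms
proof (induction "len w" arbitrary: w rule: less_induct)
  case less
  show ?case
  proof (cases "w = \<one>")
    case False
    then obtain s where s: "s \<in> S" "len (w \<otimes> s) < len w" using ex_descent less by blast
    let ?v = "w \<otimes> s"
    have v: "?v \<in> carrier W" "?v \<otimes> s = w" using s less by auto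
    then have asc: "?v \<star> \<alpha> s \<in> \<Phi>p" using ascent_iff[of ?v s] s by auto
    have IH: "finite (inversions ?v)" "card (inversions ?v) = len ?v" using less s v by blast+
    have "len w = len ?v + 1" using len_mult_gen[of w s] s less by auto
    moreover have "card ((\<star>) s ` inversions ?v) = card (inversions ?v)"
      by (rule card_image) (use s in \<open>auto simp: inj_on_def\<close>)
    ultimately show ?thesis
      using inversions_ascent[OF v(1) s(1) asc] IH unfolding v(2) by simp
  qed simp
qed

lemma finite_inversions [simp]: "w \<in> carrier W \<Longrightarrow> finite (inversions w)"
  and card_inversions: "w \<in> carrier W \<Longrightarrow> card (inversions w) = len w"
  using inversions_len by auto

lemma inversions_mult:
  assumes u: "u \<in> carrier W" and v: "v \<in> carrier W"
  shows "inversions (u \<otimes> v) \<subseteq> inversions v \<union> (\<star>) (inv v) ` inversions u"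
proof
  fix \<gamma> assume \<gamma>: "\<gamma> \<in> inversions (u \<otimes> v)"
  show "\<gamma> \<in> inversions v \<union> (\<star>) (inv v) ` inversions u"
  proof (cases "v \<star> \<gamma> \<in> \<Phi>p")
    case True
    then have "v \<star> \<gamma> \<in> inversions u" using \<gamma> u v by (auto simp: inversions_def act_mult)
    then show ?thesis using v by (auto intro!: image_eqI[of _ _ "v \<star> \<gamma>"])
  qed (use \<gamma> in \<open>auto simp: inversions_def\<close>)
qed

lemma card_act_image [simp]: "w \<in> carrier W \<Longrightarrow> card ((\<star>) w ` A) = card A"
  by (rule card_image) (auto simp: inj_on_def)

text \<open>An inversion \<beta> of \<open>u\<close> with \<open>inv v \<star> \<beta>\<close>
  negative would make \<open>- (inv v \<star> \<beta>)\<close> an inversion of \<open>v\<close> that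
  \<open>u \<otimes> v\<close> sends to a positive root, against the inclusion.\<close>

lemma inversions_mult_eq:
  assumes u: "u \<in> carrier W" and v: "v \<in> carrier W" and sub: "inversions v \<subseteq> inversions (u \<otimes> v)"
  shows "inversions (u \<otimes> v) = inversions v \<union> (\<star>) (inv v) ` inversions u"
    "inversions v \<inter> (\<star>) (inv v) ` inversions u = {}"
proof -
  have pos: "inv v \<star> \<beta> \<in> \<Phi>p" if \<beta>: "\<beta> \<in> inversions u" for \<beta>
  proof (rule ccontr)
    assume neg: "inv v \<star> \<beta> \<notin> \<Phi>p"
    have \<beta>': "\<beta> \<in> \<Phi>" using \<beta> pos_root_root unfolding inversions_def by auto
    then have "- (inv v \<star> \<beta>) \<in> \<Phi>p" using neg neg_iff root_act v by auto
    moreover have "v \<star> (- (inv v \<star> \<beta>)) = - \<beta>" using v by (simp add: act_linear)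
    ultimately have "- (inv v \<star> \<beta>) \<in> inversions v" using \<beta> not_pos_neg unfolding inversions_def by auto
    then have "(u \<otimes> v) \<star> (- (inv v \<star> \<beta>)) \<notin> \<Phi>p" using sub unfolding inversions_def by auto
    then have "- (u \<star> \<beta>) \<notin> \<Phi>p" using u v by (simp add: act_mult act_linear)
    then show False using \<beta> \<beta>' neg_iff root_act u unfolding inversions_def by auto
  qed
  have "(\<star>) (inv v) ` inversions u \<subseteq> inversions (u \<otimes> v)"
    using pos u v by (auto simp: inversions_def act_mult)
  then show "inversions (u \<otimes> v) = inversions v \<union> (\<star>) (inv v) ` inversions u"
    using sub inversions_mult[OF u v] by blast
  show "inversions v \<inter> (\<star>) (inv v) ` inversions u = {}"
    using v by (auto simp: inversions_def)
qed

text \<open>\<open>inversions_mult\<close> bounds the inversions of the product by a union of two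
  sets of sizes \<open>len v\<close> and \<open>len u\<close>. Lengths add exactly when this union
  is disjoint and fully attained.\<close>

lemma len_add_iff:
  assumes u: "u \<in> carrier W" and v: "v \<in> carrier W"
  shows "len (u \<otimes> v) = len u + len v \<longleftrightarrow> inversions v \<subseteq> inversions (u \<otimes> v)"
proof
  assume "inversions v \<subseteq> inversions (u \<otimes> v)"
  from inversions_mult_eq[OF u v this] show "len (u \<otimes> v) = len u + len v"
    using u v by (simp add: card_inversions[symmetric] card_Un_disjoint)
next
  assume eq: "len (u \<otimes> v) = len u + len v"
  have "card (inversions v \<union> (\<star>) (inv v) ` inversions u) \<le> card (inversions v) + card (inversions u)"
    using card_Un_le[of "inversions v" "(\<star>) (inv v) ` inversions u"] v by simp
  then have "card (inversions v \<union> (\<star>) (inv v) ` inversions u) \<le> card (inversions (u \<otimes> v))"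
    using eq u v by (simp add: card_inversions)
  then have "inversions (u \<otimes> v) = inversions v \<union> (\<star>) (inv v) ` inversions u"
    using inversions_mult[OF u v] u v by (intro card_seteq) auto
  then show "inversions v \<subseteq> inversions (u \<otimes> v)" by blast
qed

text \<open>In \<open>u = (u \<otimes> inv v) \<otimes> v\<close> lengths add by the inclusion
  criterion, while \<open>u\<close> and \<open>v\<close> have equal length; so the first factor has
  length 0.\<close>

lemma inversions_inject:
  assumes "u \<in> carrier W" "v \<in> carrier W" "inversions u = inversions v" shows "u = v"
proof -
  have uv: "u \<otimes> inv v \<otimes> v = u" using assms by (simp add: m_assoc)
  have "len (u \<otimes> inv v \<otimes> v) = len (u \<otimes> inv v) + len v"
    by (subst len_add_iff) (use assms uv in auto)
  moreover have "len u = len v" using assms by (simp add: card_inversions[symmetric])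
  ultimately have "len (u \<otimes> inv v) = 0" using uv by simp
  then have "u \<otimes> inv v = \<one>" using len_eq_0_iff assms by auto
  then show ?thesis using uv assms by simp
qed

lemma eq_one_if_simple_pos:
  assumes "w \<in> carrier W" "\<And>s. s \<in> S \<Longrightarrow> w \<star> \<alpha> s \<in> \<Phi>p" shows "w = \<one>"
proof (rule ccontr)
  assume "w \<noteq> \<one>"
  then obtain s where "s \<in> S" "len (w \<otimes> s) < len w" using ex_descent assms by blast
  then show False using assms descent_iff by blast
qed

lemma act_faithful:
  assumes "u \<in> carrier W" "v \<in> carrier W" "\<And>s. s \<in> S \<Longrightarrow> u \<star> \<alpha> s = v \<star> \<alpha> s" shows "u = v"
proof -
  have "inv v \<otimes> u = \<one>" by (rule eq_one_if_simple_pos) (use assms in \<open>auto simp: act_mult\<close>)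
  then show ?thesis using assms by (metis inv_equality inv_inv inv_closed)
qed

section \<open>Reflections in roots\<close>

lemma conj_gen_act:
  assumes "w \<in> carrier W" "s \<in> S" "Poly_Mapping.keys v \<subseteq> S"
  shows "(w \<otimes> s \<otimes> inv w) \<star> v = v - scale_vec (2 * form W (w \<star> \<alpha> s) v) (w \<star> \<alpha> s)"
proof -
  have "form W (w \<star> \<alpha> s) v = form W (w \<star> \<alpha> s) (w \<star> inv w \<star> v)" using assms by simp
  also have "\<dots> = form W (\<alpha> s) (inv w \<star> v)" by (rule form_act) (use assms keys_act in auto)
  finally show ?thesis using assms by (simp add: act_mult act_linear act_gen)
qed

text \<open>\<open>reflection\<close> is a definite description over all ways to write the root. By
  \<open>conj_gen_act\<close> every candidate acts through the root alone, and the action is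
  faithful, so there is only one.\<close>

lemma reflection_conj:
  assumes "w \<in> carrier W" "s \<in> S" shows "reflection W S (w \<star> \<alpha> s) = w \<otimes> s \<otimes> inv w"
  unfolding reflection_def
proof (rule the_equality)
  fix r assume "\<exists>w'\<in>carrier W. \<exists>s'\<in>S. w \<star> \<alpha> s = w' \<star> \<alpha> s' \<and> r = w' \<otimes> s' \<otimes> inv w'"
  then obtain w' s' where *: "w' \<in> carrier W" "s' \<in> S" "w \<star> \<alpha> s = w' \<star> \<alpha> s'" "r = w' \<otimes> s' \<otimes> inv w'"
    by blast
  show "r = w \<otimes> s \<otimes> inv w"
    by (rule act_faithful) (use * assms conj_gen_act in auto)
qed (use assms in blast)

lemma reflection_props:
  assumes "\<gamma> \<in> \<Phi>"
  shows reflection_closed: "reflection W S \<gamma> \<in> carrier W"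
    and reflection_act: "Poly_Mapping.keys v \<subseteq> S \<Longrightarrow>
      reflection W S \<gamma> \<star> v = v - scale_vec (2 * form W \<gamma> v) \<gamma>"
    and reflection_conj_act: "u \<in> carrier W \<Longrightarrow>
      reflection W S (u \<star> \<gamma>) = u \<otimes> reflection W S \<gamma> \<otimes> inv u"
    and reflection_involution: "reflection W S \<gamma> \<otimes> reflection W S \<gamma> = \<one>"
    and reflection_uminus: "reflection W S (- \<gamma>) = reflection W S \<gamma>"
proof -
  obtain w s where *: "w \<in> carrier W" "s \<in> S" "\<gamma> = w \<star> \<alpha> s" using assms by (elim rootsE)
  show cl: "reflection W S \<gamma> \<in> carrier W" using * reflection_conj by auto
  show act: "reflection W S \<gamma> \<star> v = v - scale_vec (2 * form W \<gamma> v) \<gamma>" if "Poly_Mapping.keys v \<subseteq> S" for v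
    using * that by (simp add: reflection_conj conj_gen_act)
  show "reflection W S (u \<star> \<gamma>) = u \<otimes> reflection W S \<gamma> \<otimes> inv u" if "u \<in> carrier W"
    using that * by (simp add: act_mult[symmetric] reflection_conj inv_mult_group m_assoc)
  have "(w \<otimes> s \<otimes> inv w) \<otimes> (w \<otimes> s \<otimes> inv w) = w \<otimes> s \<otimes> (inv w \<otimes> w) \<otimes> s \<otimes> inv w"
    using * by (simp only: m_assoc m_closed inv_closed gens_carrier)
  then show "reflection W S \<gamma> \<otimes> reflection W S \<gamma> = \<one>"
    using * by (simp add: reflection_conj)
  have "- \<gamma> = (w \<otimes> s) \<star> \<alpha> s" using * by (simp add: act_mult act_linear)
  then have "reflection W S (- \<gamma>) = (w \<otimes> s) \<otimes> s \<otimes> inv (w \<otimes> s)" using * reflection_conj[of "w \<otimes> s" s] by simp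
  then show "reflection W S (- \<gamma>) = reflection W S \<gamma>" using * by (simp add: reflection_conj inv_mult_group m_assoc)
qed

lemma reflection_self: "\<gamma> \<in> \<Phi> \<Longrightarrow> reflection W S \<gamma> \<star> \<gamma> = - \<gamma>"
  by (rule vec_eqI) (simp add: reflection_act root_keys root_norm lookup_minus)

lemma reflection_inject:
  assumes "\<gamma> \<in> \<Phi>p" "\<delta> \<in> \<Phi>p" "reflection W S \<gamma> = reflection W S \<delta>" shows "\<gamma> = \<delta>"
proof -
  have "- \<gamma> = \<gamma> - scale_vec (2 * form W \<delta> \<gamma>) \<delta>"
    using assms reflection_self[of \<gamma>] reflection_act[of \<delta> \<gamma>] by (simp add: pos_root_root root_keys)
  then have "\<gamma> = scale_vec (form W \<delta> \<gamma>) \<delta>"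
    by (auto simp: vec_eq_iff lookup_minus algebra_simps)
  then show ?thesis using pos_parallel_eq assms by blast
qed

lemma reflection_inv: "\<gamma> \<in> \<Phi> \<Longrightarrow> inv (reflection W S \<gamma>) = reflection W S \<gamma>"
  by (rule inv_equality) (auto simp: reflection_involution reflection_closed)

lemma reflection_simple [simp]: "s \<in> S \<Longrightarrow> reflection W S (\<alpha> s) = s"
  using reflection_conj[of \<one> s] by simp

end

section \<open>Parabolic subgroups and longest elements\<close>

abbreviation supp :: "'a vec \<Rightarrow> 'a set" where "supp \<equiv> Poly_Mapping.keys"

context coxeter_system
begin

lemma parabolic_closed: "J \<subseteq> S \<Longrightarrow> u \<in> generate W J \<Longrightarrow> u \<in> carrier W"
  by (rule generate_in_carrier) (use gens_subset in auto)

lemma parabolic_induct [consumes 2, case_names one mult]: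
  assumes "J \<subseteq> S" "w \<in> generate W J" "P \<one>"
    "\<And>s w. s \<in> J \<Longrightarrow> s \<in> S \<Longrightarrow> w \<in> carrier W \<Longrightarrow> w \<in> generate W J \<Longrightarrow> P w \<Longrightarrow> P (s \<otimes> w)"
  shows "P w"
proof -
  obtain ws where ws: "set ws \<subseteq> J" "word_prod W ws = w" using generate_word[OF assms(1,2)] by blast
  have "P (word_prod W ws)" using ws(1)
  proof (induction ws)
    case (Cons s ws)
    then have ws: "set ws \<subseteq> S" "set ws \<subseteq> J" and s: "s \<in> J" "s \<in> S" using assms(1) by auto
    have "P (s \<otimes> word_prod W ws)"
      by (rule assms(4)[OF s]) (use ws Cons.IH in \<open>auto simp: set_S_carrier intro: word_generate\<close>)
    then show ?case by simp
  qed (use assms(3) in simp)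
  then show ?thesis using ws by simp
qed

lemma parabolic_inv: "J \<subseteq> S \<Longrightarrow> u \<in> generate W J \<Longrightarrow> inv u \<in> generate W J"
  by (rule generate_m_inv_closed) (use gens_subset in auto)

lemma parabolic_act_lookup:
  assumes "J \<subseteq> S" "u \<in> generate W J" "k \<notin> J" shows "lk (u \<star> v) k = lk v k"
  using assms(1,2)
proof (induction rule: parabolic_induct)
  case (mult s w)
  then show ?case using assms(3) by (auto simp: act_mult act_gen lookup_minus lookup_simple_root)
qed simp

lemma parabolic_act_supp:
  assumes "J \<subseteq> S" "u \<in> generate W J" "J \<subseteq> C" "supp v \<subseteq> C" shows "supp (u \<star> v) \<subseteq> C"
proof
  fix k assume k: "k \<in> supp (u \<star> v)"
  show "k \<in> C"
  proof (cases "k \<in> J")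
    case False
    then have "k \<in> supp v" using k parabolic_act_lookup[OF assms(1,2)] by (simp add: in_keys_iff)
    then show ?thesis using assms by auto
  qed (use assms in auto)
qed

lemma parabolic_act_fixed:
  assumes "J \<subseteq> S" "u \<in> generate W J" "\<And>j. j \<in> J \<Longrightarrow> form W (\<alpha> j) v = 0" shows "u \<star> v = v"
  using assms(1,2)
  by (induction rule: parabolic_induct) (auto simp: act_mult act_gen assms(3))

text \<open>Cut out by support rather than as an orbit under the parabolic subgroup, because
  supports are what coordinate arguments control.\<close>

definition par_pos :: "'a set \<Rightarrow> 'a vec set" where "par_pos J = {\<gamma> \<in> \<Phi>p. supp \<gamma> \<subseteq> J}"

lemma pos_root_coeff_outside:
  assumes "\<gamma> \<in> \<Phi>p" "\<not> supp \<gamma> \<subseteq> J" obtains k where "k \<notin> J" "k \<in> S" "0 < lk \<gamma> k"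
proof -
  obtain k where k: "k \<in> supp \<gamma>" "k \<notin> J" using assms by blast
  then have "0 < lk \<gamma> k" using assms(1) by (metis in_keys_iff less_eq_real_def pos_roots_iff)
  then show ?thesis using k assms root_keys pos_root_root by (intro that[of k]) auto
qed

text \<open>Elements of the parabolic subgroup leave the coordinates outside \<open>J\<close>
  unchanged, and one of these is positive.\<close>

lemma parabolic_act_pos:
  assumes J: "J \<subseteq> S" "u \<in> generate W J" and \<gamma>: "\<gamma> \<in> \<Phi>p" "\<not> supp \<gamma> \<subseteq> J"
  shows "u \<star> \<gamma> \<in> \<Phi>p" "\<not> supp (u \<star> \<gamma>) \<subseteq> J"
proof -
  obtain k where k: "k \<notin> J" "0 < lk \<gamma> k" using pos_root_coeff_outside[OF \<gamma>] by blast
  then have *: "0 < lk (u \<star> \<gamma>) k" using parabolic_act_lookup[OF J] by simp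
  then show "u \<star> \<gamma> \<in> \<Phi>p"
    by (rule pos_coeff[OF root_act[OF pos_root_root[OF \<gamma>(1)] parabolic_closed[OF J]]])
  show "\<not> supp (u \<star> \<gamma>) \<subseteq> J" using k * by (metis in_keys_iff less_irrefl subsetD)
qed

lemma inversions_parabolic: "J \<subseteq> S \<Longrightarrow> u \<in> generate W J \<Longrightarrow> inversions u \<subseteq> par_pos J"
  using parabolic_act_pos(1) unfolding inversions_def par_pos_def by blast

lemma simple_inversion_iff: "s \<in> S \<Longrightarrow> w \<in> carrier W \<Longrightarrow> \<alpha> s \<in> inversions w \<longleftrightarrow> len (w \<otimes> s) < len w"
  by (simp add: descent_iff inversions_def)

text \<open>A right descent \<open>s\<close> of such an element has its simple root among the
  inversions, so \<open>s\<close> lies in \<open>J\<close>; removing it preserves the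
  assumption.\<close>

lemma mem_parabolic_if_inversions:
  assumes J: "J \<subseteq> S" and "w \<in> carrier W" "inversions w \<subseteq> par_pos J" shows "w \<in> generate W J"
  using assms(2,3)
proof (induction "len w" arbitrary: w rule: less_induct)
  case less
  show ?case
  proof (cases "w = \<one>")
    case False
    then obtain s where s: "s \<in> S" "len (w \<otimes> s) < len w" using ex_descent less by blast
    let ?v = "w \<otimes> s"
    have v: "?v \<in> carrier W" "?v \<otimes> s = w" using s less by auto
    have "\<alpha> s \<in> inversions w" using s less by (simp add: simple_inversion_iff)
    then have sJ: "s \<in> J" using less.prems unfolding par_pos_def by auto
    have asc: "?v \<star> \<alpha> s \<in> \<Phi>p" using ascent_iff[of ?v s] s v by auto
    have "inversions ?v \<subseteq> par_pos J"
    proof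
      fix \<delta> assume \<delta>: "\<delta> \<in> inversions ?v"
      then have "s \<star> \<delta> \<in> inversions w" using inversions_ascent(1)[OF v(1) s(1) asc] v by auto
      then have "supp (s \<star> \<delta>) \<subseteq> J" using less.prems unfolding par_pos_def by auto
      then have "supp (s \<star> s \<star> \<delta>) \<subseteq> J"
        by (rule parabolic_act_supp[OF J generate.incl[OF sJ] subset_refl])
      then show "\<delta> \<in> par_pos J" using \<delta> s unfolding par_pos_def inversions_def by simp
    qed
    then have "?v \<in> generate W J" using less.hyps[OF s(2) v(1)] by blast
    then have "?v \<otimes> s \<in> generate W J" using sJ by (auto intro: generate.intros)
    then show ?thesis using v by simp
  qed (simp add: generate.one)
qed

lemma parabolic_eq_one:
  assumes "J \<subseteq> S" "u \<in> generate W J" "\<And>j. j \<in> J \<Longrightarrow> u \<star> \<alpha> j \<in> \<Phi>p" shows "u = \<one>"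
proof (rule eq_one_if_simple_pos)
  show u: "u \<in> carrier W" using assms parabolic_closed by blast
  fix s assume s: "s \<in> S"
  show "u \<star> \<alpha> s \<in> \<Phi>p"
  proof (cases "s \<in> J")
    case False
    show ?thesis by (rule parabolic_act_pos(1)[OF assms(1,2)]) (use s False in auto)
  qed (use assms in auto)
qed

lemma act_expand: "w \<in> carrier W \<Longrightarrow> w \<star> v = (\<Sum>k\<in>supp v. scale_vec (lk v k) (w \<star> \<alpha> k))"
  by (rule linear_vec_expand[OF linear_act])

lemma act_lookup_expand: "w \<in> carrier W \<Longrightarrow> lk (w \<star> v) i = (\<Sum>k\<in>supp v. lk v k * lk (w \<star> \<alpha> k) i)"
  by (subst act_expand) (simp_all add: lookup_sum)

lemma act_supp_into:
  assumes "w \<in> carrier W" "\<And>j. j \<in> supp v \<Longrightarrow> supp (w \<star> \<alpha> j) \<subseteq> C" shows "supp (w \<star> v) \<subseteq> C"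
proof
  fix k assume k: "k \<in> supp (w \<star> v)"
  show "k \<in> C"
  proof (rule ccontr)
    assume "k \<notin> C"
    then have "lk (w \<star> \<alpha> j) k = 0" if "j \<in> supp v" for j using assms(2)[OF that] by (auto simp: in_keys_iff)
    then have "lk (w \<star> v) k = 0" using act_lookup_expand[OF assms(1), of v] by simp
    then show False using k by (simp add: in_keys_iff)
  qed
qed

lemma act_pos_into:
  assumes w: "w \<in> carrier W" and \<gamma>: "\<gamma> \<in> \<Phi>p" and pos: "\<And>j. j \<in> supp \<gamma> \<Longrightarrow> w \<star> \<alpha> j \<in> \<Phi>p"
  shows "w \<star> \<gamma> \<in> \<Phi>p"
proof -
  have "0 \<le> lk (w \<star> \<gamma>) i" for i
    unfolding act_lookup_expand[OF w, of \<gamma>] using \<gamma> pos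
    by (intro sum_nonneg mult_nonneg_nonneg) (auto simp: pos_roots_iff)
  then show ?thesis using root_act[OF pos_root_root[OF \<gamma>] w] by (simp add: pos_roots_iff)
qed

section \<open>Finite parabolic subgroups and their longest elements\<close>

lemma finite_type_finite: "finite_type W J \<Longrightarrow> finite J"
  unfolding finite_type_def by (rule finite_subset) (auto intro: generate.incl)

lemma finite_type_subset: "finite_type W J \<Longrightarrow> J' \<subseteq> J \<Longrightarrow> finite_type W J'"
  unfolding finite_type_def by (rule finite_subset[OF mono_generate])

text \<open>Elements are determined by their inversions, which are here subsets of a finite
  set.\<close>

lemma finite_type_if_finite_par_pos:
  assumes J: "J \<subseteq> S" and "finite (par_pos J)" shows "finite_type W J"
  unfolding finite_type_def
proof (rule inj_on_finite)
  show "inj_on inversions (generate W J)"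
    by (intro inj_onI inversions_inject) (use parabolic_closed[OF J] in auto)
  show "inversions ` generate W J \<subseteq> Pow (par_pos J)" using inversions_parabolic[OF J] by auto
qed (use assms in simp)

lemma longest_exists:
  assumes J: "J \<subseteq> S" and fin: "finite_type W J"
  shows "\<exists>w\<in>generate W J. (\<forall>u\<in>generate W J. len u \<le> len w)"
proof -
  have fin: "finite (generate W J)" "generate W J \<noteq> {}"
    using fin generate.one unfolding finite_type_def by auto
  then have "Max (len ` generate W J) \<in> len ` generate W J" by (intro Max_in) auto
  then obtain w where "w \<in> generate W J" "Max (len ` generate W J) = len w" by blast
  moreover have "len u \<le> Max (len ` generate W J)" if "u \<in> generate W J" for u
    using fin that by (intro Max_ge) auto
  ultimately show ?thesis by auto
qed

text \<open>Maximal length makes every letter of \<open>J\<close> a descent, so nonnegative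
  combinations of the simple roots in \<open>J\<close> become nonpositive. As inversions determine
  the element, this also makes the longest element unique.\<close>

lemma maximal_inversions:
  assumes J: "J \<subseteq> S" and w: "w \<in> generate W J" and max: "\<And>u. u \<in> generate W J \<Longrightarrow> len u \<le> len w"
  shows "inversions w = par_pos J"
proof
  show "inversions w \<subseteq> par_pos J" by (rule inversions_parabolic[OF J w])
  have wc: "w \<in> carrier W" using parabolic_closed[OF J w] .
  have neg: "w \<star> \<alpha> j \<notin> \<Phi>p" if "j \<in> J" for j
  proof -
    have "w \<otimes> j \<in> generate W J" using w that by (auto intro: generate.intros)
    then have "len (w \<otimes> j) \<le> len w" by (rule max)
    then show ?thesis using ascent_iff[OF wc, of j] that J by auto
  qed
  show "par_pos J \<subseteq> inversions w"
  proof
    fix \<gamma> assume \<gamma>: "\<gamma> \<in> par_pos J"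
    have "lk (w \<star> \<gamma>) i \<le> 0" for i
      unfolding act_lookup_expand[OF wc, of \<gamma>]
    proof (rule sum_nonpos)
      fix k assume "k \<in> supp \<gamma>"
      then have k: "k \<in> J" using \<gamma> unfolding par_pos_def by auto
      then have "- (w \<star> \<alpha> k) \<in> \<Phi>p" using neg neg_iff wc J root_act[OF simple_root_root, of k w] by blast
      then have "0 \<le> lk (- (w \<star> \<alpha> k)) i" unfolding pos_roots_iff by blast
      moreover have "0 \<le> lk \<gamma> k" using \<gamma> unfolding par_pos_def pos_roots_iff by auto
      ultimately show "lk \<gamma> k * lk (w \<star> \<alpha> k) i \<le> 0" by (simp add: mult_nonneg_nonpos)
    qed
    then have "\<forall>i. 0 \<le> lk (- (w \<star> \<gamma>)) i" by simp
    moreover have "w \<star> \<gamma> \<in> \<Phi>" "\<gamma> \<in> \<Phi>p" using \<gamma> wc root_act pos_root_root unfolding par_pos_def by auto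
    ultimately show "\<gamma> \<in> inversions w" using root_uminus not_pos_neg unfolding inversions_def
      by (metis (mono_tags, lifting) mem_Collect_eq pos_roots_iff)
  qed
qed

lemma longest_props:
  assumes J: "J \<subseteq> S" and fin: "finite_type W J"
  shows longest_mem: "longest W S J \<in> generate W J" and inversions_longest: "inversions (longest W S J) = par_pos J"
proof -
  obtain w where w: "w \<in> generate W J" "\<And>u. u \<in> generate W J \<Longrightarrow> len u \<le> len w"
    using longest_exists[OF J fin] by blast
  have eq: "longest W S J = w" unfolding longest_def
  proof (rule the_equality)
    fix v assume v: "v \<in> generate W J \<and> (\<forall>u \<in> generate W J. len u \<le> len v)"
    show "v = w"
      by (rule inversions_inject) (use v w maximal_inversions[OF J] parabolic_closed[OF J] in auto)
  qed (use w in blast)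
  show "longest W S J \<in> generate W J" "inversions (longest W S J) = par_pos J"
    unfolding eq using w maximal_inversions[OF J] by auto
qed

lemma longest_closed: "J \<subseteq> S \<Longrightarrow> finite_type W J \<Longrightarrow> longest W S J \<in> carrier W"
  using longest_mem parabolic_closed by blast

text \<open>The inverse has the same length, hence as many inversions inside the same finite set
  \<open>par_pos J\<close>.\<close>

lemma longest_inv:
  assumes J: "J \<subseteq> S" and fin: "finite_type W J" shows "inv (longest W S J) = longest W S J"
proof (rule inversions_inject)
  let ?w = "longest W S J"
  note w = longest_closed[OF J fin]
  show "?w \<in> carrier W" "inv ?w \<in> carrier W" using w by auto
  have "inversions (inv ?w) = par_pos J"
  proof (rule card_subset_eq)
    show "finite (par_pos J)" using finite_inversions[OF w] inversions_longest[OF J fin] by simp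
    show "inversions (inv ?w) \<subseteq> par_pos J"
      by (intro inversions_parabolic[OF J] parabolic_inv[OF J] longest_mem[OF J fin])
    show "card (inversions (inv ?w)) = card (par_pos J)"
      using w inversions_longest[OF J fin, symmetric] by (simp add: card_inversions len_inv)
  qed
  then show "inversions (inv ?w) = inversions ?w" using inversions_longest[OF J fin] by simp
qed

text \<open>With \<open>\<beta> = - (w \<star> \<alpha> j)\<close>, where \<open>w\<close> is the
  longest element, \<alpha> j is a combination with positive coefficients of the positive roots
  \<open>- (w \<star> \<alpha> k)\<close> for \<open>k\<close> in the support of \<beta>. Each of
  these is therefore supported at \<open>j\<close> alone and equals \<alpha> j.\<close>

lemma longest_simple:
  assumes J: "J \<subseteq> S" and fin: "finite_type W J" and j: "j \<in> J"
  shows "\<exists>k\<in>J. longest W S J \<star> \<alpha> j = - \<alpha> k"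
proof -
  let ?w = "longest W S J"
  note w = longest_closed[OF J fin]
  have ww: "?w \<star> ?w \<star> v = v" for v using act_inv_act[OF w] longest_inv[OF J fin] by simp
  have neg: "- (?w \<star> \<alpha> k) \<in> \<Phi>p" if "k \<in> J" for k
  proof -
    have "\<alpha> k \<in> inversions ?w" using that J unfolding inversions_longest[OF J fin] par_pos_def by auto
    then show ?thesis using neg_iff root_act w J that unfolding inversions_def by auto
  qed
  define \<beta> where "\<beta> = - (?w \<star> \<alpha> j)"
  have \<beta>: "\<beta> \<in> \<Phi>p" unfolding \<beta>_def by (rule neg[OF j])
  have "supp (?w \<star> \<alpha> j) \<subseteq> J" by (rule parabolic_act_supp[OF J longest_mem[OF J fin]]) (use j in auto)
  then have \<beta>J: "supp \<beta> \<subseteq> J" unfolding \<beta>_def by simp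
  have j_eq: "\<alpha> j = - (?w \<star> \<beta>)" unfolding \<beta>_def using w ww by (simp add: act_linear)
  have "supp \<beta> \<noteq> {}" using \<beta> root_nonzero pos_root_root by auto
  then obtain k where k: "k \<in> supp \<beta>" by blast
  have \<beta>pos: "0 < lk \<beta> i" if "i \<in> supp \<beta>" for i
    using that \<beta> by (metis in_keys_iff less_eq_real_def pos_roots_iff)
  have zero: "lk (- (?w \<star> \<alpha> k)) i = 0" if i: "i \<noteq> j" for i
  proof -
    have "(\<Sum>k\<in>supp \<beta>. lk \<beta> k * lk (- (?w \<star> \<alpha> k)) i) = lk (\<alpha> j) i"
      unfolding j_eq using act_lookup_expand[OF w, of \<beta>] by (simp add: sum_negf)
    also have "\<dots> = 0" using i by (simp add: lookup_simple_root)
    finally have S0: "(\<Sum>k\<in>supp \<beta>. lk \<beta> k * lk (- (?w \<star> \<alpha> k)) i) = 0" .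
    have nn: "0 \<le> lk \<beta> k * lk (- (?w \<star> \<alpha> k)) i" if "k \<in> supp \<beta>" for k
    proof (rule mult_nonneg_nonneg)
      show "0 \<le> lk \<beta> k" using \<beta>pos[OF that] by simp
      show "0 \<le> lk (- (?w \<star> \<alpha> k)) i" using neg[of k] that \<beta>J unfolding pos_roots_iff by blast
    qed
    have "lk \<beta> k * lk (- (?w \<star> \<alpha> k)) i = 0"
      by (rule sum_nonneg_0[OF finite_keys nn S0 k])
    then show ?thesis using \<beta>pos[OF k] by (simp only: mult_eq_0_iff) auto
  qed
  have "- (?w \<star> \<alpha> k) = \<alpha> j"
  proof (rule ccontr)
    assume ne: "- (?w \<star> \<alpha> k) \<noteq> \<alpha> j"
    obtain i where "i \<noteq> j" "0 < lk (- (?w \<star> \<alpha> k)) i"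
      using pos_root_other_coeff[OF neg _ ne] k \<beta>J j J by blast
    then show False using zero by simp
  qed
  then have "?w \<star> \<alpha> j = - (?w \<star> ?w \<star> \<alpha> k)" using w by (metis act_linear(4))
  then have "?w \<star> \<alpha> j = - \<alpha> k" using ww by simp
  then show ?thesis using k \<beta>J by blast
qed

text \<open>Covers both the generators, where \<open>L\<close> is \<open>K\<close> without one
  letter, and the rank two elements of braid moves, where two letters are removed.\<close>

definition longest_quotient :: "'a set \<Rightarrow> 'a set \<Rightarrow> 'a" where
  "longest_quotient K L = longest W S K \<otimes> longest W S L"

context
  fixes K L assumes K: "K \<subseteq> S" and fin: "finite_type W K" and L: "L \<subseteq> K"
begin

lemma longest_quotient_mem: "longest_quotient K L \<in> generate W K"
proof -
  have "longest W S L \<in> generate W L" using longest_mem[of L] K L finite_type_subset[OF fin L] by blast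
  then have "longest W S L \<in> generate W K" using mono_generate[OF L] by blast
  then show ?thesis unfolding longest_quotient_def using longest_mem[OF K fin] by (auto intro: generate.eng)
qed

lemma longest_quotient_closed: "longest_quotient K L \<in> carrier W"
  using longest_quotient_mem parabolic_closed[OF K] by blast

lemma longest_quotient_act: "longest_quotient K L \<star> v = longest W S K \<star> longest W S L \<star> v"
  unfolding longest_quotient_def
  using longest_closed[OF K fin] longest_closed[of L] K L finite_type_subset[OF fin L]
  by (intro act_mult) auto

text \<open>Each of the two longest elements sends simple roots to negatives of simple roots, and
  the two signs cancel.\<close>

lemma longest_quotient_simple:
  assumes "l \<in> L" shows "\<exists>k\<in>K. longest_quotient K L \<star> \<alpha> l = \<alpha> k"
proof -
  have LS: "L \<subseteq> S" using K L by auto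
  obtain l' where l': "l' \<in> L" "longest W S L \<star> \<alpha> l = - \<alpha> l'"
    using longest_simple[OF LS finite_type_subset[OF fin L] assms] by blast
  obtain k where k: "k \<in> K" "longest W S K \<star> \<alpha> l' = - \<alpha> k"
    using longest_simple[OF K fin, of l'] l' L by blast
  then have "longest_quotient K L \<star> \<alpha> l = \<alpha> k"
    unfolding longest_quotient_act using longest_closed[OF K fin] by (simp add: l' k act_linear)
  then show ?thesis using k by blast
qed

text \<open>The longest element of \<open>L\<close> keeps the positive roots of \<open>K\<close>
  that are not supported in \<open>L\<close> positive and inside \<open>K\<close>, where the longest
  element of \<open>K\<close> negates everything.\<close>

lemma inversions_longest_quotient: "inversions (longest_quotient K L) = par_pos K - par_pos L"
proof -
  have LS: "L \<subseteq> S" using K L by auto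
  note finL = finite_type_subset[OF fin L]
  let ?h = "longest_quotient K L"
  have posL: "?h \<star> \<gamma> \<in> \<Phi>p" if "\<gamma> \<in> par_pos L" for \<gamma>
  proof (rule act_pos_into[OF longest_quotient_closed])
    show "\<gamma> \<in> \<Phi>p" using that unfolding par_pos_def by blast
    fix j assume "j \<in> supp \<gamma>"
    then have "j \<in> L" using that unfolding par_pos_def by blast
    then obtain k where "k \<in> K" "?h \<star> \<alpha> j = \<alpha> k" using longest_quotient_simple by blast
    then show "?h \<star> \<alpha> j \<in> \<Phi>p" using K by auto
  qed
  have neg: "?h \<star> \<gamma> \<notin> \<Phi>p" if \<gamma>: "\<gamma> \<in> par_pos K" "\<gamma> \<notin> par_pos L" for \<gamma>
  proof -
    have "longest W S L \<star> \<gamma> \<in> \<Phi>p"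
      using parabolic_act_pos(1)[OF LS longest_mem[OF LS finL]] \<gamma> unfolding par_pos_def by blast
    moreover have "supp (longest W S L \<star> \<gamma>) \<subseteq> K"
      by (rule parabolic_act_supp[OF LS longest_mem[OF LS finL] L]) (use \<gamma> in \<open>auto simp: par_pos_def\<close>)
    ultimately have "longest W S L \<star> \<gamma> \<in> inversions (longest W S K)"
      unfolding inversions_longest[OF K fin] par_pos_def by blast
    then show ?thesis unfolding longest_quotient_act inversions_def by blast
  qed
  show ?thesis
    using posL neg inversions_parabolic[OF K longest_quotient_mem] unfolding inversions_def par_pos_def by blast
qed

end

section \<open>Connected components of the Coxeter graph\<close>

lemma cox_adj_iff: "(s, t) \<in> cox_adj W \<longleftrightarrow> s \<noteq> t \<and> (cox_m W s t = 0 \<or> 3 \<le> cox_m W s t)"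
  unfolding cox_adj_def by auto

lemma cox_cos_nonadj:
  assumes "s \<in> S" "t \<in> S" "s \<noteq> t" "(s, t) \<notin> cox_adj W" shows "cox_cos W s t = 0"
proof -
  have "cox_m W s t = 2" using assms cox_m_neq_1[OF assms(1-3)] unfolding cox_adj_iff by auto
  then show ?thesis unfolding cox_cos_def by simp
qed

lemma cox_cos_adj: assumes "(s, t) \<in> cox_adj W" shows "cox_cos W s t < 0"
proof (cases "cox_m W s t = 0")
  case False
  then have m: "3 \<le> cox_m W s t" using assms unfolding cox_adj_iff by auto
  have "0 < cos (pi / real (cox_m W s t))"
  proof (rule cos_gt_zero_pi)
    have "0 < pi / real (cox_m W s t)" using m by simp
    then show "- (pi / 2) < pi / real (cox_m W s t)" using pi_gt_zero by linarith
    have "2 < real (cox_m W s t)" using m by linarith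
    then show "pi / real (cox_m W s t) < pi / 2" using pi_gt_zero by (intro divide_strict_left_mono) auto
  qed
  then show ?thesis unfolding cox_cos_def using False by simp
qed (simp add: cox_cos_def)

lemma cox_cos_nonpos: "s \<in> S \<Longrightarrow> t \<in> S \<Longrightarrow> s \<noteq> t \<Longrightarrow> cox_cos W s t \<le> 0"
  using cox_cos_nonadj cox_cos_adj by fastforce

lemma components_subset: "components W J T \<subseteq> J \<union> T"
proof
  fix s assume "s \<in> components W J T"
  then obtain k where "(k, s) \<in> (cox_adj W \<inter> (J \<union> T) \<times> (J \<union> T))\<^sup>*" "k \<in> T" unfolding components_def by blast
  then show "s \<in> J \<union> T" by (induction rule: rtrancl_induct) auto
qed

lemma components_incl: "T \<subseteq> components W J T"
  unfolding components_def by auto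

lemma components_adj: "k \<in> components W J T \<Longrightarrow> (k, s) \<in> cox_adj W \<Longrightarrow> s \<in> J \<union> T \<Longrightarrow> s \<in> components W J T"
proof -
  assume k: "k \<in> components W J T" and adj: "(k, s) \<in> cox_adj W" "s \<in> J \<union> T"
  then have "k \<in> J \<union> T" using components_subset by blast
  then have "(k, s) \<in> cox_adj W \<inter> (J \<union> T) \<times> (J \<union> T)" using adj by blast
  moreover obtain t where "t \<in> T" "(t, k) \<in> (cox_adj W \<inter> (J \<union> T) \<times> (J \<union> T))\<^sup>*"
    using k unfolding components_def by blast
  ultimately show ?thesis unfolding components_def by (blast intro: rtrancl_into_rtrancl)
qed

lemma components_induct [consumes 1, case_names base step]:
  assumes "k \<in> components W J T" "\<And>t. t \<in> T \<Longrightarrow> P t"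
    "\<And>k k'. k \<in> components W J T \<Longrightarrow> k' \<in> components W J T \<Longrightarrow> (k, k') \<in> cox_adj W \<Longrightarrow> P k \<Longrightarrow> P k'"
  shows "P k"
proof -
  obtain t where t: "t \<in> T" and path: "(t, k) \<in> (cox_adj W \<inter> (J \<union> T) \<times> (J \<union> T))\<^sup>*"
    using assms(1) unfolding components_def by blast
  from path have "k \<in> components W J T \<and> P k"
  proof (induction rule: rtrancl_induct)
    case base
    then show ?case using t assms(2) components_incl by blast
  next
    case (step y z)
    then have "z \<in> components W J T" using components_adj[of y J T z] by auto
    then show ?case using assms(3)[of y z] step by auto
  qed
  then show ?thesis by blast
qed

text \<open>A letter of \<open>J\<close> adjacent to the component would belong to it.\<close>

lemma components_orth:
  assumes "J \<subseteq> S" "T \<subseteq> S" "k \<in> J" "k \<notin> components W J T" "j \<in> components W J T"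
  shows "cox_cos W j k = 0"
proof (rule cox_cos_nonadj)
  show "j \<in> S" "k \<in> S" using assms components_subset[of J T] by auto
  show "j \<noteq> k" using assms by auto
  show "(j, k) \<notin> cox_adj W" using components_adj[of j J T k] assms by auto
qed

section \<open>Descents of an element that sends the simple roots of \<open>A\<close> to simple
  roots\<close>

context
  fixes A T w
  assumes A: "A \<subseteq> S" and T: "T \<subseteq> S" and AT: "A \<inter> T = {}" and w: "w \<in> carrier W"
    and simple: "\<And>a. a \<in> A \<Longrightarrow> \<exists>c\<in>S. w \<star> \<alpha> a = \<alpha> c"
    and desc: "\<And>t. t \<in> T \<Longrightarrow> w \<star> \<alpha> t \<notin> \<Phi>p"
begin

lemma simple_act_pos: "\<gamma> \<in> \<Phi>p \<Longrightarrow> supp \<gamma> \<subseteq> A \<Longrightarrow> w \<star> \<gamma> \<in> \<Phi>p"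
proof (rule act_pos_into[OF w])
  fix j assume "supp \<gamma> \<subseteq> A" "j \<in> supp \<gamma>"
  then obtain c where "c \<in> S" "w \<star> \<alpha> j = \<alpha> c" using simple by blast
  then show "w \<star> \<alpha> j \<in> \<Phi>p" by simp
qed

text \<open>If the image were positive, its coordinates outside the set \<open>C\<close> of letters
  hit by \<open>A\<close> would vanish: there \<open>A\<close> contributes 0 and the descents at
  most 0. Applying \<open>inv w\<close> then puts the support of \<gamma> into
  \<open>A\<close>.\<close>

lemma descents_act_neg:
  assumes \<gamma>: "\<gamma> \<in> \<Phi>p" "supp \<gamma> \<subseteq> A \<union> T" "\<not> supp \<gamma> \<subseteq> A"
  shows "w \<star> \<gamma> \<notin> \<Phi>p"
proof
  assume pos: "w \<star> \<gamma> \<in> \<Phi>p"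
  define C where "C = {c \<in> S. \<exists>a\<in>A. w \<star> \<alpha> a = \<alpha> c}"
  have into_C: "supp (w \<star> \<gamma>) \<subseteq> C"
  proof
    fix k assume k: "k \<in> supp (w \<star> \<gamma>)"
    show "k \<in> C"
    proof (rule ccontr)
      assume kC: "k \<notin> C"
      have "(\<Sum>j\<in>supp \<gamma>. lk \<gamma> j * lk (w \<star> \<alpha> j) k) \<le> 0"
      proof (rule sum_nonpos)
        fix j assume j: "j \<in> supp \<gamma>"
        show "lk \<gamma> j * lk (w \<star> \<alpha> j) k \<le> 0"
        proof (cases "j \<in> A")
          case True
          then obtain c where c: "c \<in> S" "w \<star> \<alpha> j = \<alpha> c" using simple by blast
          then have "c \<noteq> k" using kC True unfolding C_def by blast
          then show ?thesis by (simp add: c lookup_simple_root)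
        next
          case False
          then have jT: "j \<in> T" using j \<gamma>(2) by blast
          then have "w \<star> \<alpha> j \<in> \<Phi>" using T by (intro root_act[OF _ w]) auto
          then have "- (w \<star> \<alpha> j) \<in> \<Phi>p" using desc[OF jT] by (simp only: neg_iff) simp
          then have "0 \<le> lk (- (w \<star> \<alpha> j)) k" unfolding pos_roots_iff by blast
          moreover have "0 \<le> lk \<gamma> j" using \<gamma>(1) unfolding pos_roots_iff by blast
          ultimately show ?thesis by (simp add: mult_nonneg_nonpos)
        qed
      qed
      then have "lk (w \<star> \<gamma>) k \<le> 0" unfolding act_lookup_expand[OF w, of \<gamma>] .
      moreover have "0 \<le> lk (w \<star> \<gamma>) k" using pos unfolding pos_roots_iff by blast
      ultimately show False using k by (simp add: in_keys_iff)
    qed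
  qed
  have "supp (inv w \<star> w \<star> \<gamma>) \<subseteq> A"
  proof (rule act_supp_into)
    show "inv w \<in> carrier W" using w by simp
    fix j assume "j \<in> supp (w \<star> \<gamma>)"
    then obtain a where a: "a \<in> A" "\<alpha> j = w \<star> \<alpha> a" using into_C unfolding C_def by force
    show "supp (inv w \<star> \<alpha> j) \<subseteq> A" unfolding a(2) act_inv_act[OF w] using a(1) by simp
  qed
  then show False using \<gamma>(3) w by simp
qed

abbreviation (input) "desc_comp \<equiv> components W A T"

lemma desc_comp_subset: "desc_comp \<subseteq> S" "desc_comp - T \<subseteq> A" "T \<subseteq> desc_comp" "desc_comp - T \<subseteq> S"
  using components_subset[of A T] components_incl[of T A] A T by auto

lemma inversions_descents: "par_pos desc_comp - par_pos (desc_comp - T) \<subseteq> inversions w"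
proof
  fix \<gamma> assume \<gamma>: "\<gamma> \<in> par_pos desc_comp - par_pos (desc_comp - T)"
  then have \<gamma>': "\<gamma> \<in> \<Phi>p" "supp \<gamma> \<subseteq> desc_comp" "\<not> supp \<gamma> \<subseteq> desc_comp - T" unfolding par_pos_def by auto
  then have "\<not> supp \<gamma> \<subseteq> A" using AT by blast
  moreover have "supp \<gamma> \<subseteq> A \<union> T" using \<gamma>'(2) components_subset[of A T] by blast
  ultimately show "\<gamma> \<in> inversions w" using descents_act_neg \<gamma>'(1) unfolding inversions_def by blast
qed

text \<open>The subgroup acts on the set \<open>F\<close>, which is finite because \<open>w\<close>
  inverts it. An element fixing \<open>F\<close> pointwise is 1, so the subgroup embeds into the
  self-maps of \<open>F\<close>.\<close>

lemma descents_finite_type_sub: "finite_type W (desc_comp - T)"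
proof -
  define F where "F = par_pos desc_comp - par_pos (desc_comp - T)"
  have finF: "finite F" unfolding F_def by (rule finite_subset[OF inversions_descents]) (use w in simp)
  note sub = desc_comp_subset
  have stable: "u \<star> \<beta> \<in> F" if u: "u \<in> generate W (desc_comp - T)" and \<beta>: "\<beta> \<in> F" for u \<beta>
  proof -
    have \<beta>': "\<beta> \<in> \<Phi>p" "\<not> supp \<beta> \<subseteq> desc_comp - T" "supp \<beta> \<subseteq> desc_comp" using \<beta> unfolding F_def par_pos_def by auto
    note parabolic_act_pos[OF sub(4) u \<beta>'(1,2)]
    moreover have "supp (u \<star> \<beta>) \<subseteq> desc_comp" by (rule parabolic_act_supp[OF sub(4) u _ \<beta>'(3)]) blast
    ultimately show ?thesis unfolding F_def par_pos_def by blast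
  qed
  have TF: "\<alpha> t \<in> F" if "t \<in> T" for t
    using that sub T unfolding F_def par_pos_def by auto
  have faithful: "g = \<one>" if g: "g \<in> generate W (desc_comp - T)" and fix_F: "\<And>\<beta>. \<beta> \<in> F \<Longrightarrow> g \<star> \<beta> = \<beta>" for g
  proof (rule parabolic_eq_one[OF sub(4) g])
    have gc: "g \<in> carrier W" using parabolic_closed[OF sub(4) g] .
    fix k assume "k \<in> desc_comp - T"
    then have "k \<in> desc_comp" by blast
    \<comment> \<open>Induction along the graph from the letters of \<open>T\<close>, whose simple
      roots lie in \<open>F\<close>. What is carried along is a root of \<open>F\<close> through
      \<open>k\<close> such that \<open>g\<close> fixes the simple roots of all letters in its
      support.\<close>
    then have "\<exists>\<beta>\<in>F. k \<in> supp \<beta> \<and> (\<forall>j\<in>supp \<beta>. g \<star> \<alpha> j = \<alpha> j)"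
    proof (induction rule: components_induct)
      case (base t)
      then show ?case using TF fix_F by (intro bexI[of _ "\<alpha> t"]) auto
    next
      case (step k k')
      then obtain \<beta> where \<beta>: "\<beta> \<in> F" "k \<in> supp \<beta>" and fixed: "\<And>j. j \<in> supp \<beta> \<Longrightarrow> g \<star> \<alpha> j = \<alpha> j" by blast
      show ?case
      proof (cases "k' \<in> supp \<beta> \<or> k' \<in> T")
        case True
        then show ?thesis
        proof
          assume "k' \<in> supp \<beta>" then show ?thesis using \<beta> fixed by blast
        next
          assume "k' \<in> T" then show ?thesis using TF fix_F by (intro bexI[of _ "\<alpha> k'"]) auto
        qed
      next
        case False
        then have k': "k' \<in> desc_comp - T" "k' \<in> S" "k' \<notin> supp \<beta>" using step sub by auto
        have \<beta>pos: "\<beta> \<in> \<Phi>p" using \<beta> unfolding F_def par_pos_def by blast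
        have \<beta>S: "supp \<beta> \<subseteq> S" using root_keys[OF pos_root_root[OF \<beta>pos]] .
        have "form W \<beta> (\<alpha> k') = (\<Sum>j\<in>supp \<beta>. lk \<beta> j * cox_cos W j k')"
          by (subst form_expand_left) (simp add: form_simple_root)
        also have "\<dots> < 0"
        proof -
          have le: "lk \<beta> j * cox_cos W j k' \<le> 0" if "j \<in> supp \<beta>" for j
            using cox_cos_nonpos[of j k'] that \<beta>S k' \<beta>pos
            by (intro mult_nonneg_nonpos) (auto simp: pos_roots_iff)
          have "0 < lk \<beta> k" using \<beta>(2) \<beta>pos by (metis in_keys_iff less_eq_real_def pos_roots_iff)
          then have less: "lk \<beta> k * cox_cos W k k' < 0" using cox_cos_adj[OF step(3)] by (rule mult_pos_neg)
          have "(\<Sum>j\<in>supp \<beta>. lk \<beta> j * cox_cos W j k') < (\<Sum>j\<in>supp \<beta>. 0)"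
            by (rule sum_strict_mono_ex1) (use le less \<beta>(2) in auto)
          then show ?thesis by simp
        qed
        \<comment> \<open>A neighbour \<open>k'\<close> outside the support pairs negatively with
          \<beta>, and reflecting \<beta> in it gives another root of \<open>F\<close>. Both are
          fixed by \<open>g\<close>, hence so is their difference, a nonzero multiple of \<alpha>
          k'.\<close>
        finally have neg: "form W (\<alpha> k') \<beta> < 0" using form_sym[of \<beta> "\<alpha> k'"] \<beta>S k' by simp
        let ?\<beta> = "k' \<star> \<beta>"
        have \<beta>': "?\<beta> \<in> F" by (rule stable[OF generate.incl[OF k'(1)] \<beta>(1)])
        have eq: "?\<beta> = \<beta> - scale_vec (2 * form W (\<alpha> k') \<beta>) (\<alpha> k')" using k' by (simp add: act_gen)
        have "g \<star> ?\<beta> = g \<star> \<beta> - scale_vec (2 * form W (\<alpha> k') \<beta>) (g \<star> \<alpha> k')"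
          unfolding eq using gc by (simp add: act_linear)
        then have "\<beta> - scale_vec (2 * form W (\<alpha> k') \<beta>) (g \<star> \<alpha> k') =
            \<beta> - scale_vec (2 * form W (\<alpha> k') \<beta>) (\<alpha> k')"
          using fix_F[OF \<beta>'] fix_F[OF \<beta>(1)] eq by metis
        then have "scale_vec (2 * form W (\<alpha> k') \<beta>) (g \<star> \<alpha> k') = scale_vec (2 * form W (\<alpha> k') \<beta>) (\<alpha> k')"
          by simp
        then have "scale_vec (2 * form W (\<alpha> k') \<beta>) (g \<star> \<alpha> k' - \<alpha> k') = 0" by (simp add: scale_vec_diff)
        then have fk: "g \<star> \<alpha> k' = \<alpha> k'" using neg by (simp add: scale_vec_eq_0_iff)
        have "lk ?\<beta> k' \<noteq> 0" using k' neg
          by (simp add: eq lookup_minus lookup_simple_root not_in_keys_iff_lookup_eq_zero)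
        then have "k' \<in> supp ?\<beta>" by (simp add: in_keys_iff)
        moreover have "g \<star> \<alpha> j = \<alpha> j" if "j \<in> supp ?\<beta>" for j
        proof (cases "j = k'")
          case False
          then have "lk ?\<beta> j = lk \<beta> j" by (simp add: eq lookup_minus lookup_simple_root)
          then have "j \<in> supp \<beta>" using that by (simp add: in_keys_iff)
          then show ?thesis by (rule fixed)
        qed (use fk in simp)
        ultimately show ?thesis using \<beta>' by blast
      qed
    qed
    then have "g \<star> \<alpha> k = \<alpha> k" by blast
    then show "g \<star> \<alpha> k \<in> \<Phi>p" using \<open>k \<in> desc_comp\<close> sub by auto
  qed
  have "inj_on (\<lambda>u. restrict ((\<star>) u) F) (generate W (desc_comp - T))"
  proof (rule inj_onI)
    fix u v assume u: "u \<in> generate W (desc_comp - T)" and v: "v \<in> generate W (desc_comp - T)"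
      and eq: "restrict ((\<star>) u) F = restrict ((\<star>) v) F"
    have c: "u \<in> carrier W" "v \<in> carrier W" using u v parabolic_closed[OF sub(4)] by auto
    have "inv v \<otimes> u = \<one>"
    proof (rule faithful)
      show "inv v \<otimes> u \<in> generate W (desc_comp - T)" using u v parabolic_inv[OF sub(4)] by (auto intro: generate.eng)
      fix \<beta> assume "\<beta> \<in> F"
      then have "u \<star> \<beta> = v \<star> \<beta>" using eq by (metis restrict_apply')
      then show "(inv v \<otimes> u) \<star> \<beta> = \<beta>" using c by (simp add: act_mult)
    qed
    then show "u = v" using c by (metis inv_closed inv_equality inv_inv)
  qed
  moreover have "(\<lambda>u. restrict ((\<star>) u) F) ` generate W (desc_comp - T) \<subseteq> F \<rightarrow>\<^sub>E F"
    using stable by auto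
  moreover have "finite (F \<rightarrow>\<^sub>E F)" using finF by (intro finite_PiE) auto
  ultimately show ?thesis unfolding finite_type_def by (rule inj_on_finite)
qed

text \<open>\<open>w\<close> times the longest element of \<open>desc_comp - T\<close> inverts every
  positive root of the component: roots of the smaller set are first negated and then keep their
  sign, the others stay within the set inverted by \<open>w\<close>. Every element has finitely many
  inversions.\<close>

lemma descents_finite_type: "finite_type W desc_comp"
proof (rule finite_type_if_finite_par_pos)
  note sub = desc_comp_subset
  note fin = descents_finite_type_sub
  let ?v = "longest W S (desc_comp - T)"
  note v = longest_closed[OF sub(4) fin]
  have "par_pos desc_comp \<subseteq> inversions (w \<otimes> ?v)"
  proof
    fix \<gamma> assume \<gamma>: "\<gamma> \<in> par_pos desc_comp"
    then have \<gamma>pos: "\<gamma> \<in> \<Phi>p" "supp \<gamma> \<subseteq> desc_comp" unfolding par_pos_def by auto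
    have vK: "supp (?v \<star> \<gamma>) \<subseteq> desc_comp"
      by (rule parabolic_act_supp[OF sub(4) longest_mem[OF sub(4) fin] _ \<gamma>pos(2)]) blast
    have "w \<star> ?v \<star> \<gamma> \<notin> \<Phi>p"
    proof (cases "supp \<gamma> \<subseteq> desc_comp - T")
      case True
      then have "\<gamma> \<in> inversions ?v" unfolding inversions_longest[OF sub(4) fin] par_pos_def using \<gamma>pos by blast
      then have "- (?v \<star> \<gamma>) \<in> \<Phi>p" using neg_iff root_act v pos_root_root unfolding inversions_def by auto
      moreover have "supp (- (?v \<star> \<gamma>)) \<subseteq> A"
        using parabolic_act_supp[OF sub(4) longest_mem[OF sub(4) fin] subset_refl True] sub(2) by simp
      ultimately have "w \<star> (- (?v \<star> \<gamma>)) \<in> \<Phi>p" by (rule simple_act_pos)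
      then have "- (w \<star> ?v \<star> \<gamma>) \<in> \<Phi>p" using w by (simp add: act_linear)
      then show ?thesis using not_pos_neg by blast
    next
      case False
      note parabolic_act_pos[OF sub(4) longest_mem[OF sub(4) fin] \<gamma>pos(1) False]
      then have "?v \<star> \<gamma> \<in> par_pos desc_comp - par_pos (desc_comp - T)" using vK unfolding par_pos_def by blast
      then show ?thesis using inversions_descents unfolding inversions_def by blast
    qed
    then show "\<gamma> \<in> inversions (w \<otimes> ?v)" using \<gamma>pos w v unfolding inversions_def by (simp add: act_mult)
  qed
  then show "finite (par_pos desc_comp)" by (rule finite_subset) (use w v in simp)
qed (rule desc_comp_subset)

text \<open>By \<open>inversions_descents\<close> the inversions of the quotient of longest elements
  are inversions of \<open>w\<close>, as the criterion \<open>len_add_iff\<close> demands.\<close>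

lemma descents_factor:
  shows "len w = len (w \<otimes> inv (longest_quotient desc_comp (desc_comp - T))) + len (longest_quotient desc_comp (desc_comp - T))"
proof -
  let ?h = "longest_quotient desc_comp (desc_comp - T)"
  have h: "?h \<in> carrier W"
    by (rule longest_quotient_closed[OF desc_comp_subset(1) descents_finite_type]) blast
  have hinv: "inversions ?h = par_pos desc_comp - par_pos (desc_comp - T)"
    by (rule inversions_longest_quotient[OF desc_comp_subset(1) descents_finite_type]) blast
  have eq: "w \<otimes> inv ?h \<otimes> ?h = w" using w h by (simp add: m_assoc)
  then have "inversions ?h \<subseteq> inversions (w \<otimes> inv ?h \<otimes> ?h)" using hinv inversions_descents by simp
  then have "len (w \<otimes> inv ?h \<otimes> ?h) = len (w \<otimes> inv ?h) + len ?h" using len_add_iff w h by simp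
  then show ?thesis using eq by simp
qed

end

text \<open>Conjugating by descents reduces to \<open>w \<star> \<alpha> s = - \<alpha> s\<close>, where \<open>w = s\<close>
  because \<open>w\<close> moves vectors only along one line.\<close>
lemma involution_rank_one_reflection:
  assumes J: "J \<subseteq> S" and "w \<in> generate W J" "w \<noteq> \<one>" "w \<otimes> w = \<one>"
    "\<And>j. j \<in> J \<Longrightarrow> \<exists>c. w \<star> \<alpha> j - \<alpha> j = scale_vec c \<delta>"
  shows "\<exists>\<gamma>\<in>\<Phi>p. w = reflection W S \<gamma>"
  using assms(2-5)
proof (induction "len w" arbitrary: w \<delta> rule: less_induct)
  case less
  note wJ = less.prems(1) and w1 = less.prems(2) and ww = less.prems(3) and line = less.prems(4)
  have w: "w \<in> carrier W" using parabolic_closed[OF J wJ] .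
  obtain s where s: "s \<in> S" "len (w \<otimes> s) < len w" using ex_descent w w1 by blast
  then have inv_s: "\<alpha> s \<in> inversions w" using w by (simp add: simple_inversion_iff)
  then have sJ: "s \<in> J" using inversions_parabolic[OF J wJ] unfolding par_pos_def by auto
  have neg: "w \<star> \<alpha> s \<notin> \<Phi>p" using inv_s unfolding inversions_def by blast
  obtain c where c: "w \<star> \<alpha> s - \<alpha> s = scale_vec c \<delta>" using line[OF sJ] by blast
  show ?case
  proof (cases "w \<star> \<alpha> s = - \<alpha> s")
    case True
    have "- scale_vec 2 (\<alpha> s) = scale_vec c \<delta>"
      unfolding c[symmetric] True by (rule vec_eqI) (simp add: lookup_minus)
    then have c0: "c \<noteq> 0" by (auto simp: scale_vec_eq_0_iff)
    then have \<delta>: "\<delta> = scale_vec (- 2 / c) (\<alpha> s)"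
    proof -
      have "scale_vec (1 / c) (- scale_vec 2 (\<alpha> s)) = scale_vec (1 / c) (scale_vec c \<delta>)"
        using \<open>- scale_vec 2 (\<alpha> s) = scale_vec c \<delta>\<close> by simp
      then show ?thesis using c0 by (simp add: scale_vec_uminus scale_vec_left_uminus)
    qed
    have same: "w \<star> \<alpha> j = s \<star> \<alpha> j" if j: "j \<in> J" for j
    proof -
      obtain d where "w \<star> \<alpha> j - \<alpha> j = scale_vec d \<delta>" using line[OF j] by blast
      then obtain e where e: "w \<star> \<alpha> j = \<alpha> j + scale_vec e (\<alpha> s)" unfolding \<delta> by (auto simp: diff_eq_eq add.commute)
      \<comment> \<open>Invariance of the form determines \<open>e\<close>, and the value is that of
        the reflection in \<alpha> s.\<close>
      have "form W (w \<star> \<alpha> s) (w \<star> \<alpha> j) = form W (\<alpha> s) (\<alpha> j)"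
        by (rule form_act[OF w]) (use s j J in auto)
      then have "e = - 2 * form W (\<alpha> s) (\<alpha> j)"
        unfolding True e using s by (simp add: form_bilinear form_simple_root)
      then show ?thesis unfolding e using s by (simp add: act_gen scale_vec_left_uminus)
    qed
    have "s \<otimes> w = \<one>"
    proof (rule parabolic_eq_one[OF J])
      show "s \<otimes> w \<in> generate W J" using sJ wJ by (auto intro: generate.intros)
      fix j assume "j \<in> J"
      then show "(s \<otimes> w) \<star> \<alpha> j \<in> \<Phi>p" using same J s w by (auto simp: act_mult)
    qed
    then have "w = s" using s w by (metis gens_carrier gens_inv inv_equality inv_inv)
    then show ?thesis using s by (intro bexI[of _ "\<alpha> s"]) auto
  next
    case False
    let ?w = "s \<otimes> w \<otimes> s"
    have w': "?w \<in> carrier W" using s w by simp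
    have conj_back: "s \<otimes> ?w \<otimes> s = w" using s w by (simp add: m_assoc[symmetric] gens_involution)
    \<comment> \<open>Conjugation by \<open>s\<close> shortens \<open>w\<close>: the product
      \<open>s w\<close> still sends \<alpha> s to a negative root, and it has the length of its
      inverse \<open>w s\<close>.\<close>
    have "- (w \<star> \<alpha> s) \<in> \<Phi>p" using neg neg_iff root_act w s by auto
    moreover have "- (w \<star> \<alpha> s) \<noteq> \<alpha> s" using False by (metis minus_minus)
    ultimately have "s \<star> (- (w \<star> \<alpha> s)) \<in> \<Phi>p" using s gen_act_pos by blast
    then have "- (s \<star> w \<star> \<alpha> s) \<in> \<Phi>p" using s by (simp add: act_linear)
    then have "(s \<otimes> w) \<star> \<alpha> s \<notin> \<Phi>p" using not_pos_neg s w by (auto simp: act_mult)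
    then have "len ?w < len (s \<otimes> w)" using descent_iff[of "s \<otimes> w" s] s w by simp
    also have "len (s \<otimes> w) = len (inv (s \<otimes> w))" using s w by (simp add: len_inv)
    also have "inv (s \<otimes> w) = w \<otimes> s" using s w ww inv_equality[of w w] by (simp add: inv_mult_group)
    finally have len': "len ?w < len w" using s by simp
    have "\<exists>\<gamma>\<in>\<Phi>p. ?w = reflection W S \<gamma>"
    proof (rule less.hyps[OF len', where \<delta> = "s \<star> \<delta>"])
      show "?w \<in> generate W J" using sJ wJ by (auto intro: generate.intros)
      show "?w \<noteq> \<one>" using conj_back s w1 gens_involution by auto
      have "?w \<otimes> ?w = s \<otimes> (w \<otimes> (s \<otimes> s) \<otimes> w) \<otimes> s" using s w by (simp only: m_assoc m_closed gens_carrier)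
      then show "?w \<otimes> ?w = \<one>" using s w ww by (simp add: gens_involution)
      fix j assume j: "j \<in> J"
      obtain d where d: "w \<star> \<alpha> j - \<alpha> j = scale_vec d \<delta>" using line[OF j] by blast
      define a where "a = 2 * form W (\<alpha> s) (\<alpha> j)"
      have sj: "s \<star> \<alpha> j = \<alpha> j - scale_vec a (\<alpha> s)" unfolding a_def using s by (simp add: act_gen)
      have "w \<star> s \<star> \<alpha> j - s \<star> \<alpha> j = (w \<star> \<alpha> j - \<alpha> j) - scale_vec a (w \<star> \<alpha> s - \<alpha> s)"
        unfolding sj using w by (simp add: act_linear scale_vec_diff)
      also have "\<dots> = scale_vec (d - a * c) \<delta>" unfolding c d by (simp add: scale_vec_left_diff)
      finally have "s \<star> (w \<star> s \<star> \<alpha> j - s \<star> \<alpha> j) = s \<star> scale_vec (d - a * c) \<delta>" by simp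
      then have "?w \<star> \<alpha> j - \<alpha> j = scale_vec (d - a * c) (s \<star> \<delta>)" using s w by (simp add: act_linear act_mult)
      then show "\<exists>c. ?w \<star> \<alpha> j - \<alpha> j = scale_vec c (s \<star> \<delta>)" by blast
    qed
    then obtain \<gamma> where \<gamma>: "\<gamma> \<in> \<Phi>p" "?w = reflection W S \<gamma>" by blast
    then have w_eq: "w = reflection W S (s \<star> \<gamma>)"
      using reflection_conj_act[of \<gamma> s] pos_root_root s conj_back by simp
    have "s \<star> \<gamma> \<in> \<Phi>" using \<gamma> s root_act pos_root_root by simp
    then show ?thesis using pos_or_neg w_eq reflection_uminus by metis
  qed
qed

end

section \<open>The generators of the groupoid\<close>

locale coxeter_groupoid = coxeter_system W S for W (structure) and S +
  fixes \<Lambda> :: "'l set" and b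
  assumes base: "b \<in> injections S \<Lambda>"
begin

abbreviation "V \<equiv> verts W S \<Lambda> b"
abbreviation "Cs \<equiv> Cset W S \<Lambda>"
abbreviation "Ys \<equiv> Yset W S \<Lambda>"
abbreviation "Gens \<equiv> gens W S \<Lambda> b"
abbreviation "elt \<equiv> gen_elt W S \<Lambda>"
abbreviation "tgt \<equiv> gen_tgt W S \<Lambda> b"
abbreviation "perp x \<equiv> perp_roots W S (x ` \<Lambda>)"

text \<open>The component $[x]_{\sim s}$.\<close>
abbreviation "cpt x s \<equiv> components W (x ` \<Lambda>) {s}"

lemma vert_inj: "x \<in> V \<Longrightarrow> x \<in> injections S \<Lambda>"
  unfolding verts_def by blast

lemma vert_S: "x \<in> V \<Longrightarrow> l \<in> \<Lambda> \<Longrightarrow> x l \<in> S"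
  using vert_inj unfolding injections_def by auto

lemma vert_image_S: "x \<in> V \<Longrightarrow> x ` \<Lambda> \<subseteq> S"
  using vert_S by auto

lemma vert_inj_on: "x \<in> V \<Longrightarrow> inj_on x \<Lambda>"
  using vert_inj unfolding injections_def by auto

lemma vert_eqI: "x \<in> V \<Longrightarrow> y \<in> V \<Longrightarrow> (\<And>l. l \<in> \<Lambda> \<Longrightarrow> x l = y l) \<Longrightarrow> x = y"
  using vert_inj[of x] vert_inj[of y] unfolding injections_def by (auto intro: PiE_ext)

lemma Cset_carrier: "w \<in> Cs y x \<Longrightarrow> w \<in> carrier W"
  unfolding Cset_def by blast

lemma Cset_act: "w \<in> Cs y x \<Longrightarrow> l \<in> \<Lambda> \<Longrightarrow> w \<star> \<alpha> (x l) = \<alpha> (y l)"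
  unfolding Cset_def by simp

lemma CsetI: "w \<in> carrier W \<Longrightarrow> (\<And>l. l \<in> \<Lambda> \<Longrightarrow> w \<star> \<alpha> (x l) = \<alpha> (y l)) \<Longrightarrow> w \<in> Cs y x"
  unfolding Cset_def by simp

lemma Cset_one: "\<one> \<in> Cs x x"
  by (rule CsetI) auto

lemma Cset_mult: "u \<in> Cs z y \<Longrightarrow> w \<in> Cs y x \<Longrightarrow> u \<otimes> w \<in> Cs z x"
  by (rule CsetI) (auto simp: act_mult Cset_carrier Cset_act)

lemma Cset_inv: "w \<in> Cs y x \<Longrightarrow> inv w \<in> Cs x y"
  by (rule CsetI) (auto simp: Cset_carrier Cset_act[symmetric])

text \<open>The target is read off from the images of the simple roots, and composing with an arrow
  from the base vertex shows that it is a vertex.\<close>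

lemma Cset_target_vert:
  assumes "x \<in> V" "w \<in> carrier W" "\<And>l. l \<in> \<Lambda> \<Longrightarrow> \<exists>s\<in>S. w \<star> \<alpha> (x l) = \<alpha> s"
  shows "\<exists>y\<in>V. w \<in> Cs y x"
proof -
  define y where "y = restrict (\<lambda>l. SOME s. s \<in> S \<and> w \<star> \<alpha> (x l) = \<alpha> s) \<Lambda>"
  have y: "y l \<in> S \<and> w \<star> \<alpha> (x l) = \<alpha> (y l)" if "l \<in> \<Lambda>" for l
    using someI_ex[OF assms(3)[OF that, unfolded Bex_def]] that unfolding y_def by simp
  have wC: "w \<in> Cs y x" using y assms(2) by (intro CsetI) auto
  have "inj_on y \<Lambda>"
  proof (rule inj_onI)
    fix k l assume kl: "k \<in> \<Lambda>" "l \<in> \<Lambda>" "y k = y l"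
    then have "w \<star> \<alpha> (x k) = w \<star> \<alpha> (x l)" using y by metis
    then have "x k = x l" using assms(2) by simp
    then show "k = l" using vert_inj_on[OF assms(1)] kl unfolding inj_on_def by blast
  qed
  then have "y \<in> injections S \<Lambda>" using y unfolding injections_def by (auto simp: y_def)
  moreover obtain u where "u \<in> Cs x b" using assms(1) unfolding verts_def by blast
  ultimately have "y \<in> V" using Cset_mult[OF wC] unfolding verts_def by blast
  then show ?thesis using wC by blast
qed

lemma Cset_target_unique: "y \<in> V \<Longrightarrow> y' \<in> V \<Longrightarrow> w \<in> Cs y x \<Longrightarrow> w \<in> Cs y' x \<Longrightarrow> y = y'"
  by (rule vert_eqI) (metis Cset_act simple_root_inject)+

lemma perp_iff: "\<gamma> \<in> perp x \<longleftrightarrow> \<gamma> \<in> \<Phi> \<and> (\<forall>l\<in>\<Lambda>. form W \<gamma> (\<alpha> (x l)) = 0)"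
  unfolding perp_roots_def by auto

lemma perp_root: "\<gamma> \<in> perp x \<Longrightarrow> \<gamma> \<in> \<Phi>"
  by (simp add: perp_iff)

lemma perp_act:
  assumes "w \<in> Cs y x" "x \<in> V" "\<gamma> \<in> perp x" shows "w \<star> \<gamma> \<in> perp y"
proof -
  note w = Cset_carrier[OF assms(1)]
  have "form W (w \<star> \<gamma>) (\<alpha> (y l)) = 0" if "l \<in> \<Lambda>" for l
  proof -
    have "form W (w \<star> \<gamma>) (\<alpha> (y l)) = form W (w \<star> \<gamma>) (w \<star> \<alpha> (x l))"
      using Cset_act[OF assms(1) that] by simp
    also have "\<dots> = form W \<gamma> (\<alpha> (x l))"
      by (rule form_act[OF w]) (use assms that vert_S root_keys perp_root in auto)
    finally show ?thesis using assms(3) that by (simp add: perp_iff)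
  qed
  then show ?thesis using assms w by (simp add: perp_iff root_act)
qed

lemma perp_uminus: "\<gamma> \<in> perp x \<Longrightarrow> - \<gamma> \<in> perp x"
  by (simp add: perp_iff root_uminus form_bilinear)

lemma perp_reflection_Cset:
  assumes "x \<in> V" "\<gamma> \<in> perp x" shows "reflection W S \<gamma> \<in> Cs x x"
  by (rule CsetI) (use assms vert_S in \<open>auto simp: perp_iff reflection_closed reflection_act\<close>)

lemma Cset_descent_notin:
  assumes "w \<in> Cs y x" "y \<in> V" "s \<in> S" "w \<star> \<alpha> s \<notin> \<Phi>p" shows "s \<notin> x ` \<Lambda>"
  using assms Cset_act[OF assms(1)] vert_S by force

lemma comp_facts:
  assumes "x \<in> V" "T \<subseteq> S" "T \<inter> x ` \<Lambda> = {}"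
  shows "components W (x ` \<Lambda>) T \<subseteq> S" "components W (x ` \<Lambda>) T - T \<subseteq> x ` \<Lambda>"
    "T \<subseteq> components W (x ` \<Lambda>) T"
  using components_subset[of "x ` \<Lambda>" T] components_incl[of T "x ` \<Lambda>"] vert_image_S[OF assms(1)] assms by blast+

text \<open>Letters of [x] inside \<open>K\<close> go to simple roots by
  \<open>longest_quotient_simple\<close>; those outside \<open>K\<close> are orthogonal to it and
  hence fixed.\<close>

lemma quotient_Cset:
  assumes x: "x \<in> V" and T: "T \<subseteq> S" "T \<inter> x ` \<Lambda> = {}" and fin: "finite_type W (components W (x ` \<Lambda>) T)"
  defines "K \<equiv> components W (x ` \<Lambda>) T"
  shows "\<exists>y\<in>V. longest_quotient K (K - T) \<in> Cs y x"
proof (rule Cset_target_vert[OF x])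
  note K = comp_facts[OF x T, folded K_def] and fin = fin[folded K_def]
  have L: "K - T \<subseteq> K" by blast
  show "longest_quotient K (K - T) \<in> carrier W" by (rule longest_quotient_closed[OF K(1) fin L])
  fix l assume l: "l \<in> \<Lambda>"
  show "\<exists>s\<in>S. longest_quotient K (K - T) \<star> \<alpha> (x l) = \<alpha> s"
  proof (cases "x l \<in> K")
    case True
    then have "x l \<in> K - T" using T l by auto
    then show ?thesis using longest_quotient_simple[OF K(1) fin L] K(1) by blast
  next
    case False
    have "longest_quotient K (K - T) \<star> \<alpha> (x l) = \<alpha> (x l)"
    proof (rule parabolic_act_fixed[OF K(1) longest_quotient_mem[OF K(1) fin L]])
      fix j assume "j \<in> K"
      then show "form W (\<alpha> j) (\<alpha> (x l)) = 0"
        using components_orth[OF vert_image_S[OF x] T(1), of "x l" j] l False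
        unfolding K_def by (simp add: form_simple_root)
    qed
    then show ?thesis using vert_S[OF x l] by blast
  qed
qed

lemma gensD:
  assumes "(x, s) \<in> Gens"
  shows "x \<in> V" "s \<in> S" "s \<notin> x ` \<Lambda>" "finite_type W (cpt x s)" "cpt x s \<subseteq> S"
    "cpt x s - {s} \<subseteq> x ` \<Lambda>" "s \<in> cpt x s"
  using assms comp_facts[of x "{s}"] unfolding gens_def by auto

lemma gen_elt_eq: "elt (x, s) = longest_quotient (cpt x s) (cpt x s - {s})"
  unfolding gen_elt_def longest_quotient_def by (simp add: Let_def)

lemma gen_elt_mem: "(x, s) \<in> Gens \<Longrightarrow> elt (x, s) \<in> generate W (cpt x s)"
  unfolding gen_elt_eq by (rule longest_quotient_mem[OF gensD(5,4)]) auto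

lemma gen_inversions:
  "(x, s) \<in> Gens \<Longrightarrow> inversions (elt (x, s)) = par_pos (cpt x s) - par_pos (cpt x s - {s})"
  unfolding gen_elt_eq by (rule inversions_longest_quotient[OF gensD(5,4)]) auto

lemma gen_inversions_simple: "(x, s) \<in> Gens \<Longrightarrow> \<alpha> s \<in> inversions (elt (x, s))"
  using gensD[of x s] by (auto simp: gen_inversions par_pos_def)

lemma gen_tgt_props:
  assumes "\<xi> \<in> Gens" shows "tgt \<xi> \<in> V" "elt \<xi> \<in> Cs (tgt \<xi>) (fst \<xi>)"
proof -
  obtain x s where \<xi>: "\<xi> = (x, s)" by fastforce
  note g = gensD[OF assms[unfolded \<xi>]]
  obtain y where y: "y \<in> V" "elt \<xi> \<in> Cs y x"
    using quotient_Cset[of x "{s}"] g unfolding \<xi> gen_elt_eq by auto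
  have "tgt \<xi> \<in> V \<and> elt \<xi> \<in> Cs (tgt \<xi>) (fst \<xi>)"
    unfolding gen_tgt_def
  proof (rule theI[of _ y])
    show "y \<in> V \<and> elt \<xi> \<in> Cs y (fst \<xi>)" using y \<xi> by simp
    fix z assume "z \<in> V \<and> elt \<xi> \<in> Cs z (fst \<xi>)"
    then show "z = y" using y \<xi> Cset_target_unique by fastforce
  qed
  then show "tgt \<xi> \<in> V" "elt \<xi> \<in> Cs (tgt \<xi>) (fst \<xi>)" by auto
qed

lemma gen_tgt_eq: "\<xi> \<in> Gens \<Longrightarrow> y \<in> V \<Longrightarrow> elt \<xi> \<in> Cs y (fst \<xi>) \<Longrightarrow> tgt \<xi> = y"
  using gen_tgt_props Cset_target_unique by blast

lemma gen_elt_carrier: "\<xi> \<in> Gens \<Longrightarrow> elt \<xi> \<in> carrier W"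
  using gen_tgt_props Cset_carrier by blast

lemma fst_gen_vert: "\<xi> \<in> Gens \<Longrightarrow> fst \<xi> \<in> V"
  using gensD(1)[of "fst \<xi>" "snd \<xi>"] by simp

lemma Cset_simple: "w \<in> Cs y x \<Longrightarrow> y \<in> V \<Longrightarrow> a \<in> x ` \<Lambda> \<Longrightarrow> \<exists>c\<in>S. w \<star> \<alpha> a = \<alpha> c"
  using Cset_act vert_S by blast

lemma descents_facts:
  assumes x: "x \<in> V" and y: "y \<in> V" and w: "w \<in> Cs y x"
    and T: "T \<subseteq> S" "\<And>t. t \<in> T \<Longrightarrow> w \<star> \<alpha> t \<notin> \<Phi>p"
  defines "K \<equiv> components W (x ` \<Lambda>) T"
  shows "T \<inter> x ` \<Lambda> = {}" "finite_type W K" "par_pos K - par_pos (K - T) \<subseteq> inversions w"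
    "len w = len (w \<otimes> inv (longest_quotient K (K - T))) + len (longest_quotient K (K - T))"
proof -
  show disj: "T \<inter> x ` \<Lambda> = {}" using Cset_descent_notin[OF w y] T by blast
  then have "x ` \<Lambda> \<inter> T = {}" by blast
  note * = vert_image_S[OF x] T(1) this Cset_carrier[OF w] Cset_simple[OF w y] T(2)
  show "finite_type W K" unfolding K_def by (rule descents_finite_type[OF *])
  show "par_pos K - par_pos (K - T) \<subseteq> inversions w" unfolding K_def by (rule inversions_descents[OF *])
  show "len w = len (w \<otimes> inv (longest_quotient K (K - T))) + len (longest_quotient K (K - T))"
    unfolding K_def by (rule descents_factor[OF *])
qed

text \<open>The criterion for recognizing generators. A descent of such an arrow lies in
  \<open>cpt x s\<close> but not in [x], so it is \<open>s\<close>. Then \<open>w\<close> has all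
  inversions of the generator, and it has none supported in \<open>cpt x s - {s}\<close>.\<close>

lemma gen_unique:
  assumes x: "x \<in> V" and y: "y \<in> V" and s: "s \<in> S" "s \<notin> x ` \<Lambda>"
    and w: "w \<in> Cs y x" "w \<in> generate W (cpt x s)" "w \<noteq> \<one>"
  shows "(x, s) \<in> Gens" "w = elt (x, s)"
proof -
  have K: "cpt x s \<subseteq> S" "cpt x s - {s} \<subseteq> x ` \<Lambda>" using comp_facts[OF x, of "{s}"] s by auto
  note wc = Cset_carrier[OF w(1)]
  obtain r where r: "r \<in> S" "len (w \<otimes> r) < len w" using ex_descent[OF wc w(3)] by blast
  then have "\<alpha> r \<in> inversions w" using simple_inversion_iff wc by blast
  then have rneg: "w \<star> \<alpha> r \<notin> \<Phi>p" and "r \<in> cpt x s"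
    using inversions_parabolic[OF K(1) w(2)] unfolding inversions_def par_pos_def by auto
  moreover have "r \<notin> x ` \<Lambda>" by (rule Cset_descent_notin[OF w(1) y r(1) rneg])
  ultimately have "r = s" using K(2) by blast
  then have sneg: "\<And>t. t \<in> {s} \<Longrightarrow> w \<star> \<alpha> t \<notin> \<Phi>p" using rneg by simp
  note d = descents_facts[OF x y w(1) _ sneg]
  have "{s} \<subseteq> S" using s by simp
  note d = d[OF this]
  show G: "(x, s) \<in> Gens" unfolding gens_def using x s d(2) by blast
  have "inversions w \<inter> par_pos (cpt x s - {s}) = {}"
  proof -
    have "w \<star> \<gamma> \<in> \<Phi>p" if "\<gamma> \<in> par_pos (cpt x s - {s})" for \<gamma>
    proof (rule act_pos_into[OF wc])
      show "\<gamma> \<in> \<Phi>p" using that unfolding par_pos_def by blast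
      fix j assume "j \<in> supp \<gamma>"
      then have "j \<in> x ` \<Lambda>" using that K(2) unfolding par_pos_def by blast
      then show "w \<star> \<alpha> j \<in> \<Phi>p" using Cset_simple[OF w(1) y] by fastforce
    qed
    then show ?thesis unfolding inversions_def by blast
  qed
  then have "inversions w = inversions (elt (x, s))"
    using d(3) inversions_parabolic[OF K(1) w(2)] unfolding gen_inversions[OF G] by blast
  then show "w = elt (x, s)" using inversions_inject wc gen_elt_carrier[OF G] by blast
qed

lemma gen_elt_not_one: "\<xi> \<in> Gens \<Longrightarrow> elt \<xi> \<noteq> \<one>"
  using gen_inversions_simple[of "fst \<xi>" "snd \<xi>"] by auto

lemma len_gen_elt_pos: "\<xi> \<in> Gens \<Longrightarrow> 0 < len (elt \<xi>)"
  using gen_elt_not_one len_eq_0_iff gen_elt_carrier by blast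

text \<open>Outside the component the generator fixes the letters, and inside it [y] occupies all
  letters but one. The count takes place in the finite component because [x] may be
  infinite.\<close>

lemma gen_tgt_image:
  assumes G: "(x, s) \<in> Gens"
  defines "y \<equiv> tgt (x, s)"
  shows "\<exists>t. {t} = (x ` \<Lambda> \<union> {s}) - y ` \<Lambda> \<and> y ` \<Lambda> \<union> {t} = x ` \<Lambda> \<union> {s} \<and> t \<in> cpt x s"
proof -
  note g = gensD[OF G]
  have y: "y \<in> V" "elt (x, s) \<in> Cs y x" using gen_tgt_props[OF G] unfolding y_def by auto
  let ?K = "cpt x s"
  have inK: "y l \<in> ?K" if "l \<in> \<Lambda>" "x l \<in> ?K" for l
  proof -
    have "x l \<in> ?K - {s}" using that g(3) by auto
    then obtain k where "k \<in> ?K" "elt (x, s) \<star> \<alpha> (x l) = \<alpha> k"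
      using longest_quotient_simple[OF g(5,4), of "?K - {s}"] unfolding gen_elt_eq by blast
    then show ?thesis using Cset_act[OF y(2) that(1)] by simp
  qed
  have outK: "y l = x l" if "l \<in> \<Lambda>" "x l \<notin> ?K" for l
  proof -
    have "elt (x, s) \<star> \<alpha> (x l) = \<alpha> (x l)"
    proof (rule parabolic_act_fixed[OF g(5) gen_elt_mem[OF G]])
      fix j assume "j \<in> ?K"
      then show "form W (\<alpha> j) (\<alpha> (x l)) = 0"
        using components_orth[OF vert_image_S[OF g(1)], of "{s}" "x l" j] g(2) that by (simp add: form_simple_root)
    qed
    then show ?thesis using Cset_act[OF y(2) that(1)] by simp
  qed
  define L where "L = {l \<in> \<Lambda>. x l \<in> ?K}"
  have xL: "x ` L = ?K - {s}" unfolding L_def using g(3,6) by auto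
  have yL: "y ` L \<subseteq> ?K" unfolding L_def using inK by auto
  have finK: "finite ?K" using finite_type_finite g(4) by blast
  have L: "L \<subseteq> \<Lambda>" unfolding L_def by blast
  have "card (y ` L) = card L" by (rule card_image[OF inj_on_subset[OF vert_inj_on[OF y(1)] L]])
  moreover have "card (x ` L) = card L" by (rule card_image[OF inj_on_subset[OF vert_inj_on[OF g(1)] L]])
  ultimately have "card (y ` L) = card (?K - {s})" using xL by simp
  moreover have "card (?K - y ` L) = card ?K - card (y ` L)"
    by (rule card_Diff_subset[OF finite_subset[OF yL finK] yL])
  moreover have "0 < card ?K" using finK g(7) card_gt_0_iff by blast
  ultimately have "card (?K - y ` L) = 1" using finK g(7) by simp
  then obtain t where t: "?K - y ` L = {t}" using card_1_singletonE by blast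
  have yrest: "y l \<notin> ?K" if "l \<in> \<Lambda>" "l \<notin> L" for l using that outK unfolding L_def by auto
  have K_sub: "?K \<subseteq> x ` \<Lambda> \<union> {s}" using g(6) by blast
  have y_sub: "y ` \<Lambda> \<subseteq> x ` \<Lambda> \<union> {s}" using inK outK K_sub by blast
  have "{t} = (x ` \<Lambda> \<union> {s}) - y ` \<Lambda>"
  proof (intro equalityI subsetI)
    fix k assume "k \<in> {t}"
    then have "k \<in> ?K" "k \<notin> y ` L" using t by auto
    then show "k \<in> (x ` \<Lambda> \<union> {s}) - y ` \<Lambda>" using K_sub yrest by blast
  next
    fix k assume k: "k \<in> (x ` \<Lambda> \<union> {s}) - y ` \<Lambda>"
    have "k \<in> ?K"
    proof (rule ccontr)
      assume "k \<notin> ?K"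
      moreover from this k g(7) obtain l where l: "l \<in> \<Lambda>" "k = x l" by blast
      ultimately have "k = y l" using outK[of l] by simp
      then show False using k l(1) by blast
    qed
    moreover have "k \<notin> y ` L" using k unfolding L_def by blast
    ultimately show "k \<in> {t}" using t by blast
  qed
  then show ?thesis using t y_sub by blast
qed

lemma cox_adj_sym: "s \<in> S \<Longrightarrow> t \<in> S \<Longrightarrow> (s, t) \<in> cox_adj W \<Longrightarrow> (t, s) \<in> cox_adj W"
  using cox_m_sym by (auto simp: cox_adj_iff)

text \<open>[x] together with \<open>s\<close> is the same set of letters as [y] together with
  \<open>t\<close>, so the two components coincide. The inverse is then an arrow out of
  \<open>y\<close> inside the same parabolic subgroup, and \<open>gen_unique\<close> identifies
  it.\<close>

lemma gen_inv_props:
  assumes G: "(x, s) \<in> Gens"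
  obtains t where "gen_inv W S \<Lambda> b (x, s) = (tgt (x, s), t)" "(tgt (x, s), t) \<in> Gens"
    "elt (tgt (x, s), t) = inv (elt (x, s))" "tgt (tgt (x, s), t) = x"
    "gen_inv W S \<Lambda> b (tgt (x, s), t) = (x, s)" "{t} = (x ` \<Lambda> \<union> {s}) - tgt (x, s) ` \<Lambda>"
proof -
  note g = gensD[OF G]
  define y where "y = tgt (x, s)"
  have y: "y \<in> V" "elt (x, s) \<in> Cs y x" using gen_tgt_props[OF G] unfolding y_def by auto
  obtain t where t: "{t} = (x ` \<Lambda> \<union> {s}) - y ` \<Lambda>" "y ` \<Lambda> \<union> {t} = x ` \<Lambda> \<union> {s}" "t \<in> cpt x s"
    using gen_tgt_image[OF G] unfolding y_def by blast
  have inv_eq: "gen_inv W S \<Lambda> b (x, s) = (y, t)"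
    unfolding gen_inv_def Let_def y_def[symmetric] fst_conv snd_conv t(1)[symmetric] by simp
  define R where "R = cox_adj W \<inter> (x ` \<Lambda> \<union> {s}) \<times> (x ` \<Lambda> \<union> {s})"
  have "sym R" unfolding R_def using cox_adj_sym vert_image_S[OF g(1)] g(2) by (intro symI) auto
  then have symR: "sym (R\<^sup>*)" by (rule sym_rtrancl)
  have "cpt x s = {k. (s, k) \<in> R\<^sup>*}" unfolding components_def R_def by simp
  moreover have "cpt y t = {k. (t, k) \<in> R\<^sup>*}" unfolding components_def R_def t(2) by simp
  moreover have "(s, t) \<in> R\<^sup>*" using t(3) calculation(1) by blast
  moreover have "(t, s) \<in> R\<^sup>*" using calculation(3) symR by (meson symD)
  ultimately have comp_eq: "cpt y t = cpt x s" by (auto intro: rtrancl_trans)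
  have inv: "inv (elt (x, s)) \<in> Cs x y" using y Cset_inv by blast
  have "t \<in> S" "t \<notin> y ` \<Lambda>" using t g(5) by auto
  moreover have "inv (elt (x, s)) \<in> generate W (cpt y t)"
    unfolding comp_eq by (rule parabolic_inv[OF g(5) gen_elt_mem[OF G]])
  moreover have "inv (elt (x, s)) \<noteq> \<one>"
    using gen_elt_not_one[OF G] gen_elt_carrier[OF G] inv_eq_1_iff by blast
  ultimately have G': "(y, t) \<in> Gens" and e': "elt (y, t) = inv (elt (x, s))"
    using gen_unique[OF y(1) g(1) _ _ inv] by auto
  have tgt': "tgt (y, t) = x" by (rule gen_tgt_eq[OF G' g(1)]) (use e' inv in simp)
  have "(y ` \<Lambda> \<union> {t}) - x ` \<Lambda> = {s}" using t(2) g(3) by auto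
  then have "gen_inv W S \<Lambda> b (y, t) = (x, s)"
    unfolding gen_inv_def Let_def tgt' fst_conv snd_conv by simp
  then show ?thesis using that[of t] inv_eq G' e' tgt' t(1) unfolding y_def by blast
qed

section \<open>Loop generators as reflections\<close>

abbreviation "Loops \<equiv> loop_gens W S \<Lambda> b"

lemma loop_iff: "\<xi> \<in> Loops \<longleftrightarrow> \<xi> \<in> Gens \<and> tgt \<xi> = fst \<xi>"
  unfolding loop_gens_def by blast

text \<open>For a loop the exchanged letter is again \<open>s\<close>, so the generator is its own
  inverse. It fixes every simple root of the component except \<alpha> s, and so moves them along
  one line, as \<open>involution_rank_one_reflection\<close> requires.\<close>

lemma loop_gen_reflection:
  assumes L: "(x, s) \<in> Loops"
  shows "\<exists>\<gamma>\<in>\<Phi>p. elt (x, s) = reflection W S \<gamma> \<and> \<gamma> \<in> perp x"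
proof -
  have G: "(x, s) \<in> Gens" and tgt: "tgt (x, s) = x" using L by (auto simp: loop_iff)
  note g = gensD[OF G]
  let ?g = "elt (x, s)"
  obtain t where "elt (x, t) = inv ?g" "{t} = (x ` \<Lambda> \<union> {s}) - x ` \<Lambda>"
    using gen_inv_props[OF G] unfolding tgt by metis
  moreover from this g(3) have "t = s" by blast
  ultimately have "inv ?g = ?g" by simp
  then have gg: "?g \<otimes> ?g = \<one>" using gen_elt_carrier[OF G] by (metis r_inv)
  have fixed: "?g \<star> \<alpha> a = \<alpha> a" if "a \<in> x ` \<Lambda>" for a
    using gen_tgt_props(2)[OF G] that Cset_act unfolding tgt by auto
  have "\<exists>c. ?g \<star> \<alpha> j - \<alpha> j = scale_vec c (?g \<star> \<alpha> s - \<alpha> s)" if "j \<in> cpt x s" for j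
  proof (cases "j = s")
    case True
    then show ?thesis by (intro exI[of _ 1]) simp
  next
    case False
    then show ?thesis using fixed[of j] that g(6) by (intro exI[of _ 0]) auto
  qed
  then obtain \<gamma> where \<gamma>: "\<gamma> \<in> \<Phi>p" "?g = reflection W S \<gamma>"
    using involution_rank_one_reflection[OF g(5) gen_elt_mem[OF G] gen_elt_not_one[OF G] gg] by blast
  note \<gamma>root = pos_root_root[OF \<gamma>(1)]
  \<comment> \<open>A vector fixed by the reflection is orthogonal to its root.\<close>
  have "form W \<gamma> (\<alpha> (x l)) = 0" if "l \<in> \<Lambda>" for l
  proof -
    have "\<alpha> (x l) - scale_vec (2 * form W \<gamma> (\<alpha> (x l))) \<gamma> = \<alpha> (x l)"
      using fixed[of "x l"] that vert_S[OF g(1)] unfolding \<gamma>(2) by (subst reflection_act[symmetric, OF \<gamma>root]) auto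
    then show ?thesis using root_nonzero[OF \<gamma>root] by (simp add: scale_vec_eq_0_iff)
  qed
  then show ?thesis using \<gamma> \<gamma>root by (auto simp: perp_iff)
qed

text \<open>The root is supported in the component, so its reflection changes no coordinate outside
  and lies in the parabolic subgroup of the generator. As an arrow from \<open>x\<close> to itself
  it must be the generator, by \<open>gen_unique\<close>.\<close>

lemma perp_inversion_gen:
  assumes G: "(x, s) \<in> Gens" and \<gamma>: "\<gamma> \<in> inversions (elt (x, s))" "\<gamma> \<in> perp x"
  shows "elt (x, s) = reflection W S \<gamma>" "(x, s) \<in> Loops"
proof -
  note g = gensD[OF G]
  have pos: "\<gamma> \<in> \<Phi>p" and sup: "supp \<gamma> \<subseteq> cpt x s"
    using \<gamma>(1) unfolding gen_inversions[OF G] par_pos_def by auto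
  note root = pos_root_root[OF pos]
  note refl = perp_reflection_Cset[OF g(1) \<gamma>(2)]
  have "inversions (reflection W S \<gamma>) \<subseteq> par_pos (cpt x s)"
  proof
    fix \<delta> assume \<delta>: "\<delta> \<in> inversions (reflection W S \<gamma>)"
    then have \<delta>pos: "\<delta> \<in> \<Phi>p" unfolding inversions_def by blast
    have "supp \<delta> \<subseteq> cpt x s"
    proof (rule ccontr)
      assume "\<not> supp \<delta> \<subseteq> cpt x s"
      then obtain k where k: "k \<notin> cpt x s" "0 < lk \<delta> k" using pos_root_coeff_outside[OF \<delta>pos] by blast
      then have "lk \<gamma> k = 0" using sup by (auto simp: in_keys_iff)
      then have "0 < lk (reflection W S \<gamma> \<star> \<delta>) k"
        using k reflection_act[OF root root_keys[OF pos_root_root[OF \<delta>pos]]] by (simp add: lookup_minus)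
      then have "reflection W S \<gamma> \<star> \<delta> \<in> \<Phi>p"
        by (rule pos_coeff[OF root_act[OF pos_root_root[OF \<delta>pos] reflection_closed[OF root]]])
      then show False using \<delta> unfolding inversions_def by blast
    qed
    then show "\<delta> \<in> par_pos (cpt x s)" using \<delta>pos unfolding par_pos_def by blast
  qed
  then have mem: "reflection W S \<gamma> \<in> generate W (cpt x s)"
    by (rule mem_parabolic_if_inversions[OF g(5) reflection_closed[OF root]])
  have "reflection W S \<gamma> \<noteq> \<one>" using reflection_self[OF root] not_pos_neg[OF pos] pos by auto
  from gen_unique(2)[OF g(1) g(1) g(2,3) refl mem this]
  show eq: "elt (x, s) = reflection W S \<gamma>" by simp
  show "(x, s) \<in> Loops" using G gen_tgt_eq[OF G g(1)] refl eq by (simp add: loop_iff)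
qed

lemma loop_perp_inversions:
  assumes L: "(x, s) \<in> Loops" and \<gamma>: "\<gamma> \<in> \<Phi>p" "elt (x, s) = reflection W S \<gamma>"
  shows "inversions (elt (x, s)) \<inter> perp x = {\<gamma>}" "\<gamma> \<in> perp x"
proof -
  have G: "(x, s) \<in> Gens" using L by (simp add: loop_iff)
  obtain \<gamma>' where "\<gamma>' \<in> \<Phi>p" "elt (x, s) = reflection W S \<gamma>'" "\<gamma>' \<in> perp x" using loop_gen_reflection[OF L] by blast
  then show perp: "\<gamma> \<in> perp x" using reflection_inject \<gamma> by metis
  have "\<gamma> \<in> inversions (elt (x, s))"
    using \<gamma> reflection_self[OF pos_root_root[OF \<gamma>(1)]] not_pos_neg unfolding inversions_def by simp
  moreover have "\<delta> = \<gamma>" if "\<delta> \<in> inversions (elt (x, s)) \<inter> perp x" for \<delta>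
    using that perp_inversion_gen[OF G, of \<delta>] \<gamma> reflection_inject unfolding inversions_def by auto
  ultimately show "inversions (elt (x, s)) \<inter> perp x = {\<gamma>}" using perp by blast
qed

lemma card_gen_perp_inversions:
  assumes "\<xi> \<in> Gens"
  shows "card (inversions (elt \<xi>) \<inter> perp (fst \<xi>)) = (if \<xi> \<in> Loops then 1 else 0)"
proof -
  obtain x s where \<xi>: "\<xi> = (x, s)" by fastforce
  show ?thesis
  proof (cases "\<xi> \<in> Loops")
    case True
    then show ?thesis using loop_gen_reflection[of x s] loop_perp_inversions[of x s] unfolding \<xi> by auto
  next
    case False
    then have "inversions (elt \<xi>) \<inter> perp (fst \<xi>) = {}"
      using perp_inversion_gen(2)[of x s] assms unfolding \<xi> by auto
    then show ?thesis using False by simp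
  qed
qed

section \<open>Standard expressions\<close>

abbreviation "path \<equiv> gen_path W S \<Lambda> b"
abbreviation "std \<equiv> standard_expression W S \<Lambda> b"
abbreviation "expr \<equiv> expression W S \<Lambda> b"
abbreviation "elts \<xi>s \<equiv> word_prod W (map elt \<xi>s)"
abbreviation "lens \<xi>s \<equiv> (\<Sum>\<xi>\<leftarrow>\<xi>s. len (elt \<xi>))"

lemma path_props:
  "path y \<xi>s x \<Longrightarrow> y \<in> V \<and> x \<in> V \<and> set \<xi>s \<subseteq> Gens \<and> elts \<xi>s \<in> Cs y x"
proof (induction \<xi>s arbitrary: y)
  case (Cons \<xi> \<xi>s)
  then have "\<xi> \<in> Gens" "tgt \<xi> = y" "elts \<xi>s \<in> Cs (fst \<xi>) x" "x \<in> V" "set \<xi>s \<subseteq> Gens" by auto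
  then show ?case using gen_tgt_props[of \<xi>] Cset_mult by auto
qed (auto simp: Cset_one)

lemma path_append: "path z (p @ q) x \<longleftrightarrow> (\<exists>y. path z p y \<and> path y q x)"
  by (induction p arbitrary: z) (auto dest: path_props)

lemma path_single: "path y [\<xi>] x \<longleftrightarrow> \<xi> \<in> Gens \<and> tgt \<xi> = y \<and> fst \<xi> = x"
  using fst_gen_vert[of \<xi>] by auto

lemma gens_elts_carrier: "set \<xi>s \<subseteq> Gens \<Longrightarrow> elts \<xi>s \<in> carrier W"
  using gen_elt_carrier by (intro word_prod_closed) auto

lemma elts_append: "set p \<subseteq> Gens \<Longrightarrow> set q \<subseteq> Gens \<Longrightarrow> elts (p @ q) = elts p \<otimes> elts q"
  using gen_elt_carrier by (auto simp: image_subset_iff subset_iff intro!: word_prod_append)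

lemma len_elts_le: "set \<xi>s \<subseteq> Gens \<Longrightarrow> len (elts \<xi>s) \<le> lens \<xi>s"
proof (induction \<xi>s)
  case (Cons \<xi> \<xi>s)
  then have "len (elt \<xi> \<otimes> elts \<xi>s) \<le> len (elt \<xi>) + len (elts \<xi>s)"
    by (intro len_mult_le) (auto simp: gen_elt_carrier gens_elts_carrier)
  then show ?case using Cons by simp
qed simp

lemma std_iff: "std y x w \<xi>s \<longleftrightarrow> path y \<xi>s x \<and> elts \<xi>s = w \<and> len w = lens \<xi>s"
  unfolding standard_expression_def expression_def by auto

lemma std_props:
  assumes "std y x w \<xi>s" shows "x \<in> V" "y \<in> V" "w \<in> Cs y x" "set \<xi>s \<subseteq> Gens" "w \<in> carrier W"
  using assms path_props[of y \<xi>s x] Cset_carrier unfolding std_iff by auto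

lemma std_append:
  assumes "std z y u p" "std y x w q" "len (u \<otimes> w) = len u + len w" shows "std z x (u \<otimes> w) (p @ q)"
proof -
  note p = std_props[OF assms(1)] and q = std_props[OF assms(2)]
  have "elts (p @ q) = u \<otimes> w" using assms p q by (simp only: elts_append std_iff)
  then show ?thesis using assms unfolding std_iff path_append by auto
qed

text \<open>Length is subadditive, so equality for the whole expression forces equality for both
  parts and for their product.\<close>

lemma std_split:
  assumes "std z x w (p @ q)"
  obtains y where "std z y (elts p) p" "std y x (elts q) q" "w = elts p \<otimes> elts q"
    "len (elts p \<otimes> elts q) = len (elts p) + len (elts q)"
proof -
  obtain y where y: "path z p y" "path y q x" using assms unfolding std_iff path_append by blast
  note pp = path_props[OF y(1)] and qq = path_props[OF y(2)]
  then have w: "w = elts p \<otimes> elts q" using assms elts_append[of p q] unfolding std_iff by simp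
  have c: "elts p \<in> carrier W" "elts q \<in> carrier W" using pp qq gens_elts_carrier by auto
  have "len w = lens p + lens q" using assms unfolding std_iff by simp
  moreover have "len w \<le> len (elts p) + len (elts q)" unfolding w by (rule len_mult_le[OF c])
  moreover have "len (elts p) \<le> lens p" "len (elts q) \<le> lens q" using pp qq len_elts_le by auto
  ultimately have "len (elts p) = lens p" "len (elts q) = lens q" "len w = len (elts p) + len (elts q)" by linarith+
  then show ?thesis using that[of y] y w unfolding std_iff by auto
qed

lemma std_Nil: "std y x w [] \<longleftrightarrow> y = x \<and> x \<in> V \<and> w = \<one>"
  unfolding std_iff by auto

lemma std_single: "\<xi> \<in> Gens \<Longrightarrow> std (tgt \<xi>) (fst \<xi>) (elt \<xi>) [\<xi>]"
  unfolding std_iff path_single using gen_elt_carrier[of \<xi>] by simp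

lemma std_singleD: "std y x w [\<xi>] \<Longrightarrow> \<xi> \<in> Gens \<and> tgt \<xi> = y \<and> fst \<xi> = x \<and> w = elt \<xi>"
  unfolding std_iff path_single using gen_elt_carrier[of \<xi>] by auto

lemma std_one: "std y x \<one> \<xi>s \<Longrightarrow> \<xi>s = []"
proof (rule ccontr)
  assume "std y x \<one> \<xi>s" "\<xi>s \<noteq> []"
  then obtain \<xi> \<eta>s where "\<xi>s = \<xi> # \<eta>s" "\<xi> \<in> Gens" "lens \<xi>s = 0" using std_props(4) unfolding std_iff
    by (cases \<xi>s) auto
  then show False using len_gen_elt_pos[of \<xi>] by simp
qed

lemma descent_step:
  assumes x: "x \<in> V" and y: "y \<in> V" and w: "w \<in> Cs y x" and s: "s \<in> S" "w \<star> \<alpha> s \<notin> \<Phi>p"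
  shows "(x, s) \<in> Gens" "w \<otimes> inv (elt (x, s)) \<in> Cs y (tgt (x, s))"
    "len w = len (w \<otimes> inv (elt (x, s))) + len (elt (x, s))"
proof -
  have T: "{s} \<subseteq> S" "\<And>t. t \<in> {s} \<Longrightarrow> w \<star> \<alpha> t \<notin> \<Phi>p" using s by auto
  note d = descents_facts[OF x y w T]
  show G: "(x, s) \<in> Gens" unfolding gens_def using x d(1,2) s by blast
  show "w \<otimes> inv (elt (x, s)) \<in> Cs y (tgt (x, s))"
    using w gen_tgt_props(2)[OF G] Cset_inv Cset_mult by fastforce
  show "len w = len (w \<otimes> inv (elt (x, s))) + len (elt (x, s))" using d(4) unfolding gen_elt_eq .
qed

lemma std_exists:
  assumes "x \<in> V" "y \<in> V" "w \<in> Cs y x" shows "\<exists>\<xi>s. std y x w \<xi>s"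
  using assms
proof (induction "len w" arbitrary: w x rule: less_induct)
  case less
  show ?case
  proof (cases "w = \<one>")
    case True
    then have "\<one> \<in> Cs y x" using less by simp
    then have "y = x" using Cset_target_unique[OF less(3) less(2)] Cset_one by blast
    then show ?thesis using True less std_Nil by blast
  next
    case False
    note w = Cset_carrier[OF less(4)]
    obtain s where s: "s \<in> S" "len (w \<otimes> s) < len w" using ex_descent w False by blast
    then have neg: "w \<star> \<alpha> s \<notin> \<Phi>p" using descent_iff w by blast
    note d = descent_step[OF less(2,3,4) s(1) neg]
    note g = gen_elt_carrier[OF d(1)]
    have "len (w \<otimes> inv (elt (x, s))) < len w" using d len_gen_elt_pos[OF d(1)] by simp
    from less(1)[OF this gen_tgt_props(1)[OF d(1)] less(3) d(2)]
    obtain \<xi>s where \<xi>s: "std y (tgt (x, s)) (w \<otimes> inv (elt (x, s))) \<xi>s" by blast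
    have eq: "w \<otimes> inv (elt (x, s)) \<otimes> elt (x, s) = w" using w g by (simp add: m_assoc)
    have "std y x (w \<otimes> inv (elt (x, s)) \<otimes> elt (x, s)) (\<xi>s @ [(x, s)])"
      by (rule std_append[OF \<xi>s std_single[OF d(1), unfolded fst_conv]]) (use d(3) eq in simp)
    then show ?thesis unfolding eq by blast
  qed
qed

text \<open>Any descent can be made the last letter; this freedom drives both theorems on moves
  below.\<close>

lemma std_exists_last:
  assumes x: "x \<in> V" and y: "y \<in> V" and w: "w \<in> Cs y x" and s: "s \<in> S" "w \<star> \<alpha> s \<notin> \<Phi>p"
  shows "(x, s) \<in> Gens" "\<exists>\<xi>s. std y x w (\<xi>s @ [(x, s)])"
proof -
  note d = descent_step[OF x y w s]
  show "(x, s) \<in> Gens" by (rule d(1))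
  have eq: "w \<otimes> inv (elt (x, s)) \<otimes> elt (x, s) = w"
    using Cset_carrier[OF w] gen_elt_carrier[OF d(1)] by (simp add: m_assoc)
  obtain \<xi>s where \<xi>s: "std y (tgt (x, s)) (w \<otimes> inv (elt (x, s))) \<xi>s"
    using std_exists[OF gen_tgt_props(1)[OF d(1)] y d(2)] by blast
  have "std y x (w \<otimes> inv (elt (x, s)) \<otimes> elt (x, s)) (\<xi>s @ [(x, s)])"
    by (rule std_append[OF \<xi>s std_single[OF d(1), unfolded fst_conv]]) (use d(3) eq in simp)
  then show "\<exists>\<xi>s. std y x w (\<xi>s @ [(x, s)])" unfolding eq by blast
qed

text \<open>The number of loop generators does not depend on the standard expression because it
  counts the inversions in $\Phi^{\perp[x]}$.\<close>
definition pinv :: "('l \<Rightarrow> 'a) \<Rightarrow> 'a \<Rightarrow> 'a vec set" where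
  "pinv x w = inversions w \<inter> perp x"

text \<open>The disjoint union of \<open>inversions_mult_eq\<close> restricts to orthogonal roots,
  because \<open>inv v\<close> carries those at \<open>y\<close> onto those at
  \<open>x\<close>.\<close>

lemma pinv_add:
  assumes x: "x \<in> V" and u: "u \<in> Cs z y" and v: "v \<in> Cs y x" and y: "y \<in> V" and l: "len (u \<otimes> v) = len u + len v"
  shows "card (pinv x (u \<otimes> v)) = card (pinv y u) + card (pinv x v)"
proof -
  note uc = Cset_carrier[OF u] and vc = Cset_carrier[OF v]
  have sub: "inversions v \<subseteq> inversions (u \<otimes> v)" using len_add_iff uc vc l by blast
  note eq = inversions_mult_eq[OF uc vc sub]
  have "(\<star>) (inv v) ` inversions u \<inter> perp x = (\<star>) (inv v) ` (inversions u \<inter> perp y)"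
  proof (intro equalityI subsetI)
    fix \<gamma> assume "\<gamma> \<in> (\<star>) (inv v) ` inversions u \<inter> perp x"
    then obtain \<delta> where d: "\<delta> \<in> inversions u" "\<gamma> = inv v \<star> \<delta>" "\<gamma> \<in> perp x" by blast
    then have "v \<star> \<gamma> \<in> perp y" using perp_act[OF v x] by blast
    then show "\<gamma> \<in> (\<star>) (inv v) ` (inversions u \<inter> perp y)" using d vc by auto
  next
    fix \<gamma> assume "\<gamma> \<in> (\<star>) (inv v) ` (inversions u \<inter> perp y)"
    then show "\<gamma> \<in> (\<star>) (inv v) ` inversions u \<inter> perp x" using perp_act[OF Cset_inv[OF v] y] by blast
  qed
  then have "pinv x (u \<otimes> v) = pinv x v \<union> (\<star>) (inv v) ` pinv y u" "pinv x v \<inter> (\<star>) (inv v) ` pinv y u = {}"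
    using eq unfolding pinv_def by blast+
  moreover have "finite (pinv x v)" "finite (pinv y u)" unfolding pinv_def using uc vc by auto
  ultimately show ?thesis using vc by (simp add: card_Un_disjoint)
qed

lemma std_loop_count: "std y x w \<xi>s \<Longrightarrow> card (pinv x w) = length (filter (\<lambda>\<xi>. \<xi> \<in> Loops) \<xi>s)"
proof (induction \<xi>s arbitrary: y w)
  case Nil
  then show ?case by (simp add: std_Nil pinv_def)
next
  case (Cons \<xi> \<xi>s)
  then have "std y x w ([\<xi>] @ \<xi>s)" by simp
  then obtain z where z: "std y z (elts [\<xi>]) [\<xi>]" "std z x (elts \<xi>s) \<xi>s" "w = elts [\<xi>] \<otimes> elts \<xi>s"
    "len (elts [\<xi>] \<otimes> elts \<xi>s) = len (elts [\<xi>]) + len (elts \<xi>s)" by (rule std_split)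
  note s = std_singleD[OF z(1)] and p1 = std_props[OF z(1)] and p2 = std_props[OF z(2)]
  have "card (pinv x w) = card (pinv z (elts [\<xi>])) + card (pinv x (elts \<xi>s))"
    unfolding z(3) by (rule pinv_add[OF p2(1) p1(3) p2(3) p1(1) z(4)])
  moreover have "card (pinv z (elts [\<xi>])) = (if \<xi> \<in> Loops then 1 else 0)"
    using card_gen_perp_inversions[of \<xi>] s unfolding pinv_def by simp
  ultimately show ?case using Cons.IH[OF z(2)] by simp
qed

lemma lp_eq:
  assumes "x \<in> V" "y \<in> V" "w \<in> Cs y x" shows "lp W S \<Lambda> b x w = card (pinv x w)"
  unfolding lp_def
proof (rule the_equality)
  obtain \<xi>s where "std y x w \<xi>s" using std_exists assms by blast
  then show "\<exists>y \<xi>s. std y x w \<xi>s \<and> card (pinv x w) = length (filter (\<lambda>\<xi>. \<xi> \<in> Loops) \<xi>s)"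
    using std_loop_count by blast
qed (use std_loop_count in force)

section \<open>The subgroupoid of arrows without orthogonal inversions\<close>

lemma Yset_iff:
  assumes "x \<in> V" shows "w \<in> Ys y x \<longleftrightarrow> w \<in> Cs y x \<and> pinv x w = {}"
  unfolding Yset_def pinv_def inversions_def perp_pos_roots_def by auto

lemma Yset_Cset: "w \<in> Ys y x \<Longrightarrow> w \<in> Cs y x"
  unfolding Yset_def by blast

lemma Yset_carrier: "w \<in> Ys y x \<Longrightarrow> w \<in> carrier W"
  using Yset_Cset Cset_carrier by blast

lemma Yset_act_pos: "w \<in> Ys y x \<Longrightarrow> \<gamma> \<in> \<Phi>p \<Longrightarrow> \<gamma> \<in> perp x \<Longrightarrow> w \<star> \<gamma> \<in> \<Phi>p"
  unfolding Yset_def perp_pos_roots_def by blast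

lemma YsetI:
  "w \<in> Cs y x \<Longrightarrow> (\<And>\<gamma>. \<gamma> \<in> \<Phi>p \<Longrightarrow> \<gamma> \<in> perp x \<Longrightarrow> w \<star> \<gamma> \<in> \<Phi>p) \<Longrightarrow> w \<in> Ys y x"
  unfolding Yset_def perp_pos_roots_def by auto

lemma Yset_one: "\<one> \<in> Ys x x"
  by (rule YsetI) (auto simp: Cset_one)

lemma Yset_mult:
  assumes x: "x \<in> V" and u: "u \<in> Ys z y" and w: "w \<in> Ys y x" shows "u \<otimes> w \<in> Ys z x"
proof (rule YsetI)
  note wC = Yset_Cset[OF w]
  show "u \<otimes> w \<in> Cs z x" by (rule Cset_mult[OF Yset_Cset[OF u] wC])
  fix \<gamma> assume g: "\<gamma> \<in> \<Phi>p" "\<gamma> \<in> perp x"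
  show "(u \<otimes> w) \<star> \<gamma> \<in> \<Phi>p"
    unfolding act_mult[OF Yset_carrier[OF u] Yset_carrier[OF w]]
    by (rule Yset_act_pos[OF u Yset_act_pos[OF w g] perp_act[OF wC x g(2)]])
qed

text \<open>\<open>w\<close> keeps positive orthogonal roots positive, hence negative ones negative,
  so its inverse cannot change a sign either.\<close>

lemma Yset_inv:
  assumes x: "x \<in> V" and y: "y \<in> V" and w: "w \<in> Ys y x" shows "inv w \<in> Ys x y"
proof -
  note wc = Yset_carrier[OF w] and inv = Cset_inv[OF Yset_Cset[OF w]]
  have "inv w \<star> \<gamma> \<in> \<Phi>p" if \<gamma>: "\<gamma> \<in> \<Phi>p" "\<gamma> \<in> perp y" for \<gamma>
  proof (rule ccontr)
    assume "inv w \<star> \<gamma> \<notin> \<Phi>p"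
    moreover have "inv w \<star> \<gamma> \<in> perp x" by (rule perp_act[OF inv y \<gamma>(2)])
    ultimately have "- (inv w \<star> \<gamma>) \<in> \<Phi>p" "- (inv w \<star> \<gamma>) \<in> perp x"
      using neg_iff perp_root perp_uminus by blast+
    then have "w \<star> (- (inv w \<star> \<gamma>)) \<in> \<Phi>p" by (rule Yset_act_pos[OF w])
    then have "- \<gamma> \<in> \<Phi>p" using wc by (simp add: act_linear)
    then show False using \<gamma>(1) not_pos_neg by blast
  qed
  then show ?thesis using inv YsetI by blast
qed

abbreviation "NLoops \<equiv> nonloop_gens W S \<Lambda> b"

lemma nonloop_gen_Yset: "\<xi> \<in> NLoops \<Longrightarrow> elt \<xi> \<in> Ys (tgt \<xi>) (fst \<xi>)"
proof -
  assume \<xi>: "\<xi> \<in> NLoops"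
  then have G: "\<xi> \<in> Gens" "\<xi> \<notin> Loops" unfolding nonloop_gens_def by auto
  have "pinv (fst \<xi>) (elt \<xi>) = {}"
    using card_gen_perp_inversions[OF G(1)] G gen_elt_carrier[OF G(1)] unfolding pinv_def by simp
  then show ?thesis using Yset_iff fst_gen_vert gen_tgt_props(2) G(1) by blast
qed

lemma nonloop_gens_Gens: "set \<xi>s \<subseteq> NLoops \<Longrightarrow> set \<xi>s \<subseteq> Gens"
  unfolding nonloop_gens_def by blast

lemma nonloop_path_Yset: "path y \<xi>s x \<Longrightarrow> set \<xi>s \<subseteq> NLoops \<Longrightarrow> elts \<xi>s \<in> Ys y x"
proof (induction \<xi>s arbitrary: y)
  case (Cons \<xi> \<xi>s)
  then have "elt \<xi> \<in> Ys y (fst \<xi>)" "elts \<xi>s \<in> Ys (fst \<xi>) x" using nonloop_gen_Yset[of \<xi>] by auto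
  moreover have "x \<in> V" using path_props Cons.prems by blast
  ultimately show ?case using Yset_mult by simp
qed (simp add: Yset_one)

text \<open>Since this covers every standard expression and not just some, the expressions built in
  the braid argument are free of loops automatically.\<close>

lemma std_Yset_nonloop:
  assumes "std y x w \<xi>s" "w \<in> Ys y x" shows "set \<xi>s \<subseteq> NLoops"
proof -
  have "card (pinv x w) = 0" using assms Yset_iff std_props(1) by (metis card.empty)
  then have "filter (\<lambda>\<xi>. \<xi> \<in> Loops) \<xi>s = []" using std_loop_count[OF assms(1)] by simp
  then show ?thesis using std_props(4)[OF assms(1)] unfolding nonloop_gens_def filter_empty_conv by blast
qed

text \<open>A standard expression without loops gives one inclusion; the other holds because
  \<open>Y\<close> contains the non-loop generators and is closed under the groupoid
  operations.\<close>

lemma Yset_generated: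
  assumes "x \<in> V" "y \<in> V"
  shows "Ys y x = {w. groupoid_gen W V (nonloop_arrow W S \<Lambda> b) y x w}"
proof (intro equalityI subsetI CollectI)
  fix w assume w: "w \<in> Ys y x"
  obtain \<xi>s where std: "std y x w \<xi>s" using std_exists[OF assms Yset_Cset[OF w]] by blast
  have "groupoid_gen W V (nonloop_arrow W S \<Lambda> b) y x (elts \<xi>s)"
    if "path y \<xi>s x" "set \<xi>s \<subseteq> NLoops" for \<xi>s y
    using that
  proof (induction \<xi>s arbitrary: y)
    case Nil
    then show ?case by (auto intro: groupoid_gen.ident)
  next
    case (Cons \<xi> \<xi>s)
    have "nonloop_arrow W S \<Lambda> b y (fst \<xi>) (elt \<xi>)"
      unfolding nonloop_arrow_def using Cons.prems by auto
    moreover have "y \<in> V" "fst \<xi> \<in> V" using Cons.prems gen_tgt_props(1)[of \<xi>] fst_gen_vert by auto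
    ultimately have "groupoid_gen W V (nonloop_arrow W S \<Lambda> b) y (fst \<xi>) (elt \<xi>)"
      by (intro groupoid_gen.incl)
    then show ?case using Cons by (auto intro: groupoid_gen.comp)
  qed
  then show "groupoid_gen W V (nonloop_arrow W S \<Lambda> b) y x w"
    using std std_Yset_nonloop[OF std w] unfolding std_iff by auto
next
  fix w assume "w \<in> {w. groupoid_gen W V (nonloop_arrow W S \<Lambda> b) y x w}"
  then have "groupoid_gen W V (nonloop_arrow W S \<Lambda> b) y x w" by simp
  then have "y \<in> V \<and> x \<in> V \<and> w \<in> Ys y x"
  proof (induction rule: groupoid_gen.induct)
    case (incl x y w)
    then obtain \<xi> where "\<xi> \<in> NLoops" "fst \<xi> = x" "tgt \<xi> = y" "elt \<xi> = w"
      unfolding nonloop_arrow_def by blast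
    then show ?case using nonloop_gen_Yset incl by blast
  qed (auto simp: Yset_one Yset_inv Yset_mult)
  then show "w \<in> Ys y x" by blast
qed

section \<open>Moves between loop-free expressions\<close>

abbreviation "nbm \<equiv> nonloop_braid_move W S \<Lambda> b"
abbreviation "cancel \<equiv> cancel_move W S \<Lambda> b"

lemma nbm_context: "nbm p q \<Longrightarrow> nbm (u @ p @ v) (u @ q @ v)"
proof (induction rule: nonloop_braid_move.induct)
  case (1 p q u' v')
  from nonloop_braid_move.intros[OF this, of "u @ u'" "v' @ v"] show ?case by simp
qed

lemma nbm_star_context: "nbm\<^sup>*\<^sup>* p q \<Longrightarrow> nbm\<^sup>*\<^sup>* (u @ p @ v) (u @ q @ v)"
  by (induction rule: rtranclp_induct) (auto intro: rtranclp.rtrancl_into_rtrancl nbm_context)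

lemma std_cancel_last:
  assumes "std y x w (p @ [\<xi>])"
  shows "std y (tgt \<xi>) (w \<otimes> inv (elt \<xi>)) p" "\<xi> \<in> Gens" "fst \<xi> = x" "len w = len (w \<otimes> inv (elt \<xi>)) + len (elt \<xi>)"
    "inversions (elt \<xi>) \<subseteq> inversions w"
proof -
  obtain z where z: "std y z (elts p) p" "std z x (elts [\<xi>]) [\<xi>]" "w = elts p \<otimes> elts [\<xi>]"
    "len (elts p \<otimes> elts [\<xi>]) = len (elts p) + len (elts [\<xi>])" using assms by (rule std_split)
  note s = std_singleD[OF z(2)]
  note c = std_props(5)[OF z(1)] gen_elt_carrier[of \<xi>]
  have e: "elts [\<xi>] = elt \<xi>" using c s by simp
  have w: "w \<otimes> inv (elt \<xi>) = elts p" unfolding z(3) e using c s by (simp add: m_assoc)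
  have "inversions (elt \<xi>) \<subseteq> inversions w"
    using len_add_iff[of "elts p" "elt \<xi>"] z(3,4) c s unfolding e by simp
  then show "std y (tgt \<xi>) (w \<otimes> inv (elt \<xi>)) p" "\<xi> \<in> Gens" "fst \<xi> = x"
    "len w = len (w \<otimes> inv (elt \<xi>)) + len (elt \<xi>)" "inversions (elt \<xi>) \<subseteq> inversions w"
    using z s unfolding w e by simp_all
qed

text \<open>Equal last letters are cancelled and induction applies. Different ones are both
  descents, so a rank two element \<open>h\<close> splits off on the right. Its two standard
  expressions end in these letters; behind a common prefix \<open>e\<close> they differ by one braid
  move, and \<open>same_last\<close> links each of the two words to a given expression.\<close>

theorem std_braid_equivalent:
  assumes "std y x w p" "std y x w q" "w \<in> Ys y x" shows "nbm\<^sup>*\<^sup>* p q"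
  using assms
proof (induction "len w" arbitrary: x w p q rule: less_induct)
  case less
  note p = less.prems(1) and q = less.prems(2) and wY = less.prems(3)
  have same_last: "nbm\<^sup>*\<^sup>* (p' @ [\<xi>]) (q' @ [\<xi>])" if p': "std y x w (p' @ [\<xi>])" and q': "std y x w (q' @ [\<xi>])" for p' q' \<xi>
  proof -
    note P = std_cancel_last[OF p'] and Q = std_cancel_last[OF q']
    have G: "\<xi> \<in> Gens" "fst \<xi> = x" "len w = len (w \<otimes> inv (elt \<xi>)) + len (elt \<xi>)" using P by blast+
    have sp: "std y (tgt \<xi>) (w \<otimes> inv (elt \<xi>)) p'" using P by blast
    have sq: "std y (tgt \<xi>) (w \<otimes> inv (elt \<xi>)) q'" using Q by blast
    have "set p' \<subseteq> NLoops" using std_Yset_nonloop[OF p' wY] by simp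
    then have "w \<otimes> inv (elt \<xi>) \<in> Ys y (tgt \<xi>)"
      using nonloop_path_Yset[of y p' "tgt \<xi>"] sp unfolding std_iff by simp
    moreover have "len (w \<otimes> inv (elt \<xi>)) < len w" using G len_gen_elt_pos[OF G(1)] by linarith
    ultimately have "nbm\<^sup>*\<^sup>* p' q'" using less.hyps sp sq by blast
    then show ?thesis using nbm_star_context[of p' q' "[]" "[\<xi>]"] by simp
  qed
  show ?case
  proof (cases "w = \<one>")
    case True
    then have "p = []" "q = []" using p q std_one by auto
    then show ?thesis by simp
  next
    case False
    have "p \<noteq> []" "q \<noteq> []" using p q False by (auto simp: std_Nil)
    then obtain p' \<xi> q' \<eta> where pq: "p = p' @ [\<xi>]" "q = q' @ [\<eta>]" by (metis rev_exhaust)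
    note P = std_cancel_last[OF p[unfolded pq]] and Q = std_cancel_last[OF q[unfolded pq]]
    obtain s t where st: "\<xi> = (x, s)" "\<eta> = (x, t)" using P(3) Q(3) by (metis prod.collapse)
    show ?thesis
    proof (cases "s = t")
      case True
      then show ?thesis using same_last p q st pq by simp
    next
      case False
      have G: "(x, s) \<in> Gens" "(x, t) \<in> Gens" using P(2) Q(2) st by auto
      have x: "x \<in> V" and y: "y \<in> V" and w: "w \<in> Cs y x" using std_props[OF p] by auto
      have "\<alpha> s \<in> inversions w" "\<alpha> t \<in> inversions w"
        using gen_inversions_simple[OF G(1)] gen_inversions_simple[OF G(2)] P(5) Q(5) st by auto
      then have T: "{s, t} \<subseteq> S" "\<And>r. r \<in> {s, t} \<Longrightarrow> w \<star> \<alpha> r \<notin> \<Phi>p"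
        using gensD[OF G(1)] gensD[OF G(2)] unfolding inversions_def by auto
      define K where "K = components W (x ` \<Lambda>) {s, t}"
      define h where "h = longest_quotient K (K - {s, t})"
      have d: "{s, t} \<inter> x ` \<Lambda> = {}" "finite_type W K" "len w = len (w \<otimes> inv h) + len h"
        unfolding h_def K_def by (rule descents_facts[OF x y w T]; assumption)+
      have K: "K \<subseteq> S" "{s, t} \<subseteq> K" using comp_facts[OF x T(1) d(1)] unfolding K_def by auto
      obtain z where z: "z \<in> V" "h \<in> Cs z x"
        using quotient_Cset[OF x T(1) d(1), folded K_def, OF d(2)] unfolding h_def by blast
      have hc: "h \<in> carrier W" using Cset_carrier z by blast
      have "inversions h = par_pos K - par_pos (K - {s, t})"
        unfolding h_def by (rule inversions_longest_quotient[OF K(1) d(2) Diff_subset])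
      then have "\<alpha> s \<in> inversions h" "\<alpha> t \<in> inversions h" using K T(1) unfolding par_pos_def by auto
      then have neg: "h \<star> \<alpha> s \<notin> \<Phi>p" "h \<star> \<alpha> t \<notin> \<Phi>p" unfolding inversions_def by auto
      obtain p2 where p2: "std z x h (p2 @ [(x, s)])" using std_exists_last(2)[OF x z gensD(2)[OF G(1)] neg(1)] by blast
      obtain q2 where q2: "std z x h (q2 @ [(x, t)])" using std_exists_last(2)[OF x z gensD(2)[OF G(2)] neg(2)] by blast
      have eq: "w \<otimes> inv h \<otimes> h = w" using Cset_carrier[OF w] hc by (simp add: m_assoc)
      have l: "len (w \<otimes> inv h \<otimes> h) = len (w \<otimes> inv h) + len h" using d(3) eq by simp
      obtain e where e: "std y z (w \<otimes> inv h) e"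
        using std_exists[OF z(1) y Cset_mult[OF w Cset_inv[OF z(2)]]] by blast
      have ep: "std y x w (e @ p2 @ [(x, s)])" using std_append[OF e p2 l] eq by simp
      have eq': "std y x w (e @ q2 @ [(x, t)])" using std_append[OF e q2 l] eq by simp
      have "nbm (e @ (p2 @ [(x, s)]) @ []) (e @ (q2 @ [(x, t)]) @ [])"
      proof (rule nonloop_braid_move.intros)
        have "p2 @ [(x, s)] \<noteq> q2 @ [(x, t)]" using False by simp
        then show "braid_pair W S \<Lambda> b (p2 @ [(x, s)]) (q2 @ [(x, t)])"
          unfolding braid_pair_def
          using x gensD(2,3)[OF G(1)] gensD(2,3)[OF G(2)] False d(2) p2 q2
          unfolding h_def longest_quotient_def K_def by blast
        \<comment> \<open>The full word including \<open>e\<close> is a standard expression of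
          \<open>w\<close>, which lies in \<open>Y\<close>.\<close>
        show "set (p2 @ [(x, s)]) \<inter> Loops = {}" using std_Yset_nonloop[OF ep wY] unfolding nonloop_gens_def by auto
        show "set (q2 @ [(x, t)]) \<inter> Loops = {}" using std_Yset_nonloop[OF eq' wY] unfolding nonloop_gens_def by auto
      qed
      moreover have "nbm\<^sup>*\<^sup>* p ((e @ p2) @ [(x, s)])"
        unfolding pq(1) st(1) by (rule same_last) (use p ep in \<open>simp_all add: pq st\<close>)
      moreover have "nbm\<^sup>*\<^sup>* ((e @ q2) @ [(x, t)]) q"
        unfolding pq(2) st(2) by (rule same_last) (use q eq' in \<open>simp_all add: pq st\<close>)
      ultimately show ?thesis by simp
    qed
  qed
qed

lemma first_nonreduced:
  assumes "len (elts \<xi>s) \<noteq> lens \<xi>s"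
  shows "\<exists>p \<xi> q. \<xi>s = p @ \<xi> # q \<and> len (elts p) = lens p \<and> len (elts (p @ [\<xi>])) \<noteq> lens (p @ [\<xi>])"
  using assms
proof (induction \<xi>s rule: rev_induct)
  case (snoc \<xi> \<xi>s)
  show ?case
  proof (cases "len (elts \<xi>s) = lens \<xi>s")
    case True
    then show ?thesis using snoc.prems by (intro exI[of _ \<xi>s] exI[of _ \<xi>] exI[of _ "[]"]) auto
  next
    case False
    then obtain p \<eta> q where "\<xi>s = p @ \<eta> # q" "len (elts p) = lens p" "len (elts (p @ [\<eta>])) \<noteq> lens (p @ [\<eta>])"
      using snoc.IH by blast
    then show ?thesis by (intro exI[of _ p] exI[of _ \<eta>] exI[of _ "q @ [\<xi>]"]) auto
  qed
qed simp

text \<open>An inversion of the inverse generator is minus the image of an inversion of the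
  generator, and the latter is supported on [z] and \<open>t\<close>, where \<open>u\<close> keeps
  all simple roots positive. Read backwards: if lengths fail to add, \<open>t\<close> is a descent
  of \<open>u\<close>.\<close>

lemma len_add_gen:
  assumes z: "z \<in> V" and u: "u \<in> Cs y z" "y \<in> V" and G: "(z, t) \<in> Gens" and pos: "u \<star> \<alpha> t \<in> \<Phi>p"
  shows "len (u \<otimes> inv (elt (z, t))) = len u + len (inv (elt (z, t)))"
proof -
  let ?h = "elt (z, t)"
  note uc = Cset_carrier[OF u(1)] and hc = gen_elt_carrier[OF G]
  have "inversions (inv ?h) \<subseteq> inversions (u \<otimes> inv ?h)"
  proof
    fix \<gamma> assume \<gamma>: "\<gamma> \<in> inversions (inv ?h)"
    then have g: "\<gamma> \<in> \<Phi>p" "inv ?h \<star> \<gamma> \<notin> \<Phi>p" unfolding inversions_def by auto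
    let ?\<delta> = "- (inv ?h \<star> \<gamma>)"
    have root: "inv ?h \<star> \<gamma> \<in> \<Phi>" by (rule root_act[OF pos_root_root[OF g(1)]]) (use hc in simp)
    have d: "?\<delta> \<in> \<Phi>p" using neg_iff[OF root] g(2) by blast
    have "?h \<star> ?\<delta> = - \<gamma>" using hc by (simp add: act_linear)
    then have "?\<delta> \<in> inversions ?h" using d g(1) not_pos_neg unfolding inversions_def by simp
    then have "supp ?\<delta> \<subseteq> cpt z t" unfolding gen_inversions[OF G] par_pos_def by blast
    then have "supp ?\<delta> \<subseteq> z ` \<Lambda> \<union> {t}" using gensD(6)[OF G] by blast
    then have "u \<star> ?\<delta> \<in> \<Phi>p"
      by (intro act_pos_into[OF uc d]) (use pos Cset_simple[OF u] in fastforce)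
    then have "- (u \<star> inv ?h \<star> \<gamma>) \<in> \<Phi>p" using uc by (simp add: act_linear)
    then have "u \<star> inv ?h \<star> \<gamma> \<notin> \<Phi>p" using not_pos_neg by blast
    then show "\<gamma> \<in> inversions (u \<otimes> inv ?h)" using g uc hc unfolding inversions_def by (simp add: act_mult)
  qed
  then show ?thesis using len_add_iff uc hc by simp
qed

text \<open>Induction on the sum of the lengths of the letters. At the first letter \<xi> where
  lengths fail to add, the standard prefix has another standard expression ending in the inverse of
  \<xi>; braid moves reach it, and the pair cancels.\<close>

theorem expr_reduces:
  assumes "path y \<xi>s x" "set \<xi>s \<subseteq> NLoops" "std y x (elts \<xi>s) \<eta>s"
  shows "(sup nbm cancel)\<^sup>*\<^sup>* \<xi>s \<eta>s"
  using assms
proof (induction "lens \<xi>s" arbitrary: \<xi>s rule: less_induct)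
  case less
  note path = less.prems(1) and nl = less.prems(2) and std = less.prems(3)
  have mono: "(sup nbm cancel)\<^sup>*\<^sup>* p q" if "nbm\<^sup>*\<^sup>* p q" for p q
    using that by (rule rtranclp_mono[THEN predicate2D, rotated]) simp
  show ?case
  proof (cases "len (elts \<xi>s) = lens \<xi>s")
    case True
    then have "std y x (elts \<xi>s) \<xi>s" using path unfolding std_iff by simp
    then show ?thesis using mono[OF std_braid_equivalent[OF _ std]] nonloop_path_Yset[OF path nl] by blast
  next
    case False
    then obtain p \<xi> q where split: "\<xi>s = p @ \<xi> # q" and p: "len (elts p) = lens p"
      and p\<xi>: "len (elts (p @ [\<xi>])) \<noteq> lens (p @ [\<xi>])" using first_nonreduced by blast
    obtain z where z: "path y p z" "\<xi> \<in> Gens" "tgt \<xi> = z" "path (fst \<xi>) q x"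
      using path unfolding split path_append by auto
    obtain x' s where \<xi>: "\<xi> = (x', s)" by fastforce
    have zV: "z \<in> V" and yV: "y \<in> V" and u: "elts p \<in> Cs y z" and pG: "set p \<subseteq> Gens" using path_props[OF z(1)] by auto
    have uY: "elts p \<in> Ys y z" using nonloop_path_Yset[OF z(1)] nl unfolding split by simp
    have pstd: "std y z (elts p) p" using z(1) p unfolding std_iff by simp
    \<comment> \<open>\<open>(z, t)\<close> and \<xi> are inverse to each other; the subword to be
      cancelled is \<open>(z, t)\<close> followed by \<xi>.\<close>
    obtain t where t: "(z, t) \<in> Gens" "elt (z, t) = inv (elt \<xi>)" "tgt (z, t) = x'"
      "gen_inv W S \<Lambda> b (z, t) = \<xi>"
      using gen_inv_props[of x' s] z(2,3) unfolding \<xi> by metis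
    note gc = gen_elt_carrier[OF z(2)]
    have inv_t: "inv (elt (z, t)) = elt \<xi>" using t(2) gc by simp
    have "elts (p @ [\<xi>]) = elts p \<otimes> elt \<xi>" using elts_append[of p "[\<xi>]"] pG z(2) gc by simp
    then have "len (elts p \<otimes> elt \<xi>) \<noteq> len (elts p) + len (elt \<xi>)" using p\<xi> p by simp
    then have neg: "elts p \<star> \<alpha> t \<notin> \<Phi>p"
      using len_add_gen[OF zV u yV t(1)] unfolding inv_t by blast
    obtain e where e: "std y z (elts p) (e @ [(z, t)])"
      using std_exists_last(2)[OF zV yV u gensD(2)[OF t(1)] neg] by blast
    have "nbm\<^sup>*\<^sup>* p (e @ [(z, t)])" by (rule std_braid_equivalent[OF pstd e uY])
    then have "nbm\<^sup>*\<^sup>* \<xi>s ((e @ [(z, t)]) @ \<xi> # q)"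
      using nbm_star_context[of p "e @ [(z, t)]" "[]" "\<xi> # q"] unfolding split by simp
    then have 1: "(sup nbm cancel)\<^sup>*\<^sup>* \<xi>s ((e @ [(z, t)]) @ \<xi> # q)" by (rule mono)
    have "cancel (e @ [(z, t), gen_inv W S \<Lambda> b (z, t)] @ q) (e @ q)" by (rule cancel_move.intros[OF t(1)])
    then have 2: "sup nbm cancel ((e @ [(z, t)]) @ \<xi> # q) (e @ q)" unfolding t(4) by simp
    note E = std_cancel_last[OF e]
    have e_std: "std y x' (elts p \<otimes> elt \<xi>) e" using E(1) unfolding t(3) inv_t .
    have eP: "path y e x'" "elts e = elts p \<otimes> elt \<xi>" using e_std unfolding std_iff by auto
    have path': "path y (e @ q) x" unfolding path_append using eP z(4) \<xi> by auto
    have nl': "set (e @ q) \<subseteq> NLoops" using std_Yset_nonloop[OF e uY] nl unfolding split by auto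
    have qG: "set q \<subseteq> Gens" "set e \<subseteq> Gens" using nl' nonloop_gens_Gens by auto
    have "elts (e @ q) = elts p \<otimes> elt \<xi> \<otimes> elts q" using elts_append[of e q] qG eP by simp
    also have "\<dots> = elts p \<otimes> elts (\<xi> # q)" using gens_elts_carrier pG qG gc by (simp add: m_assoc)
    also have "\<dots> = elts \<xi>s" unfolding split using elts_append[of p "\<xi> # q"] pG qG z(2) by simp
    finally have same: "elts (e @ q) = elts \<xi>s" .
    \<comment> \<open>\<open>p\<close> and \<open>e @ [(z, t)]\<close> are standard expressions of
      one element, so their total lengths agree.\<close>
    have "lens e < lens p"
      using e p len_gen_elt_pos[OF t(1)] unfolding std_iff by simp
    then have less': "lens (e @ q) < lens \<xi>s" unfolding split by simp
    have "(sup nbm cancel)\<^sup>*\<^sup>* (e @ q) \<eta>s" by (rule less.hyps[OF less' path' nl']) (use std same in simp)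
    then show ?thesis using 1 2 by (meson rtranclp.rtrancl_into_rtrancl rtranclp_trans)
  qed
qed

end

section \<open>The reflection part\<close>

text \<open>Blocks \<open>e 0\<close>, ..., \<open>e n\<close> separated by letters
  \<open>l 1\<close>, ..., \<open>l n\<close>. Letters are numbered from 1, so that
  \<open>l i\<close> stands directly before \<open>e i\<close>, as in the expression of the
  theorem.\<close>

definition interleave :: "(nat \<Rightarrow> 'g) \<Rightarrow> (nat \<Rightarrow> 'g list) \<Rightarrow> nat \<Rightarrow> 'g list" where
  "interleave l e n = e 0 @ concat (map (\<lambda>i. l i # e i) [1..<Suc n])"

lemma interleave_0 [simp]: "interleave l e 0 = e 0"
  by (simp add: interleave_def)

lemma interleave_Suc [simp]: "interleave l e (Suc n) = interleave l e n @ l (Suc n) # e (Suc n)"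
  by (simp add: interleave_def)

lemma interleave_cong:
  "(\<And>i. i \<le> n \<Longrightarrow> e i = e' i) \<Longrightarrow> (\<And>i. i \<in> {1..n} \<Longrightarrow> l i = l' i) \<Longrightarrow> interleave l e n = interleave l' e' n"
  by (induction n) auto

text \<open>Used with \<open>P\<close> selecting the loop generators, so that the blocks are the
  loop-free stretches.\<close>

lemma interleave_exists:
  "\<exists>n l e. xs = interleave l e n \<and> (\<forall>i\<le>n. \<forall>x\<in>set (e i). \<not> P x) \<and> (\<forall>i\<in>{1..n}. P (l i))"
proof (induction xs rule: rev_induct)
  case Nil
  show ?case by (rule exI[of _ 0], intro exI[of _ "\<lambda>_. undefined"] exI[of _ "\<lambda>_. []"]) simp
next
  case (snoc x xs)
  then obtain n l e where *: "xs = interleave l e n" "\<forall>i\<le>n. \<forall>x\<in>set (e i). \<not> P x" "\<forall>i\<in>{1..n}. P (l i)"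
    by blast
  show ?case
  proof (cases "P x")
    case True
    have "xs @ [x] = interleave (l(Suc n := x)) (e(Suc n := [])) (Suc n)"
      using * interleave_cong[of n "e(Suc n := [])" e "l(Suc n := x)" l] by simp
    moreover have "\<forall>i\<le>Suc n. \<forall>x\<in>set ((e(Suc n := [])) i). \<not> P x" "\<forall>i\<in>{1..Suc n}. P ((l(Suc n := x)) i)"
      using * True by (auto simp: le_Suc_eq)
    ultimately show ?thesis by blast
  next
    case False
    have "xs @ [x] = interleave l (e(n := e n @ [x])) n"
      using * interleave_cong[of "n - 1" "e(n := e n @ [x])" e l l] by (cases n) auto
    moreover have "\<forall>i\<le>n. \<forall>y\<in>set ((e(n := e n @ [x])) i). \<not> P y" using * False by auto
    ultimately show ?thesis using * by blast
  qed
qed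

lemma interleave_infix: "i \<le> n \<Longrightarrow> \<exists>p q. interleave l e n = p @ e i @ q"
proof (induction n)
  case (Suc n)
  show ?case
  proof (cases "i = Suc n")
    case True
    then show ?thesis by (intro exI[of _ "interleave l e n @ [l (Suc n)]"] exI[of _ "[]"]) simp
  next
    case False
    then obtain p q where "interleave l e n = p @ e i @ q" using Suc by auto
    then show ?thesis by (intro exI[of _ p] exI[of _ "q @ l (Suc n) # e (Suc n)"]) simp
  qed
qed (auto intro!: exI[of _ "[]"])

lemma interleave_filter:
  "(\<forall>i\<le>n. \<forall>x\<in>set (e i). \<not> P x) \<Longrightarrow> (\<forall>i\<in>{1..n}. P (l i)) \<Longrightarrow> length (filter P (interleave l e n)) = n"
proof (induction n)
  case (Suc n)
  have "\<forall>x\<in>set (e (Suc n)). \<not> P x" using Suc.prems(1) by blast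
  then have "filter P (e (Suc n)) = []" by (simp add: filter_empty_conv)
  moreover have "length (filter P (interleave l e n)) = n" by (rule Suc.IH) (use Suc.prems in \<open>auto simp: le_Suc_eq\<close>)
  moreover have "P (l (Suc n))" using Suc.prems(2) by auto
  ultimately show ?case by simp
qed (simp add: filter_empty_conv)

lemma interleave_letter: "i \<in> {1..n} \<Longrightarrow> l i \<in> set (interleave l e n)"
  by (induction n) (auto simp: le_Suc_eq)

context coxeter_groupoid
begin

text \<open>For \<open>u i\<close> the product of block \<open>i\<close>, the value at
  \<open>i\<close> collects the blocks in front of the \<open>i\<close>-th loop; it is the element
  that conjugates this loop.\<close>

primrec partial_prod :: "(nat \<Rightarrow> 'a) \<Rightarrow> nat \<Rightarrow> 'a" where
  "partial_prod u 0 = \<one>"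
| "partial_prod u (Suc i) = partial_prod u i \<otimes> u i"

lemma partial_prod_cong: "(\<And>j. j < i \<Longrightarrow> u j = u' j) \<Longrightarrow> partial_prod u i = partial_prod u' i"
  by (induction i) auto

text \<open>A loop has equal source and target, so one vertex \<open>z i\<close> serves both sides
  of \<open>l i\<close>.\<close>

lemma path_interleaveD:
  assumes "path y (interleave l e n) x" "\<And>i. i \<in> {1..n} \<Longrightarrow> l i \<in> Loops"
  shows "\<exists>z. z 0 = y \<and> z (Suc n) = x \<and> (\<forall>i\<le>n. path (z i) (e i) (z (Suc i))) \<and> (\<forall>i\<in>{1..n}. z i = fst (l i))"
  using assms
proof (induction n arbitrary: x)
  case 0
  then show ?case by (intro exI[of _ "\<lambda>i. if i = 0 then y else x"]) auto
next
  case (Suc n)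
  obtain m where m: "path y (interleave l e n) m" "tgt (l (Suc n)) = m" "path (fst (l (Suc n))) (e (Suc n)) x"
    using Suc.prems(1) unfolding interleave_Suc path_append by auto
  then have m': "m = fst (l (Suc n))" using Suc.prems(2)[of "Suc n"] by (simp add: loop_iff)
  obtain z where z: "z 0 = y" "z (Suc n) = m" "\<forall>i\<le>n. path (z i) (e i) (z (Suc i))" "\<forall>i\<in>{1..n}. z i = fst (l i)"
    using Suc.IH[OF m(1)] Suc.prems(2) by auto
  have "\<forall>i\<le>Suc n. path ((z(Suc (Suc n) := x)) i) (e i) ((z(Suc (Suc n) := x)) (Suc i))"
    using z m m' by (auto simp: le_Suc_eq)
  moreover have "\<forall>i\<in>{1..Suc n}. (z(Suc (Suc n) := x)) i = fst (l i)" using z m' by (auto simp: le_Suc_eq)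
  ultimately show ?case using z by (intro exI[of _ "z(Suc (Suc n) := x)"]) auto
qed

lemma path_interleaveI:
  assumes "\<And>i. i \<le> n \<Longrightarrow> path (z i) (e i) (z (Suc i))" "\<And>i. i \<in> {1..n} \<Longrightarrow> l i \<in> Loops \<and> fst (l i) = z i"
  shows "path (z 0) (interleave l e n) (z (Suc n))"
  using assms
proof (induction n)
  case (Suc n)
  then have "path (z 0) (interleave l e n) (z (Suc n))" by auto
  moreover have "path (z (Suc n)) (l (Suc n) # e (Suc n)) (z (Suc (Suc n)))"
    using Suc.prems(1)[of "Suc n"] Suc.prems(2)[of "Suc n"] by (auto simp: loop_iff)
  ultimately show ?case unfolding interleave_Suc path_append by blast
qed auto

lemma lens_interleave:
  "lens (interleave l e n) = (\<Sum>i\<le>n. lens (e i)) + (\<Sum>i\<in>{1..n}. len (elt (l i)))"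
  by (induction n) auto

text \<open>Since block \<open>i\<close> has the product
  \<open>inv (v i) \<otimes> v (Suc i)\<close>, each loop moves to the left as a conjugate while the
  blocks collect in \<open>v (Suc n)\<close>.\<close>

lemma elts_interleave:
  assumes "set (interleave l e n) \<subseteq> Gens"
  defines "v \<equiv> partial_prod (\<lambda>i. elts (e i))"
  shows "elts (interleave l e n) =
      word_prod W (map (\<lambda>i. v i \<otimes> elt (l i) \<otimes> inv (v i)) [1..<Suc n]) \<otimes> v (Suc n)"
    and "\<And>i. i \<le> Suc n \<Longrightarrow> v i \<in> carrier W"
    and "word_prod W (map (\<lambda>i. v i \<otimes> elt (l i) \<otimes> inv (v i)) [1..<Suc n]) \<in> carrier W"
proof -
  let ?P = "\<lambda>n. word_prod W (map (\<lambda>i. v i \<otimes> elt (l i) \<otimes> inv (v i)) [1..<Suc n])"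
  have "elts (interleave l e n) = ?P n \<otimes> v (Suc n) \<and> (\<forall>i\<le>Suc n. v i \<in> carrier W) \<and> ?P n \<in> carrier W"
    using assms(1)
  proof (induction n)
    case 0
    then show ?case unfolding v_def using gens_elts_carrier by (auto simp: le_Suc_eq)
  next
    case (Suc n)
    let ?r = "elt (l (Suc n))" and ?E = "elts (e (Suc n))"
    have IH: "elts (interleave l e n) = ?P n \<otimes> v (Suc n)" "\<forall>i\<le>Suc n. v i \<in> carrier W" "?P n \<in> carrier W"
      using Suc by auto
    have r: "?r \<in> carrier W" and E: "?E \<in> carrier W" using Suc.prems gen_elt_carrier gens_elts_carrier by auto
    have vS: "v (Suc n) \<in> carrier W" using IH(2) by simp
    have f: "v (Suc n) \<otimes> ?r \<otimes> inv (v (Suc n)) \<in> carrier W" using vS r by simp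
    have v2: "v (Suc (Suc n)) = v (Suc n) \<otimes> ?E" unfolding v_def by simp
    have fc: "v i \<otimes> elt (l i) \<otimes> inv (v i) \<in> carrier W" if "i \<in> {1..n}" for i
    proof -
      have "l i \<in> set (interleave l e n)" by (rule interleave_letter[OF that])
      then have "l i \<in> Gens" using Suc.prems by auto
      then show ?thesis using IH(2) that gen_elt_carrier[of "l i"] by simp
    qed
    have "?P (Suc n) = word_prod W (map (\<lambda>i. v i \<otimes> elt (l i) \<otimes> inv (v i)) [1..<Suc n] @
        [v (Suc n) \<otimes> ?r \<otimes> inv (v (Suc n))])" by simp
    also have "\<dots> = ?P n \<otimes> word_prod W [v (Suc n) \<otimes> ?r \<otimes> inv (v (Suc n))]"
    proof (rule word_prod_append)
      show "set (map (\<lambda>i. v i \<otimes> elt (l i) \<otimes> inv (v i)) [1..<Suc n]) \<subseteq> carrier W"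
        using fc by (auto simp: less_Suc_eq_le)
    qed (use f in simp)
    finally have PS: "?P (Suc n) = ?P n \<otimes> (v (Suc n) \<otimes> ?r \<otimes> inv (v (Suc n)))" using f by simp
    have "elts (interleave l e (Suc n)) = elts (interleave l e n) \<otimes> elts (l (Suc n) # e (Suc n))"
      unfolding interleave_Suc by (rule elts_append) (use Suc.prems in auto)
    also have "\<dots> = ?P n \<otimes> v (Suc n) \<otimes> (?r \<otimes> ?E)" using IH(1) by simp
    also have "\<dots> = ?P n \<otimes> (v (Suc n) \<otimes> ?r \<otimes> (inv (v (Suc n)) \<otimes> v (Suc n)) \<otimes> ?E)"
      using IH(3) vS r E by (simp add: m_assoc)
    also have "\<dots> = ?P (Suc n) \<otimes> v (Suc (Suc n))"
      unfolding PS v2 using IH(3) vS r E by (simp only: m_assoc m_closed inv_closed)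
    finally have "elts (interleave l e (Suc n)) = ?P (Suc n) \<otimes> v (Suc (Suc n))" .
    moreover have "?P (Suc n) \<in> carrier W" unfolding PS using IH(3) f by simp
    moreover have "\<forall>i\<le>Suc (Suc n). v i \<in> carrier W" using IH(2) v2 vS E by (auto simp: le_Suc_eq)
    ultimately show ?case by blast
  qed
  then show "elts (interleave l e n) = ?P n \<otimes> v (Suc n)" "\<And>i. i \<le> Suc n \<Longrightarrow> v i \<in> carrier W"
    "?P n \<in> carrier W" by auto
qed

lemma partial_prod_Yset:
  assumes "\<And>i. i \<le> n \<Longrightarrow> path (z i) (e i) (z (Suc i)) \<and> set (e i) \<subseteq> NLoops" "i \<le> Suc n"
  shows "partial_prod (\<lambda>i. elts (e i)) i \<in> Ys (z 0) (z i)"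
  using assms(2)
proof (induction i)
  case (Suc i)
  then have "elts (e i) \<in> Ys (z i) (z (Suc i))" "z (Suc i) \<in> V"
    using assms(1)[of i] nonloop_path_Yset path_props by auto
  then show ?case using Suc Yset_mult by simp
qed (simp add: Yset_one)

lemma loop_decomposition:
  assumes std: "std y x w \<xi>s"
  obtains n l e z v where "n = card (pinv x w)" "v = partial_prod (\<lambda>i. elts (e i))"
    "z 0 = y" "z (Suc n) = x"
    "\<And>i. i \<le> n \<Longrightarrow> std (z i) (z (Suc i)) (elts (e i)) (e i)"
    "\<And>i. i \<in> {1..n} \<Longrightarrow> l i \<in> Loops \<and> fst (l i) = z i"
    "\<And>i. i \<le> Suc n \<Longrightarrow> v i \<in> Ys y (z i)"
    "w = word_prod W (map (\<lambda>i. v i \<otimes> elt (l i) \<otimes> inv (v i)) [1..<Suc n]) \<otimes> v (Suc n)"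
    "len w = (\<Sum>i\<le>n. len (elts (e i))) + (\<Sum>i\<in>{1..n}. len (elt (l i)))"
    "\<And>i. i \<le> Suc n \<Longrightarrow> z i \<in> V"
proof -
  obtain n l e where \<xi>s: "\<xi>s = interleave l e n" and nl: "\<forall>i\<le>n. \<forall>\<xi>\<in>set (e i). \<not> \<xi> \<in> Loops"
    and L: "\<forall>i\<in>{1..n}. l i \<in> Loops" using interleave_exists[of \<xi>s "\<lambda>\<xi>. \<xi> \<in> Loops"] by blast
  have p: "path y (interleave l e n) x" using std unfolding std_iff \<xi>s by blast
  have LL: "\<And>i. i \<in> {1..n} \<Longrightarrow> l i \<in> Loops" using L by blast
  obtain z where z: "z 0 = y" "z (Suc n) = x" "\<forall>i\<le>n. path (z i) (e i) (z (Suc i))" "\<forall>i\<in>{1..n}. z i = fst (l i)"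
    using path_interleaveD[OF p LL] by blast
  have e: "path (z i) (e i) (z (Suc i)) \<and> set (e i) \<subseteq> NLoops" if "i \<le> n" for i
    using z(3) nl that path_props[of "z i" "e i"] unfolding nonloop_gens_def by blast
  have len_e: "len (elts (e i)) = lens (e i)" if "i \<le> n" for i
  proof -
    obtain p q where "interleave l e n = p @ e i @ q" using interleave_infix[OF \<open>i \<le> n\<close>] by blast
    then have "std y x w (p @ e i @ q)" using std unfolding \<xi>s by simp
    then obtain y' where "std y' x (elts (e i @ q)) (e i @ q)" by (rule std_split)
    then obtain y'' where "std y' y'' (elts (e i)) (e i)" by (rule std_split)
    then show ?thesis unfolding std_iff by blast
  qed
  define v where "v = partial_prod (\<lambda>i. elts (e i))"
  have Gn: "set (interleave l e n) \<subseteq> Gens" using path_props[OF p] by blast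
  note el = elts_interleave[OF Gn, folded v_def]
  show ?thesis
  proof (rule that)
    show "n = card (pinv x w)" using std_loop_count[OF std] interleave_filter[OF nl L] unfolding \<xi>s by simp
    show "v = partial_prod (\<lambda>i. elts (e i))" by (rule v_def)
    show "z 0 = y" "z (Suc n) = x" using z by auto
    show "std (z i) (z (Suc i)) (elts (e i)) (e i)" if "i \<le> n" for i
      using e[OF that] len_e[OF that] unfolding std_iff by blast
    show "l i \<in> Loops \<and> fst (l i) = z i" if "i \<in> {1..n}" for i using that L z(4) by auto
    show "v i \<in> Ys y (z i)" if "i \<le> Suc n" for i
      using partial_prod_Yset[of n z e i] e that unfolding v_def z(1) by blast
    show "w = word_prod W (map (\<lambda>i. v i \<otimes> elt (l i) \<otimes> inv (v i)) [1..<Suc n]) \<otimes> v (Suc n)"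
      using std el(1) unfolding std_iff \<xi>s by simp
    have "len w = lens (interleave l e n)" using std unfolding std_iff \<xi>s by blast
    then show "len w = (\<Sum>i\<le>n. len (elts (e i))) + (\<Sum>i\<in>{1..n}. len (elt (l i)))"
      unfolding lens_interleave using len_e by simp
    show "z i \<in> V" if "i \<le> Suc n" for i
    proof (cases i)
      case 0
      then show ?thesis using e[of 0] path_props by blast
    next
      case (Suc j)
      then show ?thesis using e[of j] path_props that by auto
    qed
  qed
qed

text \<open>These turn out to be the simple roots of $\Phi^{\perp[x]}$.\<close>
definition loop_roots :: "('l \<Rightarrow> 'a) \<Rightarrow> 'a vec set" where
  "loop_roots x = {w \<star> \<gamma> | w \<gamma> s y. y \<in> V \<and> loop_reflection W S \<Lambda> b y s \<gamma> \<and> w \<in> Ys x y}"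

abbreviation "rfl \<equiv> reflection W S"
abbreviation "Wp x \<equiv> Wperp W S (x ` \<Lambda>)"

lemma loop_rootsE:
  assumes "\<delta> \<in> loop_roots x"
  obtains w \<gamma> s y where "y \<in> V" "(y, s) \<in> Loops" "\<gamma> \<in> \<Phi>p" "elt (y, s) = rfl \<gamma>" "w \<in> Ys x y" "\<delta> = w \<star> \<gamma>"
    "rfl \<delta> = w \<otimes> rfl \<gamma> \<otimes> inv w"
  using assms reflection_conj_act pos_root_root Yset_carrier
  unfolding loop_roots_def loop_reflection_def by blast

lemma loop_rootsI:
  assumes "y \<in> V" "(y, s) \<in> Loops" "\<gamma> \<in> \<Phi>p" "elt (y, s) = rfl \<gamma>" "w \<in> Ys x y"
  shows "w \<star> \<gamma> \<in> loop_roots x"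
  using assms unfolding loop_roots_def loop_reflection_def by blast

lemma loop_roots_perp_pos:
  assumes "\<delta> \<in> loop_roots x" shows "\<delta> \<in> perp x" "\<delta> \<in> \<Phi>p"
proof -
  obtain w \<gamma> s y where *: "y \<in> V" "(y, s) \<in> Loops" "\<gamma> \<in> \<Phi>p" "elt (y, s) = rfl \<gamma>" "w \<in> Ys x y" "\<delta> = w \<star> \<gamma>"
    using assms by (rule loop_rootsE)
  have g: "\<gamma> \<in> perp y" by (rule loop_perp_inversions(2)[OF *(2-4)])
  show "\<delta> \<in> perp x" unfolding *(6) by (rule perp_act[OF Yset_Cset[OF *(5)] *(1) g])
  show "\<delta> \<in> \<Phi>p" unfolding *(6) by (rule Yset_act_pos[OF *(5,3) g])
qed

text \<open>Arrows of \<open>Y\<close> respect positivity of orthogonal roots, so the claim can be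
  moved to \<open>y\<close>, where the loop reflection inverts no root orthogonal to [y] except its
  own.\<close>

lemma loop_root_act_pos:
  assumes x: "x \<in> V" and \<delta>: "\<delta> \<in> loop_roots x" and \<beta>: "\<beta> \<in> \<Phi>p" "\<beta> \<in> perp x" "\<beta> \<noteq> \<delta>"
  shows "rfl \<delta> \<star> \<beta> \<in> \<Phi>p"
proof -
  obtain w \<gamma> s y where *: "y \<in> V" "(y, s) \<in> Loops" "\<gamma> \<in> \<Phi>p" "elt (y, s) = rfl \<gamma>" "w \<in> Ys x y" "\<delta> = w \<star> \<gamma>"
    "rfl \<delta> = w \<otimes> rfl \<gamma> \<otimes> inv w" using \<delta> by (rule loop_rootsE)
  note wc = Yset_carrier[OF *(5)] and inv = Yset_inv[OF *(1) x *(5)]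
  note rc = reflection_closed[OF pos_root_root[OF *(3)]]
  have g: "\<gamma> \<in> perp y" by (rule loop_perp_inversions(2)[OF *(2-4)])
  define \<beta>' where "\<beta>' = inv w \<star> \<beta>"
  have b: "\<beta>' \<in> \<Phi>p" "\<beta>' \<in> perp y" unfolding \<beta>'_def
    using Yset_act_pos[OF inv \<beta>(1,2)] perp_act[OF Yset_Cset[OF inv] x \<beta>(2)] by auto
  have "w \<star> \<beta>' = \<beta>" unfolding \<beta>'_def using wc by simp
  then have "\<beta>' \<noteq> \<gamma>" using \<beta>(3) *(6) by blast
  then have "\<beta>' \<notin> inversions (rfl \<gamma>)" using loop_perp_inversions(1)[OF *(2-4)] b *(4) by auto
  then have "rfl \<gamma> \<star> \<beta>' \<in> \<Phi>p" using b unfolding inversions_def by blast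
  moreover have "rfl \<gamma> \<star> \<beta>' \<in> perp y" by (rule perp_act[OF perp_reflection_Cset[OF *(1) g] *(1) b(2)])
  ultimately have "w \<star> rfl \<gamma> \<star> \<beta>' \<in> \<Phi>p" by (rule Yset_act_pos[OF *(5)])
  then show ?thesis unfolding *(7) \<beta>'_def using wc rc by (simp add: act_mult)
qed

lemma finite_pinv [simp]: "w \<in> carrier W \<Longrightarrow> finite (pinv x w)"
  unfolding pinv_def by simp

lemma refl_refl_act: "\<gamma> \<in> \<Phi> \<Longrightarrow> rfl \<gamma> \<star> rfl \<gamma> \<star> v = v"
  by (simp add: act_mult[symmetric] reflection_involution reflection_closed)

lemma mult_refl_refl: "w \<in> carrier W \<Longrightarrow> \<gamma> \<in> \<Phi> \<Longrightarrow> w \<otimes> rfl \<gamma> \<otimes> rfl \<gamma> = w"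
  by (simp add: m_assoc reflection_involution reflection_closed)

text \<open>As in \<open>inversions_ascent\<close>, with orthogonal positive roots in place of all
  positive roots and \<open>loop_root_act_pos\<close> in place of
  \<open>gen_act_pos\<close>.\<close>

lemma card_pinv_ascent:
  assumes x: "x \<in> V" and w: "w \<in> carrier W" and \<delta>: "\<delta> \<in> loop_roots x" and asc: "w \<star> \<delta> \<in> \<Phi>p"
  shows "card (pinv x (w \<otimes> rfl \<delta>)) = Suc (card (pinv x w))"
proof -
  note dp = loop_roots_perp_pos[OF \<delta>]
  note root = pos_root_root[OF dp(2)]
  note rc = reflection_closed[OF root]
  note rC = perp_reflection_Cset[OF x dp(1)]
  note rr = refl_refl_act[OF root]
  have "pinv x (w \<otimes> rfl \<delta>) = insert \<delta> ((\<star>) (rfl \<delta>) ` pinv x w)"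
  proof (intro equalityI subsetI)
    fix \<gamma> assume g: "\<gamma> \<in> pinv x (w \<otimes> rfl \<delta>)"
    then have g': "\<gamma> \<in> \<Phi>p" "\<gamma> \<in> perp x" "w \<star> rfl \<delta> \<star> \<gamma> \<notin> \<Phi>p"
      using w rc unfolding pinv_def inversions_def by (auto simp: act_mult)
    show "\<gamma> \<in> insert \<delta> ((\<star>) (rfl \<delta>) ` pinv x w)"
    proof (cases "\<gamma> = \<delta>")
      case False
      then have "rfl \<delta> \<star> \<gamma> \<in> pinv x w"
        using loop_root_act_pos[OF x \<delta> g'(1,2)] perp_act[OF rC x g'(2)] g'(3)
        unfolding pinv_def inversions_def by blast
      moreover have "\<gamma> = rfl \<delta> \<star> rfl \<delta> \<star> \<gamma>" using rr by simp
      ultimately show ?thesis by blast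
    qed simp
  next
    fix \<gamma> assume "\<gamma> \<in> insert \<delta> ((\<star>) (rfl \<delta>) ` pinv x w)"
    then consider "\<gamma> = \<delta>" | \<beta> where "\<beta> \<in> pinv x w" "\<gamma> = rfl \<delta> \<star> \<beta>" by blast
    then show "\<gamma> \<in> pinv x (w \<otimes> rfl \<delta>)"
    proof cases
      case 1
      have "- (w \<star> \<delta>) \<notin> \<Phi>p" using asc not_pos_neg by blast
      then show ?thesis using 1 dp w rc unfolding pinv_def inversions_def
        by (simp add: act_mult reflection_self[OF root] act_linear)
    next
      case 2
      then have b: "\<beta> \<in> \<Phi>p" "\<beta> \<in> perp x" "w \<star> \<beta> \<notin> \<Phi>p" "\<beta> \<noteq> \<delta>"
        using asc unfolding pinv_def inversions_def by auto
      then have "\<gamma> \<in> \<Phi>p" "\<gamma> \<in> perp x" "w \<star> rfl \<delta> \<star> \<gamma> \<notin> \<Phi>p"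
        using loop_root_act_pos[OF x \<delta> b(1,2,4)] perp_act[OF rC x b(2)] rr unfolding 2(2) by auto
      then show ?thesis using w rc unfolding pinv_def inversions_def by (simp add: act_mult)
    qed
  qed
  moreover have "\<delta> \<notin> (\<star>) (rfl \<delta>) ` pinv x w"
  proof
    assume "\<delta> \<in> (\<star>) (rfl \<delta>) ` pinv x w"
    then obtain \<beta> where b: "\<beta> \<in> pinv x w" "\<delta> = rfl \<delta> \<star> \<beta>" by blast
    then have "rfl \<delta> \<star> \<delta> = \<beta>" using rr by metis
    then have "\<beta> = - \<delta>" using reflection_self[OF root] by simp
    then show False using b(1) dp(2) not_pos_neg unfolding pinv_def inversions_def by auto
  qed
  ultimately show ?thesis using w rc by simp
qed

lemma card_pinv_descent:
  assumes x: "x \<in> V" and w: "w \<in> carrier W" and \<delta>: "\<delta> \<in> loop_roots x" and desc: "w \<star> \<delta> \<notin> \<Phi>p"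
  shows "card (pinv x w) = Suc (card (pinv x (w \<otimes> rfl \<delta>)))"
proof -
  note dp = loop_roots_perp_pos[OF \<delta>]
  note root = pos_root_root[OF dp(2)]
  note rc = reflection_closed[OF root]
  have "- (w \<star> \<delta>) \<in> \<Phi>p" using neg_iff[OF root_act[OF root w]] desc by blast
  then have "(w \<otimes> rfl \<delta>) \<star> \<delta> \<in> \<Phi>p"
    using w rc by (simp add: act_mult reflection_self[OF root] act_linear)
  from card_pinv_ascent[OF x _ \<delta> this] show ?thesis using w rc mult_refl_refl[OF w root] by simp
qed

text \<open>Sending \<gamma> to \<open>- (w \<star> \<gamma>)\<close> embeds the orthogonal
  inversions of \<open>w\<close> into those of its inverse.\<close>

lemma card_pinv_inv:
  assumes x: "x \<in> V" and w: "w \<in> Cs x x" shows "card (pinv x (inv w)) = card (pinv x w)"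
proof -
  have le: "card (pinv x u) \<le> card (pinv x (inv u))" if u: "u \<in> Cs x x" for u
  proof (rule card_inj_on_le)
    note uc = Cset_carrier[OF u]
    show "inj_on (\<lambda>\<gamma>. - (u \<star> \<gamma>)) (pinv x u)" using uc by (auto simp: inj_on_def)
    show "finite (pinv x (inv u))" using uc by simp
    show "(\<lambda>\<gamma>. - (u \<star> \<gamma>)) ` pinv x u \<subseteq> pinv x (inv u)"
    proof (rule image_subsetI)
      fix \<gamma> assume "\<gamma> \<in> pinv x u"
      then have g: "\<gamma> \<in> \<Phi>p" "\<gamma> \<in> perp x" "u \<star> \<gamma> \<notin> \<Phi>p" unfolding pinv_def inversions_def by auto
      have up: "u \<star> \<gamma> \<in> perp x" by (rule perp_act[OF u x g(2)])
      have "- (u \<star> \<gamma>) \<in> \<Phi>p" using neg_iff[OF perp_root[OF up]] g(3) by blast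
      moreover have "inv u \<star> (- (u \<star> \<gamma>)) = - \<gamma>" using uc by (simp add: act_linear)
      ultimately show "- (u \<star> \<gamma>) \<in> pinv x (inv u)"
        using perp_uminus[OF up] not_pos_neg[OF g(1)] unfolding pinv_def inversions_def by simp
    qed
  qed
  from le[OF w] le[OF Cset_inv[OF w]] show ?thesis using Cset_carrier[OF w] by simp
qed

text \<open>Take the last loop of a standard expression. The letters after it form an arrow of
  \<open>Y\<close>, so its root pulled back along them is a loop root at \<open>x\<close>. The
  suffix inverts it, and inversions of a suffix are inversions of \<open>w\<close>.\<close>

lemma loop_root_inversion:
  assumes x: "x \<in> V" and y: "y \<in> V" and w: "w \<in> Cs y x" and ne: "pinv x w \<noteq> {}"
  shows "\<exists>\<delta>\<in>loop_roots x. \<delta> \<in> inversions w"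
proof -
  obtain \<xi>s where std: "std y x w \<xi>s" using std_exists[OF x y w] by blast
  have "card (pinv x w) \<noteq> 0" using ne Cset_carrier[OF w] by simp
  then have "\<exists>\<xi>\<in>set \<xi>s. \<xi> \<in> Loops" using std_loop_count[OF std] by (auto simp: filter_empty_conv)
  then obtain p l q where pq: "\<xi>s = p @ l # q" "l \<in> Loops" "\<forall>\<xi>\<in>set q. \<not> \<xi> \<in> Loops"
    using split_list_last_prop[of \<xi>s "\<lambda>\<xi>. \<xi> \<in> Loops"] by blast
  obtain z s where l: "l = (z, s)" by fastforce
  have "std y x w (p @ l # q)" using std pq(1) by simp
  then obtain y1 where s1: "std y1 x (elts (l # q)) (l # q)" "w = elts p \<otimes> elts (l # q)"
    "len (elts p \<otimes> elts (l # q)) = len (elts p) + len (elts (l # q))" "std y y1 (elts p) p" by (rule std_split)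
  have G: "(z, s) \<in> Gens" "set q \<subseteq> Gens" using std_props(4)[OF s1(1)] l by auto
  have path: "path z q x" using s1(1) l unfolding std_iff by simp
  have qY: "elts q \<in> Ys z x" by (rule nonloop_path_Yset[OF path]) (use G(2) pq(3) in \<open>auto simp: nonloop_gens_def\<close>)
  have z: "z \<in> V" using path_props[OF path] by blast
  obtain \<gamma> where g: "\<gamma> \<in> \<Phi>p" "elt (z, s) = rfl \<gamma>" "\<gamma> \<in> perp z" using loop_gen_reflection[of z s] pq(2) l by blast
  note root = pos_root_root[OF g(1)]
  note qc = Yset_carrier[OF qY]
  define \<delta> where "\<delta> = inv (elts q) \<star> \<gamma>"
  have d: "\<delta> \<in> loop_roots x" unfolding \<delta>_def
    by (rule loop_rootsI[OF z _ g(1,2) Yset_inv[OF x z qY]]) (use pq(2) l in simp)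
  have "elts (l # q) \<star> \<delta> = - \<gamma>"
    unfolding \<delta>_def l using g(2) qc reflection_closed[OF root] by (simp add: act_mult reflection_self[OF root])
  then have "\<delta> \<in> inversions (elts (l # q))"
    using loop_roots_perp_pos(2)[OF d] not_pos_neg[OF g(1)] unfolding inversions_def by simp
  then show ?thesis using d len_add_iff[OF std_props(5)[OF s1(4)] std_props(5)[OF s1(1)]] s1(2,3) by blast
qed

lemma perp_refl_inversion:
  assumes x: "x \<in> V" and g: "\<gamma> \<in> \<Phi>p" "\<gamma> \<in> perp x"
  obtains \<delta> where "\<delta> \<in> loop_roots x" "rfl \<gamma> \<star> \<delta> \<notin> \<Phi>p"
proof -
  have "\<gamma> \<in> pinv x (rfl \<gamma>)"
    using g reflection_self[OF pos_root_root[OF g(1)]] not_pos_neg[OF g(1)] unfolding pinv_def inversions_def by simp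
  then obtain \<delta> where "\<delta> \<in> loop_roots x" "\<delta> \<in> inversions (rfl \<gamma>)"
    using loop_root_inversion[OF x x perp_reflection_Cset[OF x g(2)]] by blast
  then show ?thesis using that unfolding inversions_def by blast
qed

lemma loop_refls_carrier: "rfl ` loop_roots x \<subseteq> carrier W"
  using loop_roots_perp_pos pos_root_root reflection_closed by blast

text \<open>Conjugation by a loop reflection whose root is inverted lowers the number of orthogonal
  inversions by two, one for each side; \<open>card_pinv_inv\<close> turns the left side into the
  right one.\<close>

lemma perp_refl_generated:
  assumes x: "x \<in> V" and "\<gamma> \<in> \<Phi>p" "\<gamma> \<in> perp x"
  shows "rfl \<gamma> \<in> generate W (rfl ` loop_roots x)"
  using assms(2,3)
proof (induction "card (pinv x (rfl \<gamma>))" arbitrary: \<gamma> rule: less_induct)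
  case less
  note g = less.prems
  note root = pos_root_root[OF g(1)] and rC = perp_reflection_Cset[OF x g(2)]
  note rc = reflection_closed[OF root]
  obtain \<delta> where d: "\<delta> \<in> loop_roots x" "rfl \<gamma> \<star> \<delta> \<notin> \<Phi>p" using perp_refl_inversion[OF x g] by blast
  note dp = loop_roots_perp_pos[OF d(1)]
  note droot = pos_root_root[OF dp(2)]
  note dc = reflection_closed[OF droot] and dC = perp_reflection_Cset[OF x dp(1)]
  show ?case
  proof (cases "\<gamma> = \<delta>")
    case True
    then show ?thesis using d(1) by (auto intro: generate.incl)
  next
    case False
    let ?\<gamma> = "rfl \<delta> \<star> \<gamma>"
    have g': "?\<gamma> \<in> \<Phi>p" "?\<gamma> \<in> perp x"
      using loop_root_act_pos[OF x d(1) g False] perp_act[OF dC x g(2)] by auto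
    have eq: "rfl ?\<gamma> = rfl \<delta> \<otimes> rfl \<gamma> \<otimes> rfl \<delta>"
      using reflection_conj_act[OF root dc] reflection_inv[OF droot] by simp
    have 1: "card (pinv x (rfl \<gamma>)) = Suc (card (pinv x (rfl \<gamma> \<otimes> rfl \<delta>)))"
      by (rule card_pinv_descent[OF x rc d])
    have "inv (rfl \<gamma> \<otimes> rfl \<delta>) = rfl \<delta> \<otimes> rfl \<gamma>"
      using rc dc by (simp add: inv_mult_group reflection_inv root droot)
    then have 2: "card (pinv x (rfl \<gamma> \<otimes> rfl \<delta>)) = card (pinv x (rfl \<delta> \<otimes> rfl \<gamma>))"
      using card_pinv_inv[OF x Cset_mult[OF rC dC]] by simp
    \<comment> \<open>The descent on the second side needs \<open>rfl \<delta>\<close> to keep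
      \<beta> positive, hence \<beta> different from \<delta>: equality would make \<gamma> and
      \<delta> proportional.\<close>
    define \<beta> where "\<beta> = - (rfl \<gamma> \<star> \<delta>)"
    have up: "rfl \<gamma> \<star> \<delta> \<in> perp x" by (rule perp_act[OF rC x dp(1)])
    have b: "\<beta> \<in> \<Phi>p" "\<beta> \<in> perp x" unfolding \<beta>_def
      using neg_iff[OF perp_root[OF up]] d(2) perp_uminus[OF up] by blast+
    have "\<beta> \<noteq> \<delta>"
    proof
      assume "\<beta> = \<delta>"
      then have "\<delta> = scale_vec (form W \<gamma> \<delta>) \<gamma>"
        unfolding \<beta>_def reflection_act[OF root root_keys[OF droot]]
        by (auto simp: vec_eq_iff lookup_minus algebra_simps)
      then show False using pos_parallel_eq[OF dp(2) g(1)] False by blast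
    qed
    then have "rfl \<delta> \<star> \<beta> \<in> \<Phi>p" by (rule loop_root_act_pos[OF x d(1) b])
    then have "- (rfl \<delta> \<star> rfl \<gamma> \<star> \<delta>) \<in> \<Phi>p" unfolding \<beta>_def using dc by (simp add: act_linear)
    then have "(rfl \<delta> \<otimes> rfl \<gamma>) \<star> \<delta> \<notin> \<Phi>p" using not_pos_neg dc rc by (auto simp: act_mult)
    then have "card (pinv x (rfl \<delta> \<otimes> rfl \<gamma>)) = Suc (card (pinv x (rfl ?\<gamma>)))"
      unfolding eq using card_pinv_descent[OF x _ d(1)] dc rc by simp
    then have "rfl ?\<gamma> \<in> generate W (rfl ` loop_roots x)" using less.hyps[OF _ g'] 1 2 by simp
    moreover have "rfl \<delta> \<in> generate W (rfl ` loop_roots x)" using d(1) by (auto intro: generate.incl)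
    ultimately have "rfl \<delta> \<otimes> rfl ?\<gamma> \<otimes> rfl \<delta> \<in> generate W (rfl ` loop_roots x)"
      by (intro generate.eng)
    moreover have "rfl \<delta> \<otimes> rfl ?\<gamma> \<otimes> rfl \<delta> = rfl \<gamma>"
    proof -
      have "rfl \<delta> \<otimes> rfl ?\<gamma> \<otimes> rfl \<delta> = rfl \<delta> \<otimes> rfl \<delta> \<otimes> rfl \<gamma> \<otimes> (rfl \<delta> \<otimes> rfl \<delta>)"
        unfolding eq using dc rc by (simp only: m_assoc m_closed)
      then show ?thesis using dc rc by (simp add: reflection_involution droot)
    qed
    ultimately show ?thesis by simp
  qed
qed

lemma Wperp_eq: assumes x: "x \<in> V" shows "Wp x = generate W (rfl ` loop_roots x)"
proof
  have sub: "rfl ` perp x \<subseteq> generate W (rfl ` loop_roots x)"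
  proof (rule image_subsetI)
    fix \<gamma> assume g: "\<gamma> \<in> perp x"
    show "rfl \<gamma> \<in> generate W (rfl ` loop_roots x)"
    proof (cases "\<gamma> \<in> \<Phi>p")
      case True
      then show ?thesis using perp_refl_generated[OF x _ g] by blast
    next
      case False
      then have "- \<gamma> \<in> \<Phi>p" using neg_iff[OF perp_root[OF g]] by blast
      then show ?thesis using perp_refl_generated[OF x _ perp_uminus[OF g]] reflection_uminus[OF perp_root[OF g]] by simp
    qed
  qed
  show "Wp x \<subseteq> generate W (rfl ` loop_roots x)"
    unfolding Wperp_def by (rule generate_subgroup_incl[OF sub generate_is_subgroup[OF loop_refls_carrier]])
  show "generate W (rfl ` loop_roots x) \<subseteq> Wp x"
    unfolding Wperp_def by (rule mono_generate) (use loop_roots_perp_pos(1) in blast)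
qed

lemma Wperp_subgroup: "subgroup (Wp x) W"
  unfolding Wperp_def by (rule generate_is_subgroup) (use perp_root reflection_closed in blast)

lemma Cset_subgroup: "subgroup (Cs x x) W"
  by (rule subgroup.intro) (use Cset_carrier Cset_mult Cset_one Cset_inv in blast)+

lemma Wperp_Cset: assumes x: "x \<in> V" shows "Wp x \<subseteq> Cs x x"
  unfolding Wperp_def by (rule generate_subgroup_incl[OF _ Cset_subgroup]) (use perp_reflection_Cset[OF x] in blast)

end

lemma map_image_exists: "set ws \<subseteq> f ` A \<Longrightarrow> \<exists>xs. set xs \<subseteq> A \<and> ws = map f xs"
proof (induction ws)
  case (Cons w ws)
  then obtain xs x where "set xs \<subseteq> A" "ws = map f xs" "x \<in> A" "w = f x" by auto
  then show ?case by (intro exI[of _ "x # xs"]) auto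
qed simp

section \<open>Length with respect to the loop reflections\<close>

context coxeter_groupoid
begin

lemma word_prod_subgroup: "subgroup H W \<Longrightarrow> set ws \<subseteq> H \<Longrightarrow> word_prod W ws \<in> H"
  by (induction ws) (auto intro: subgroup.one_closed subgroup.m_closed)

abbreviation "rfls ds \<equiv> word_prod W (map rfl ds)"

lemma loop_refl_Wperp: "x \<in> V \<Longrightarrow> rfl ` loop_roots x \<subseteq> Wp x"
  unfolding Wperp_eq by (auto intro: generate.incl)

lemma rfls_Wperp: "x \<in> V \<Longrightarrow> set ds \<subseteq> loop_roots x \<Longrightarrow> rfls ds \<in> Wp x"
  by (rule word_prod_subgroup[OF Wperp_subgroup]) (use loop_refl_Wperp in fastforce)

lemma rfls_Cset: "x \<in> V \<Longrightarrow> set ds \<subseteq> loop_roots x \<Longrightarrow> rfls ds \<in> Cs x x"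
  using rfls_Wperp Wperp_Cset by blast

text \<open>Letters acting from the right, \<delta> becomes negative at some letter
  \<open>d\<close>. Just before, its image is the one positive orthogonal root that
  \<open>rfl d\<close> negates, namely \<open>d\<close>; so \<open>rfl d\<close> is a conjugate of
  \<open>rfl \<delta>\<close> and this letter can be deleted.\<close>

lemma rfls_exchange:
  assumes x: "x \<in> V" and "set ds \<subseteq> loop_roots x" and \<delta>: "\<delta> \<in> loop_roots x" and "rfls ds \<star> \<delta> \<notin> \<Phi>p"
  shows "\<exists>es. set es \<subseteq> loop_roots x \<and> length ds = Suc (length es) \<and> rfls ds \<otimes> rfl \<delta> = rfls es"
  using assms(2,4)
proof (induction ds)
  case Nil
  then show ?case using loop_roots_perp_pos(2)[OF \<delta>] by simp
next
  case (Cons d ds)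
  note dp = loop_roots_perp_pos[OF \<delta>]
  note root = pos_root_root[OF dp(2)]
  note rc = reflection_closed[OF root]
  have d: "d \<in> loop_roots x" and ds: "set ds \<subseteq> loop_roots x" using Cons.prems by auto
  note C = rfls_Cset[OF x ds]
  note wc = Cset_carrier[OF C]
  have dc: "rfl d \<in> carrier W" using d loop_refls_carrier by blast
  show ?case
  proof (cases "rfls ds \<star> \<delta> \<in> \<Phi>p")
    case False
    then obtain es where es: "set es \<subseteq> loop_roots x" "length ds = Suc (length es)" "rfls ds \<otimes> rfl \<delta> = rfls es"
      using Cons.IH[OF ds] by blast
    have "rfls (d # ds) \<otimes> rfl \<delta> = rfls (d # es)" using es(3) dc wc rc by (simp add: m_assoc)
    then show ?thesis using es d by (intro exI[of _ "d # es"]) auto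
  next
    case True
    have "rfl d \<star> rfls ds \<star> \<delta> \<notin> \<Phi>p" using Cons.prems(2) dc wc by (simp add: act_mult)
    then have "d = rfls ds \<star> \<delta>"
      using loop_root_act_pos[OF x d True perp_act[OF C x dp(1)]] by blast
    then have "rfl d = rfls ds \<otimes> rfl \<delta> \<otimes> inv (rfls ds)" using reflection_conj_act[OF root wc] by simp
    then have "rfls (d # ds) \<otimes> rfl \<delta> = rfls ds \<otimes> rfl \<delta> \<otimes> (inv (rfls ds) \<otimes> rfls ds) \<otimes> rfl \<delta>"
      using wc rc by (simp only: word_prod_Cons list.map m_assoc m_closed inv_closed)
    then have "rfls (d # ds) \<otimes> rfl \<delta> = rfls ds" using wc rc mult_refl_refl[OF wc root] by simp
    then show ?thesis using ds by (intro exI[of _ ds]) auto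
  qed
qed

abbreviation "rlen x \<equiv> word_length W (rfl ` loop_roots x)"

lemma rlen_le: "set ds \<subseteq> loop_roots x \<Longrightarrow> rlen x (rfls ds) \<le> length ds"
  using word_length_le[of "map rfl ds" "rfl ` loop_roots x" W] by auto

lemma rlen_attained:
  assumes x: "x \<in> V" and w: "w \<in> Wp x"
  obtains ds where "set ds \<subseteq> loop_roots x" "rfls ds = w" "length ds = rlen x w"
proof -
  have "inv r = r" if "r \<in> rfl ` loop_roots x" for r
    using that loop_roots_perp_pos(2) pos_root_root reflection_inv by blast
  then obtain us where us: "set us \<subseteq> rfl ` loop_roots x" "word_prod W us = w"
    using generate_involutions_word[OF loop_refls_carrier[of x] _ w[unfolded Wperp_eq[OF x]]] by blast
  obtain ws where ws: "set ws \<subseteq> rfl ` loop_roots x" "word_prod W ws = w" "length ws = rlen x w"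
    using word_length_attained[OF us] by blast
  obtain ds where "set ds \<subseteq> loop_roots x" "ws = map rfl ds" using map_image_exists[OF ws(1)] by blast
  then show ?thesis using that ws by simp
qed

text \<open>Prefixes of a reduced word are reduced, and the last letter is an ascent of its prefix,
  since otherwise the exchange would shorten the word.\<close>

lemma reduced_rfls_pinv:
  assumes x: "x \<in> V" and "set ds \<subseteq> loop_roots x" "length ds = rlen x (rfls ds)"
  shows "card (pinv x (rfls ds)) = length ds"
  using assms(2,3)
proof (induction ds rule: rev_induct)
  case Nil
  then show ?case by (simp add: pinv_def)
next
  case (snoc d ds)
  have d: "d \<in> loop_roots x" and ds: "set ds \<subseteq> loop_roots x" using snoc.prems by auto
  have carr: "set (map rfl ds) \<subseteq> carrier W" "rfl d \<in> carrier W" using d ds loop_refls_carrier by auto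
  note wc = word_prod_closed[OF carr(1)]
  have eq: "rfls (es @ [d]) = rfls es \<otimes> rfl d" if "set es \<subseteq> loop_roots x" for es
  proof -
    have "set (map rfl es) \<subseteq> carrier W" using that loop_refls_carrier by auto
    then show ?thesis using carr by (simp add: word_prod_append)
  qed
  have "length ds = rlen x (rfls ds)"
  proof (rule ccontr)
    assume "length ds \<noteq> rlen x (rfls ds)"
    then have less: "rlen x (rfls ds) < length ds" using rlen_le[OF ds] by simp
    obtain es where es: "set es \<subseteq> loop_roots x" "rfls es = rfls ds" "length es = rlen x (rfls ds)"
      using rlen_attained[OF x rfls_Wperp[OF x ds]] by blast
    then have "rfls (es @ [d]) = rfls (ds @ [d])" using eq[OF es(1)] eq[OF ds] by simp
    then have "rlen x (rfls (ds @ [d])) \<le> length (es @ [d])" using rlen_le[of "es @ [d]"] es d by simp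
    then show False using snoc.prems(2) es less by simp
  qed
  from snoc.IH[OF ds this] have IH: "card (pinv x (rfls ds)) = length ds" .
  have "rfls ds \<star> d \<in> \<Phi>p"
  proof (rule ccontr)
    assume "rfls ds \<star> d \<notin> \<Phi>p"
    then obtain es where es: "set es \<subseteq> loop_roots x" "length ds = Suc (length es)" "rfls ds \<otimes> rfl d = rfls es"
      using rfls_exchange[OF x ds d] by blast
    then have "rlen x (rfls (ds @ [d])) \<le> length es" using rlen_le[OF es(1)] eq[OF ds] by simp
    then show False using snoc.prems(2) es(2) by simp
  qed
  from card_pinv_ascent[OF x wc d this] show ?case using eq[OF ds] IH by simp
qed

lemma rlen_eq: "x \<in> V \<Longrightarrow> w \<in> Wp x \<Longrightarrow> rlen x w = card (pinv x w)"
proof -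
  assume x: "x \<in> V" and w: "w \<in> Wp x"
  obtain ds where "set ds \<subseteq> loop_roots x" "rfls ds = w" "length ds = rlen x w" using rlen_attained[OF x w] .
  then show ?thesis using reduced_rfls_pinv[OF x] by metis
qed

text \<open>Without orthogonal inversions, the length as a product of loop reflections is 0.\<close>

lemma Wperp_Yset_trivial:
  assumes x: "x \<in> V" and w: "w \<in> Wp x" "w \<in> Ys x x" shows "w = \<one>"
proof -
  have "pinv x w = {}" using w(2) Yset_iff[OF x] by blast
  then have "rlen x w = 0" using rlen_eq[OF x w(1)] by simp
  moreover obtain ds where "rfls ds = w" "length ds = rlen x w" using rlen_attained[OF x w(1)] .
  ultimately show ?thesis by simp
qed

text \<open>Add the equation to its image under \<open>rfl \<delta>\<close>, so that the left side
  becomes 0. On the right a summand with \<open>\<beta> i = \<delta>\<close> gives 0, and any other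
  one a positive multiple of a sum of two positive roots, so there is no other one.\<close>

lemma loop_roots_indecomposable:
  assumes x: "x \<in> V" and \<delta>: "\<delta> \<in> loop_roots x"
    and \<beta>: "\<And>i. i < (n::nat) \<Longrightarrow> 0 < c i \<and> \<beta> i \<in> \<Phi>p \<and> \<beta> i \<in> perp x"
    and sum: "\<delta> = (\<Sum>i<n. scale_vec (c i) (\<beta> i))" and j: "j < n"
  shows "\<beta> j = \<delta>"
proof (rule ccontr)
  assume ne: "\<beta> j \<noteq> \<delta>"
  note dp = loop_roots_perp_pos[OF \<delta>]
  note root = pos_root_root[OF dp(2)]
  note rc = reflection_closed[OF root]
  have nonneg: "0 \<le> lk (\<beta> i) k + lk (rfl \<delta> \<star> \<beta> i) k" if "i < n" for i k
  proof (cases "\<beta> i = \<delta>")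
    case True
    then show ?thesis using reflection_self[OF root] by simp
  next
    case False
    then have "rfl \<delta> \<star> \<beta> i \<in> \<Phi>p" using loop_root_act_pos[OF x \<delta>] \<beta>[OF that] by blast
    then have "0 \<le> lk (rfl \<delta> \<star> \<beta> i) k" "0 \<le> lk (\<beta> i) k" using \<beta>[OF that] unfolding pos_roots_iff by blast+
    then show ?thesis by simp
  qed
  have "lk (\<beta> j) k = 0" for k
  proof -
    have "lk \<delta> k = (\<Sum>i<n. c i * lk (\<beta> i) k)"
      using arg_cong[OF sum, of "\<lambda>v. lk v k"] by (simp add: lookup_sum)
    moreover have "lk (rfl \<delta> \<star> \<delta>) k = (\<Sum>i<n. c i * lk (rfl \<delta> \<star> \<beta> i) k)"
      using arg_cong[OF sum, of "\<lambda>v. lk (rfl \<delta> \<star> v) k"] by (simp add: act_linear[OF rc] lookup_sum)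
    ultimately have "(\<Sum>i<n. c i * (lk (\<beta> i) k + lk (rfl \<delta> \<star> \<beta> i) k)) = lk \<delta> k + lk (rfl \<delta> \<star> \<delta>) k"
      by (simp add: sum.distrib distrib_left)
    also have "\<dots> = 0" using reflection_self[OF root] by simp
    finally have S0: "(\<Sum>i<n. c i * (lk (\<beta> i) k + lk (rfl \<delta> \<star> \<beta> i) k)) = 0" .
    have "c j * (lk (\<beta> j) k + lk (rfl \<delta> \<star> \<beta> j) k) = 0"
    proof (rule sum_nonneg_0[OF finite_lessThan _ S0])
      fix i assume "i \<in> {..<n}"
      then have i: "i < n" by simp
      show "0 \<le> c i * (lk (\<beta> i) k + lk (rfl \<delta> \<star> \<beta> i) k)"
        by (rule mult_nonneg_nonneg[OF _ nonneg[OF i]]) (use \<beta>[OF i] in simp)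
    qed (use j in simp)
    then have "lk (\<beta> j) k + lk (rfl \<delta> \<star> \<beta> j) k = 0" using \<beta>[OF j] by auto
    moreover have "rfl \<delta> \<star> \<beta> j \<in> \<Phi>p" using loop_root_act_pos[OF x \<delta>] \<beta>[OF j] ne by blast
    then have "0 \<le> lk (rfl \<delta> \<star> \<beta> j) k" "0 \<le> lk (\<beta> j) k" using \<beta>[OF j] unfolding pos_roots_iff by blast+
    ultimately show ?thesis by linarith
  qed
  then have "\<beta> j = 0" by (intro vec_eqI) simp
  then show False using \<beta>[OF j] root_nonzero pos_root_root by blast
qed

text \<open>For the inclusion that is still missing, let \<gamma> be no loop root. Some loop root
  \<delta> is inverted by \<open>rfl \<gamma>\<close>, which forces the two to pair positively; then
  \<gamma> is the sum of the positive root \<open>rfl \<delta> \<star> \<gamma>\<close> and a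
  positive multiple of \<delta>.\<close>

lemma perp_simple_roots_eq:
  assumes x: "x \<in> V" shows "perp_simple_roots W S (x ` \<Lambda>) = loop_roots x"
proof (intro equalityI subsetI)
  fix \<delta> assume d: "\<delta> \<in> loop_roots x"
  show "\<delta> \<in> perp_simple_roots W S (x ` \<Lambda>)"
    unfolding perp_simple_roots_def perp_pos_roots_def
    using loop_roots_perp_pos[OF d] loop_roots_indecomposable[OF x d] by blast
next
  fix \<gamma> assume g: "\<gamma> \<in> perp_simple_roots W S (x ` \<Lambda>)"
  then have gp: "\<gamma> \<in> \<Phi>p" "\<gamma> \<in> perp x" and indec: "\<And>n c \<beta>. (\<forall>i<(n::nat). 0 < c i \<and> \<beta> i \<in> perp_pos_roots W S (x ` \<Lambda>)) \<Longrightarrow>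
      \<gamma> = (\<Sum>i<n. scale_vec (c i) (\<beta> i)) \<Longrightarrow> \<forall>i<n. \<beta> i = \<gamma>"
    unfolding perp_simple_roots_def perp_pos_roots_def by blast+
  show "\<gamma> \<in> loop_roots x"
  proof (rule ccontr)
    assume not: "\<gamma> \<notin> loop_roots x"
    obtain \<delta> where d: "\<delta> \<in> loop_roots x" "rfl \<gamma> \<star> \<delta> \<notin> \<Phi>p" using perp_refl_inversion[OF x gp] .
    note dp = loop_roots_perp_pos[OF d(1)]
    note root = pos_root_root[OF gp(1)] and droot = pos_root_root[OF dp(2)]
    have ne: "\<gamma> \<noteq> \<delta>" using not d by blast
    define f where "f = form W \<gamma> \<delta>"
    have f': "form W \<delta> \<gamma> = f" unfolding f_def by (rule form_sym[OF root_keys[OF droot] root_keys[OF root]])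
    have eq: "rfl \<gamma> \<star> \<delta> = \<delta> - scale_vec (2 * f) \<gamma>"
      unfolding f_def by (rule reflection_act[OF root root_keys[OF droot]])
    \<comment> \<open>With a nonpositive pairing, \<open>rfl \<gamma> \<star> \<delta>\<close> would
      be a nonnegative combination of two positive roots.\<close>
    have "0 < f"
    proof (rule ccontr)
      assume "\<not> 0 < f"
      then have "2 * f \<le> 0" by simp
      moreover have "0 \<le> lk \<gamma> k" for k using gp(1) unfolding pos_roots_iff by blast
      ultimately have "(2 * f) * lk \<gamma> k \<le> 0" for k by (rule mult_nonpos_nonneg)
      moreover have "0 \<le> lk \<delta> k" for k using dp(2) unfolding pos_roots_iff by blast
      ultimately have "0 \<le> lk (\<delta> - scale_vec (2 * f) \<gamma>) k" for k
        unfolding lookup_minus lookup_scale_vec by (meson diff_ge_0_iff_ge order_trans)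
      then have "\<forall>k. 0 \<le> lk (rfl \<gamma> \<star> \<delta>) k" unfolding eq by blast
      then show False using d(2) root_act[OF droot reflection_closed[OF root]] unfolding pos_roots_iff by blast
    qed
    define \<gamma>' where "\<gamma>' = rfl \<delta> \<star> \<gamma>"
    have g': "\<gamma>' \<in> \<Phi>p" "\<gamma>' \<in> perp x" unfolding \<gamma>'_def
      using loop_root_act_pos[OF x d(1) gp ne] perp_act[OF perp_reflection_Cset[OF x dp(1)] x gp(2)] by auto
    have "\<gamma>' = \<gamma> - scale_vec (2 * f) \<delta>"
      unfolding \<gamma>'_def f'[symmetric] by (rule reflection_act[OF droot root_keys[OF root]])
    then have "scale_vec 1 \<gamma>' + scale_vec (2 * f) \<delta> = \<gamma>" by simp
    then have "\<gamma> = (\<Sum>i<(2::nat). scale_vec (if i = 0 then 1 else 2 * f) (if i = 0 then \<gamma>' else \<delta>))"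
      by (simp add: numeral_2_eq_2)
    moreover have "\<forall>i<2::nat. 0 < (if i = 0 then 1 else 2 * f) \<and> (if i = 0 then \<gamma>' else \<delta>) \<in> perp_pos_roots W S (x ` \<Lambda>)"
      using g' dp \<open>0 < f\<close> unfolding perp_pos_roots_def by auto
    ultimately have "\<forall>i<2::nat. (if i = 0 then \<gamma>' else \<delta>) = \<gamma>"
      using indec[of 2 "\<lambda>i. if i = 0 then 1 else 2 * f" "\<lambda>i. if i = 0 then \<gamma>' else \<delta>"] by blast
    \<comment> \<open>The summand with index 1 is \<delta>, so indecomposability would give
      \<open>\<delta> = \<gamma>\<close>.\<close>
    then have "(if (1::nat) = 0 then \<gamma>' else \<delta>) = \<gamma>" by (elim allE[of _ 1]) simp
    then show False using ne by simp
  qed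
qed

lemma Rperp_eq: "x \<in> V \<Longrightarrow> Rperp W S (x ` \<Lambda>) = rfl ` loop_roots x"
  unfolding Rperp_def by (simp add: perp_simple_roots_eq)

lemma Rperp_conjugates:
  assumes x: "x \<in> V"
  shows "Rperp W S (x ` \<Lambda>) = {w \<otimes> rfl \<gamma> \<otimes> inv w | w \<gamma> s y.
    y \<in> V \<and> loop_reflection W S \<Lambda> b y s \<gamma> \<and> w \<in> Ys x y}"
proof -
  have "rfl (w \<star> \<gamma>) = w \<otimes> rfl \<gamma> \<otimes> inv w" if "loop_reflection W S \<Lambda> b y s \<gamma>" "w \<in> Ys x y" for w \<gamma> s y
    using that reflection_conj_act[of \<gamma> w] pos_root_root Yset_carrier unfolding loop_reflection_def by blast
  then show ?thesis unfolding Rperp_eq[OF x] loop_roots_def image_Collect by (auto; metis)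
qed

section \<open>Factorization of arrows and transport between vertices\<close>

lemma Wperp_conj:
  assumes w: "w \<in> Cs y x" and x: "x \<in> V" and u: "u \<in> Wp x" shows "w \<otimes> u \<otimes> inv w \<in> Wp y"
  using u unfolding Wperp_def
proof (induction rule: generate.induct)
  case one
  then show ?case using Cset_carrier[OF w] by (simp add: generate.one)
next
  case (incl h)
  then obtain \<gamma> where g: "\<gamma> \<in> perp x" "h = rfl \<gamma>" by blast
  then have "w \<otimes> h \<otimes> inv w = rfl (w \<star> \<gamma>)" using reflection_conj_act perp_root Cset_carrier[OF w] by simp
  then show ?case using perp_act[OF w x g(1)] by (auto intro: generate.incl)
next
  case (inv h)
  then obtain \<gamma> where g: "\<gamma> \<in> perp x" "h = rfl \<gamma>" by blast
  then have "w \<otimes> inv h \<otimes> inv w = rfl (w \<star> \<gamma>)"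
    using reflection_conj_act reflection_inv perp_root Cset_carrier[OF w] by simp
  then show ?case using perp_act[OF w x g(1)] by (auto intro: generate.incl)
next
  case (eng h1 h2)
  have c: "h1 \<in> carrier W" "h2 \<in> carrier W" "w \<in> carrier W"
    using eng(1,2) Wperp_Cset[OF x] Cset_carrier w unfolding Wperp_def by blast+
  have "w \<otimes> (h1 \<otimes> h2) \<otimes> inv w = w \<otimes> h1 \<otimes> (inv w \<otimes> w) \<otimes> h2 \<otimes> inv w" using c by (simp add: m_assoc)
  also have "\<dots> = (w \<otimes> h1 \<otimes> inv w) \<otimes> (w \<otimes> h2 \<otimes> inv w)" using c by (simp only: m_assoc m_closed inv_closed)
  finally show ?case using eng(3,4) by (simp add: generate.eng)
qed

lemma loop_factor:
  assumes "v \<in> Ys x y" "l \<in> Loops" "fst l = y"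
  shows "v \<otimes> elt l \<otimes> inv v \<in> rfl ` loop_roots x"
proof -
  obtain s where l: "l = (y, s)" using assms(3) by (cases l) auto
  have y: "y \<in> V" using assms(2) fst_gen_vert[of l] assms(3) by (simp add: loop_iff)
  obtain \<gamma> where g: "\<gamma> \<in> \<Phi>p" "elt (y, s) = rfl \<gamma>" using loop_gen_reflection[of y s] assms(2) l by blast
  have "v \<star> \<gamma> \<in> loop_roots x" by (rule loop_rootsI[OF y _ g assms(1)]) (use assms(2) l in simp)
  moreover have "v \<otimes> elt l \<otimes> inv v = rfl (v \<star> \<gamma>)"
    unfolding l g(2) using reflection_conj_act[OF pos_root_root[OF g(1)] Yset_carrier[OF assms(1)]] by simp
  ultimately show ?thesis by blast
qed

text \<open>In the loop decomposition the conjugated loops form the factor in \<open>Wp y\<close>,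
  and the product of all loop-free blocks is the factor in \<open>Y\<close>.\<close>

lemma Cset_factor:
  assumes x: "x \<in> V" and y: "y \<in> V" and w: "w \<in> Cs y x"
  obtains r u where "r \<in> Wp y" "u \<in> Ys y x" "w = r \<otimes> u"
proof -
  obtain \<xi>s where "std y x w \<xi>s" using std_exists[OF x y w] by blast
  then obtain n l e z v where *: "z (Suc n) = x" "\<And>i. i \<in> {1..n} \<Longrightarrow> l i \<in> Loops \<and> fst (l i) = z i"
    "\<And>i. i \<le> Suc n \<Longrightarrow> v i \<in> Ys y (z i)"
    "w = word_prod W (map (\<lambda>i. v i \<otimes> elt (l i) \<otimes> inv (v i)) [1..<Suc n]) \<otimes> v (Suc n)"
    by (rule loop_decomposition) blast
  have "v i \<otimes> elt (l i) \<otimes> inv (v i) \<in> rfl ` loop_roots y" if "i \<in> {1..n}" for i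
    by (rule loop_factor[of _ _ "z i"]) (use that * in auto)
  then have "set (map (\<lambda>i. v i \<otimes> elt (l i) \<otimes> inv (v i)) [1..<Suc n]) \<subseteq> Wp y"
    using loop_refl_Wperp[OF y] by (auto simp: less_Suc_eq_le subset_iff simp del: upt_Suc)
  then have "word_prod W (map (\<lambda>i. v i \<otimes> elt (l i) \<otimes> inv (v i)) [1..<Suc n]) \<in> Wp y"
    by (rule word_prod_subgroup[OF Wperp_subgroup])
  moreover have "v (Suc n) \<in> Ys y x" using *(3)[of "Suc n"] *(1) by simp
  ultimately show ?thesis using that *(4) by blast
qed

lemma Cset_left_factor:
  assumes x: "x \<in> V" and y: "y \<in> V" shows "Cs y x = Wp y <#> Ys y x"
proof
  show "Cs y x \<subseteq> Wp y <#> Ys y x"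
  proof
    fix w assume "w \<in> Cs y x"
    then obtain r u where "r \<in> Wp y" "u \<in> Ys y x" "w = r \<otimes> u" using Cset_factor[OF x y] by blast
    then show "w \<in> Wp y <#> Ys y x" unfolding set_mult_def by blast
  qed
  show "Wp y <#> Ys y x \<subseteq> Cs y x"
    using Wperp_Cset[OF y] Yset_Cset Cset_mult unfolding set_mult_def by blast
qed

text \<open>The left factorization is turned around by conjugating its reflection part with
  \<open>inv u\<close>.\<close>

lemma Cset_right_factor:
  assumes x: "x \<in> V" and y: "y \<in> V" shows "Cs y x = Ys y x <#> Wp x"
proof
  show "Cs y x \<subseteq> Ys y x <#> Wp x"
  proof
    fix w assume "w \<in> Cs y x"
    then obtain r u where ru: "r \<in> Wp y" "u \<in> Ys y x" "w = r \<otimes> u" using Cset_factor[OF x y] by blast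
    have c: "r \<in> carrier W" "u \<in> carrier W" using ru Wperp_Cset[OF y] Cset_carrier Yset_carrier by blast+
    have "inv u \<otimes> r \<otimes> inv (inv u) \<in> Wp x" by (rule Wperp_conj[OF Cset_inv[OF Yset_Cset[OF ru(2)]] y ru(1)])
    moreover have "w = u \<otimes> (inv u \<otimes> r \<otimes> inv (inv u))" using c ru(3) by (simp add: m_assoc[symmetric])
    ultimately show "w \<in> Ys y x <#> Wp x" using ru(2) unfolding set_mult_def by blast
  qed
  show "Ys y x <#> Wp x \<subseteq> Cs y x"
    using Wperp_Cset[OF x] Yset_Cset Cset_mult unfolding set_mult_def by blast
qed

lemma Cset_semidirect:
  assumes x: "x \<in> V" shows "semidirect (W\<lparr>carrier := Cs x x\<rparr>) (Wp x) (Ys x x)"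
proof -
  let ?G = "W\<lparr>carrier := Cs x x\<rparr>"
  interpret G: group ?G by (rule subgroup_imp_group[OF Cset_subgroup])
  have Y: "subgroup (Ys x x) W"
    by (rule subgroup.intro) (use Yset_carrier Yset_mult[OF x] Yset_one Yset_inv[OF x x] in blast)+
  have N: "subgroup (Wp x) ?G" by (rule subgroup_incl[OF Wperp_subgroup Cset_subgroup Wperp_Cset[OF x]])
  have "Wp x \<lhd> ?G"
  proof (rule G.normal_invI[OF N])
    fix g h assume "g \<in> carrier ?G" "h \<in> Wp x"
    then show "g \<otimes>\<^bsub>?G\<^esub> h \<otimes>\<^bsub>?G\<^esub> inv\<^bsub>?G\<^esub> g \<in> Wp x"
      using Wperp_conj[OF _ x] m_inv_consistent[OF Cset_subgroup] by simp
  qed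
  moreover have "subgroup (Ys x x) ?G"
    by (rule subgroup_incl[OF Y Cset_subgroup]) (use Yset_Cset in blast)
  moreover have "Wp x \<inter> Ys x x = {\<one>}"
    using Wperp_Yset_trivial[OF x] subgroup.one_closed[OF Wperp_subgroup] Yset_one by blast
  moreover have "Wp x <#>\<^bsub>?G\<^esub> Ys x x = Cs x x"
    using Cset_left_factor[OF x x] unfolding set_mult_def by simp
  ultimately show ?thesis unfolding semidirect_def by simp
qed

text \<open>Loop roots are transports along \<open>Y\<close>, so composing arrows maps one set into
  the other, and the inverse arrow gives the reverse inclusion.\<close>

lemma loop_roots_transport:
  assumes x: "x \<in> V" and y: "y \<in> V" and w: "w \<in> Ys y x" shows "(\<star>) w ` loop_roots x = loop_roots y"
proof -
  have sub: "(\<star>) u ` loop_roots x' \<subseteq> loop_roots y'" if u: "u \<in> Ys y' x'" for u x' y'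
  proof (rule image_subsetI)
    fix \<delta> assume "\<delta> \<in> loop_roots x'"
    then obtain v \<gamma> s z where *: "z \<in> V" "(z, s) \<in> Loops" "\<gamma> \<in> \<Phi>p" "elt (z, s) = rfl \<gamma>" "v \<in> Ys x' z" "\<delta> = v \<star> \<gamma>"
      by (rule loop_rootsE)
    have "(u \<otimes> v) \<star> \<gamma> \<in> loop_roots y'" by (rule loop_rootsI[OF *(1-4) Yset_mult[OF *(1) u *(5)]])
    then show "u \<star> \<delta> \<in> loop_roots y'" using Yset_carrier[OF u] Yset_carrier[OF *(5)] *(6) by (simp add: act_mult)
  qed
  have "\<delta> \<in> (\<star>) w ` loop_roots x" if "\<delta> \<in> loop_roots y" for \<delta>
    using sub[OF Yset_inv[OF x y w]] that Yset_carrier[OF w] by (intro image_eqI[of _ _ "inv w \<star> \<delta>"]) auto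
  then show ?thesis using sub[OF w] by blast
qed

text \<open>Conjugation turns \<open>rfl \<delta>\<close> into the reflection in
  \<open>w \<star> \<delta>\<close>, and by \<open>loop_roots_transport\<close> these are again the
  generators.\<close>

lemma Wperp_coxeter_iso:
  assumes x: "x \<in> V" and y: "y \<in> V" and w: "w \<in> Ys y x"
  shows "(\<lambda>u. w \<otimes> u \<otimes> inv w) \<in> coxeter_isos (W\<lparr>carrier := Wp x\<rparr>) (Rperp W S (x ` \<Lambda>))
    (W\<lparr>carrier := Wp y\<rparr>) (Rperp W S (y ` \<Lambda>))"
proof -
  note wC = Yset_Cset[OF w] and wc = Yset_carrier[OF w]
  have cx: "u \<in> carrier W" if "u \<in> Wp x" for u using that Wperp_Cset[OF x] Cset_carrier by blast
  have cy: "u \<in> carrier W" if "u \<in> Wp y" for u using that Wperp_Cset[OF y] Cset_carrier by blast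
  let ?f = "\<lambda>u. w \<otimes> u \<otimes> inv w" and ?g = "\<lambda>u. inv w \<otimes> u \<otimes> inv (inv w)"
  have gf: "?g (?f u) = u" if "u \<in> carrier W" for u
  proof -
    have "?g (?f u) = (inv w \<otimes> w) \<otimes> u \<otimes> (inv w \<otimes> w)" using that wc by (simp only: m_assoc m_closed inv_closed inv_inv)
    then show ?thesis using that wc by simp
  qed
  have fg: "?f (?g u) = u" if "u \<in> carrier W" for u
  proof -
    have "?f (?g u) = (w \<otimes> inv w) \<otimes> u \<otimes> (w \<otimes> inv w)" using that wc by (simp only: m_assoc m_closed inv_closed inv_inv)
    then show ?thesis using that wc by simp
  qed
  have bij: "bij_betw ?f (Wp x) (Wp y)"
    by (rule bij_betw_byWitness[where f' = ?g])
      (use gf fg cx cy Wperp_conj[OF wC x] Wperp_conj[OF Cset_inv[OF wC] y] in \<open>auto simp del: inv_inv\<close>)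
  have "?f (u \<otimes> v) = ?f u \<otimes> ?f v" if "u \<in> carrier W" "v \<in> carrier W" for u v
  proof -
    have "?f (u \<otimes> v) = w \<otimes> u \<otimes> (inv w \<otimes> w) \<otimes> v \<otimes> inv w" using that wc by (simp add: m_assoc)
    then show ?thesis using that wc by (simp only: m_assoc m_closed inv_closed)
  qed
  then have "?f \<in> hom (W\<lparr>carrier := Wp x\<rparr>) (W\<lparr>carrier := Wp y\<rparr>)"
    using Wperp_conj[OF wC x] cx by (intro homI) auto
  then have iso: "?f \<in> iso (W\<lparr>carrier := Wp x\<rparr>) (W\<lparr>carrier := Wp y\<rparr>)" using bij by (simp add: iso_def)
  have refl_conj: "w \<otimes> rfl \<delta> \<otimes> inv w = rfl (w \<star> \<delta>)" if "\<delta> \<in> loop_roots x" for \<delta>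
    by (rule reflection_conj_act[OF pos_root_root[OF loop_roots_perp_pos(2)[OF that]] wc, symmetric])
  have "?f ` rfl ` loop_roots x = rfl ` (\<star>) w ` loop_roots x"
    unfolding image_image
    by (rule image_cong[OF HOL.refl refl_conj])
  then have "?f ` Rperp W S (x ` \<Lambda>) = Rperp W S (y ` \<Lambda>)"
    unfolding Rperp_eq[OF x] Rperp_eq[OF y] loop_roots_transport[OF x y w] .
  then show ?thesis using iso unfolding coxeter_isos_def by blast
qed

text \<open>This is the loop decomposition of a standard expression of \<open>w\<close>. Standard
  expressions of one block share product and total length, so inserting any other choice of them
  keeps the whole expression standard.\<close>

lemma Wperp_standard_factorization:
  assumes x: "x \<in> V" and w: "w \<in> Wp x"
  shows "\<exists>n y s \<gamma> v. n = lp W S \<Lambda> b x w \<and> y 0 = x \<and> y (Suc n) = x \<and> v 0 = \<one> \<and> v (Suc n) = \<one> \<and>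
    (\<forall>i \<in> {1..n}. y i \<in> V \<and> loop_reflection W S \<Lambda> b (y i) (s i) (\<gamma> i) \<and> v i \<in> Ys x (y i)) \<and>
    w = word_prod W (map (\<lambda>i. v i \<otimes> rfl (\<gamma> i) \<otimes> inv (v i)) [1..<Suc n]) \<and>
    (\<forall>i \<le> n. \<exists>\<xi>s. std (y i) (y (Suc i)) (inv (v i) \<otimes> v (Suc i)) \<xi>s) \<and>
    (\<forall>e. (\<forall>i \<le> n. std (y i) (y (Suc i)) (inv (v i) \<otimes> v (Suc i)) (e i)) \<longrightarrow>
      std x x w (e 0 @ concat (map (\<lambda>i. (y i, s i) # e i) [1..<Suc n])))"
proof -
  have wC: "w \<in> Cs x x" using w Wperp_Cset[OF x] by blast
  obtain \<xi>s where "std x x w \<xi>s" using std_exists[OF x x wC] by blast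
  then obtain n l e z v where n: "n = card (pinv x w)" and v: "v = partial_prod (\<lambda>i. elts (e i))"
    and z: "z 0 = x" "z (Suc n) = x" and e: "\<And>i. i \<le> n \<Longrightarrow> std (z i) (z (Suc i)) (elts (e i)) (e i)"
    and l: "\<And>i. i \<in> {1..n} \<Longrightarrow> l i \<in> Loops \<and> fst (l i) = z i"
    and vY: "\<And>i. i \<le> Suc n \<Longrightarrow> v i \<in> Ys x (z i)"
    and w_eq: "w = word_prod W (map (\<lambda>i. v i \<otimes> elt (l i) \<otimes> inv (v i)) [1..<Suc n]) \<otimes> v (Suc n)"
    and len: "len w = (\<Sum>i\<le>n. len (elts (e i))) + (\<Sum>i\<in>{1..n}. len (elt (l i)))"
    and zV: "\<And>i. i \<le> Suc n \<Longrightarrow> z i \<in> V"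
    by (rule loop_decomposition) blast
  let ?P = "word_prod W (map (\<lambda>i. v i \<otimes> elt (l i) \<otimes> inv (v i)) [1..<Suc n])"
  have "v i \<otimes> elt (l i) \<otimes> inv (v i) \<in> rfl ` loop_roots x" if "i \<in> {1..n}" for i
    by (rule loop_factor[of _ _ "z i"]) (use that vY l in auto)
  then have "set (map (\<lambda>i. v i \<otimes> elt (l i) \<otimes> inv (v i)) [1..<Suc n]) \<subseteq> Wp x"
    using loop_refl_Wperp[OF x] by (auto simp: less_Suc_eq_le subset_iff simp del: upt_Suc)
  then have P: "?P \<in> Wp x" by (rule word_prod_subgroup[OF Wperp_subgroup])
  have Pc: "?P \<in> carrier W" using P Wperp_Cset[OF x] Cset_carrier by blast
  have vn: "v (Suc n) \<in> Ys x x" using vY[of "Suc n"] z by simp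
  \<comment> \<open>The last partial product lies in the reflection part as well as in
    \<open>Y\<close>, and these meet only in 1.\<close>
  have "v (Suc n) = inv ?P \<otimes> w" using w_eq Pc Yset_carrier[OF vn] by (simp add: m_assoc[symmetric])
  also have "inv ?P \<otimes> w \<in> Wp x"
    using P w subgroup.m_inv_closed[OF Wperp_subgroup] subgroup.m_closed[OF Wperp_subgroup] by blast
  finally have vn1: "v (Suc n) = \<one>" using Wperp_Yset_trivial[OF x _ vn] by blast
  have "\<exists>\<gamma>. loop_reflection W S \<Lambda> b (z i) (snd (l i)) \<gamma>" if "i \<in> {1..n}" for i
  proof -
    have "(z i, snd (l i)) \<in> Loops" using l[OF that] by (metis prod.collapse)
    then show ?thesis using loop_gen_reflection unfolding loop_reflection_def by blast
  qed
  then obtain \<gamma> where \<gamma>: "\<And>i. i \<in> {1..n} \<Longrightarrow> loop_reflection W S \<Lambda> b (z i) (snd (l i)) (\<gamma> i)" by metis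
  have l_eq: "(z i, snd (l i)) = l i" if "i \<in> {1..n}" for i using l[OF that] by (metis prod.collapse)
  have elt_l: "elt (l i) = rfl (\<gamma> i)" if "i \<in> {1..n}" for i
    using \<gamma>[OF that] l_eq[OF that] unfolding loop_reflection_def by simp
  have w_eq': "w = word_prod W (map (\<lambda>i. v i \<otimes> rfl (\<gamma> i) \<otimes> inv (v i)) [1..<Suc n])"
  proof -
    have m: "map (\<lambda>i. v i \<otimes> elt (l i) \<otimes> inv (v i)) [1..<Suc n] = map (\<lambda>i. v i \<otimes> rfl (\<gamma> i) \<otimes> inv (v i)) [1..<Suc n]"
      using elt_l by (intro map_cong refl) (auto simp: less_Suc_eq_le simp del: upt_Suc)
    show ?thesis using w_eq Pc unfolding vn1 m by (simp del: upt_Suc)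
  qed
  have vstep: "inv (v i) \<otimes> v (Suc i) = elts (e i)" if "i \<le> n" for i
    using Yset_carrier[OF vY[of i]] std_props(5)[OF e[OF that]] that unfolding v by (simp add: m_assoc[symmetric])
  have std_any: "std x x w (e' 0 @ concat (map (\<lambda>i. (z i, snd (l i)) # e' i) [1..<Suc n]))"
    if e': "\<forall>i\<le>n. std (z i) (z (Suc i)) (inv (v i) \<otimes> v (Suc i)) (e' i)" for e'
  proof -
    let ?L = "interleave l e' n"
    have L: "e' 0 @ concat (map (\<lambda>i. (z i, snd (l i)) # e' i) [1..<Suc n]) = ?L"
      using interleave_cong[of n e' e' "\<lambda>i. (z i, snd (l i))" l] l_eq unfolding interleave_def by blast
    have s: "path (z i) (e' i) (z (Suc i))" "elts (e' i) = elts (e i)" "lens (e' i) = len (elts (e i))" if "i \<le> n" for i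
      using e' vstep[OF that] that unfolding std_iff by auto
    have path: "path x ?L x" using path_interleaveI[of n z e' l] s(1) l z by simp
    have G: "set ?L \<subseteq> Gens" using path_props[OF path] by blast
    have pp: "partial_prod (\<lambda>i. elts (e' i)) i = v i" if "i \<le> Suc n" for i
      unfolding v by (rule partial_prod_cong) (use s(2) that in auto)
    have m: "map (\<lambda>i. partial_prod (\<lambda>i. elts (e' i)) i \<otimes> elt (l i) \<otimes> inv (partial_prod (\<lambda>i. elts (e' i)) i)) [1..<Suc n] =
        map (\<lambda>i. v i \<otimes> elt (l i) \<otimes> inv (v i)) [1..<Suc n]"
      using pp by (intro map_cong refl) (auto simp: less_Suc_eq_le simp del: upt_Suc)
    have "elts ?L = w" using elts_interleave(1)[OF G] unfolding m pp[OF order_refl] w_eq[symmetric] .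
    moreover have "len w = lens ?L" unfolding lens_interleave len using s(3) by simp
    ultimately show ?thesis unfolding L std_iff using path by blast
  qed
  show ?thesis
  proof (intro exI conjI)
    show "n = lp W S \<Lambda> b x w" using lp_eq[OF x x wC] n by simp
    show "z 0 = x" "z (Suc n) = x" by (fact z)+
    show "v 0 = \<one>" unfolding v by simp
    show "v (Suc n) = \<one>" by (rule vn1)
    show "\<forall>i \<in> {1..n}. z i \<in> V \<and> loop_reflection W S \<Lambda> b (z i) (snd (l i)) (\<gamma> i) \<and> v i \<in> Ys x (z i)"
      using zV \<gamma> vY by simp
    show "w = word_prod W (map (\<lambda>i. v i \<otimes> rfl (\<gamma> i) \<otimes> inv (v i)) [1..<Suc n])" by (rule w_eq')
    show "\<forall>i \<le> n. \<exists>\<xi>s. std (z i) (z (Suc i)) (inv (v i) \<otimes> v (Suc i)) \<xi>s" using vstep e by metis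
    show "\<forall>e. (\<forall>i \<le> n. std (z i) (z (Suc i)) (inv (v i) \<otimes> v (Suc i)) (e i)) \<longrightarrow>
      std x x w (e 0 @ concat (map (\<lambda>i. (z i, snd (l i)) # e i) [1..<Suc n]))" using std_any by blast
  qed
qed

lemma std_nonloop_braid:
  "w \<in> Ys y x \<Longrightarrow> std y x w \<xi>s \<and> std y x w \<eta>s \<Longrightarrow> nbm\<^sup>*\<^sup>* \<xi>s \<eta>s"
  using std_braid_equivalent by blast

lemma expr_nonloop_reduces:
  "\<xi>s \<in> lists NLoops \<Longrightarrow> expr y x w \<xi>s \<and> std y x w \<eta>s \<Longrightarrow> (sup nbm cancel)\<^sup>*\<^sup>* \<xi>s \<eta>s"
  using expr_reduces[of y \<xi>s x \<eta>s] unfolding expression_def by (auto simp: in_lists_conv_set)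

lemma Yset_lp:
  assumes x: "x \<in> V" and y: "y \<in> V" shows "Ys y x = {w \<in> Cs y x. lp W S \<Lambda> b x w = 0}"
  using Yset_iff[OF x] lp_eq[OF x y] Cset_carrier by (auto simp: card_eq_0_iff)

lemma Wperp_length: "x \<in> V \<Longrightarrow> w \<in> Wp x \<Longrightarrow> word_length W (Rperp W S (x ` \<Lambda>)) w = lp W S \<Lambda> b x w"
  unfolding Rperp_eq using rlen_eq lp_eq[OF _ _ subsetD[OF Wperp_Cset]] by simp

end

theorem theorem4p6:
  fixes W :: "('a, 'b) monoid_scheme" and S I :: "'a set"
    and \<Lambda> :: "'l set" and b :: "'l \<Rightarrow> 'a"
  assumes "coxeter_system W S"
    and "I \<subseteq> S"
    and "b \<in> injections S \<Lambda>" and "b ` \<Lambda> = I"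
  shows
    "(\<forall>x \<in> verts W S \<Lambda> b. \<forall>y \<in> verts W S \<Lambda> b.
        Cset W S \<Lambda> y x = Wperp W S (y ` \<Lambda>) <#>\<^bsub>W\<^esub> Yset W S \<Lambda> y x \<and>
        Cset W S \<Lambda> y x = Yset W S \<Lambda> y x <#>\<^bsub>W\<^esub> Wperp W S (x ` \<Lambda>)) \<and>

     (\<forall>x \<in> verts W S \<Lambda> b. subgroup (Cset W S \<Lambda> x x) W \<and>
        semidirect (W\<lparr>carrier := Cset W S \<Lambda> x x\<rparr>) (Wperp W S (x ` \<Lambda>)) (Yset W S \<Lambda> x x)) \<and>

     (\<forall>x \<in> verts W S \<Lambda> b. \<forall>y \<in> verts W S \<Lambda> b.
        Yset W S \<Lambda> y x =
          {w. groupoid_gen W (verts W S \<Lambda> b) (nonloop_arrow W S \<Lambda> b) y x w} \<and>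
        Yset W S \<Lambda> y x = {w \<in> Cset W S \<Lambda> y x. lp W S \<Lambda> b x w = 0}) \<and>

     (\<forall>x \<in> verts W S \<Lambda> b. \<forall>y \<in> verts W S \<Lambda> b. \<forall>w \<in> Yset W S \<Lambda> y x.
        \<forall>\<xi>s \<in> lists (nonloop_gens W S \<Lambda> b). \<forall>\<eta>s \<in> lists (nonloop_gens W S \<Lambda> b).
          standard_expression W S \<Lambda> b y x w \<xi>s \<and> standard_expression W S \<Lambda> b y x w \<eta>s \<longrightarrow>
            (nonloop_braid_move W S \<Lambda> b)\<^sup>*\<^sup>* \<xi>s \<eta>s) \<and>

     (\<forall>x \<in> verts W S \<Lambda> b. \<forall>y \<in> verts W S \<Lambda> b. \<forall>w \<in> Yset W S \<Lambda> y x.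
        \<forall>\<xi>s \<in> lists (nonloop_gens W S \<Lambda> b). \<forall>\<eta>s \<in> lists (nonloop_gens W S \<Lambda> b).
          expression W S \<Lambda> b y x w \<xi>s \<and> standard_expression W S \<Lambda> b y x w \<eta>s \<longrightarrow>
            (sup (nonloop_braid_move W S \<Lambda> b) (cancel_move W S \<Lambda> b))\<^sup>*\<^sup>* \<xi>s \<eta>s) \<and>

     (\<forall>x \<in> verts W S \<Lambda> b. \<forall>w \<in> Wperp W S (x ` \<Lambda>).
        word_length W (Rperp W S (x ` \<Lambda>)) w = lp W S \<Lambda> b x w) \<and>

     (\<forall>x \<in> verts W S \<Lambda> b. Rperp W S (x ` \<Lambda>) =
        {w \<otimes>\<^bsub>W\<^esub> reflection W S \<gamma> \<otimes>\<^bsub>W\<^esub> inv\<^bsub>W\<^esub> w | w \<gamma> s y.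
           y \<in> verts W S \<Lambda> b \<and> loop_reflection W S \<Lambda> b y s \<gamma> \<and> w \<in> Yset W S \<Lambda> x y}) \<and>

     \<comment> \<open>\<open>v 0 = v (n + 1) = 1\<close> at the vertex \<open>y 0 = y (n + 1) = x\<close>, so that the elements
        \<open>inv (v i) \<otimes> v (i + 1)\<close>, \<open>0 \<le> i \<le> n\<close>, are those replaced by standard expressions \<open>e i\<close>
        (only the identity if \<open>n = 0\<close>)\<close>
     (\<forall>x \<in> verts W S \<Lambda> b. \<forall>w \<in> Wperp W S (x ` \<Lambda>). \<exists>n y s \<gamma> v.
        n = lp W S \<Lambda> b x w \<and>
        y 0 = x \<and> y (Suc n) = x \<and> v 0 = \<one>\<^bsub>W\<^esub> \<and> v (Suc n) = \<one>\<^bsub>W\<^esub> \<and>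
        (\<forall>i \<in> {1..n}. y i \<in> verts W S \<Lambda> b \<and> loop_reflection W S \<Lambda> b (y i) (s i) (\<gamma> i) \<and>
           v i \<in> Yset W S \<Lambda> x (y i)) \<and>
        w = word_prod W (map (\<lambda>i. v i \<otimes>\<^bsub>W\<^esub> reflection W S (\<gamma> i) \<otimes>\<^bsub>W\<^esub> inv\<^bsub>W\<^esub> (v i)) [1..<Suc n]) \<and>
        (\<forall>i \<le> n. \<exists>\<xi>s. standard_expression W S \<Lambda> b (y i) (y (Suc i))
           (inv\<^bsub>W\<^esub> (v i) \<otimes>\<^bsub>W\<^esub> v (Suc i)) \<xi>s) \<and>
        (\<forall>e. (\<forall>i \<le> n. standard_expression W S \<Lambda> b (y i) (y (Suc i))
                (inv\<^bsub>W\<^esub> (v i) \<otimes>\<^bsub>W\<^esub> v (Suc i)) (e i)) \<longrightarrow>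
           standard_expression W S \<Lambda> b x x w
             (e 0 @ concat (map (\<lambda>i. (y i, s i) # e i) [1..<Suc n])))) \<and>

     (\<forall>x \<in> verts W S \<Lambda> b. \<forall>y \<in> verts W S \<Lambda> b. \<forall>w \<in> Yset W S \<Lambda> y x.
        (\<lambda>u. w \<otimes>\<^bsub>W\<^esub> u \<otimes>\<^bsub>W\<^esub> inv\<^bsub>W\<^esub> w) \<in>
          coxeter_isos (W\<lparr>carrier := Wperp W S (x ` \<Lambda>)\<rparr>) (Rperp W S (x ` \<Lambda>))
                       (W\<lparr>carrier := Wperp W S (y ` \<Lambda>)\<rparr>) (Rperp W S (y ` \<Lambda>)))"
proof -
  interpret coxeter_groupoid W S \<Lambda> b
    by (intro coxeter_groupoid.intro coxeter_groupoid_axioms.intro assms)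
  show ?thesis
    by (intro conjI ballI impI)
      (rule Cset_left_factor Cset_right_factor Cset_subgroup Cset_semidirect Yset_generated Yset_lp
        std_nonloop_braid expr_nonloop_reduces Wperp_length Rperp_conjugates
        Wperp_standard_factorization Wperp_coxeter_iso; assumption)+
qed

end
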